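(* Let $P$ be a finite poset. Then \[ f_2(\mathcal{O}(P))=f_2^\Delta(\mathcal{O}(P))+f_2^\Box(\mathcal{O}(P))\le f_2^\Delta(\mathcal{C}(P))+f_2^\Box(\mathcal{C}(P))=f_2(\mathcal{C}(P)), \] with equality holding if and only if $P$ is $\mathbf{X}$-free.
   Context: For a finite poset $P$, the order polytope is $\mathcal{O}(P)=\{x\in\mathbb{R}^P: 0\le x_p\le 1 \text{ for all } p\in P,\ x_p\le x_q \text{ whenever } p\le q\}$ and the chain polytope is $\mathcal{C}(P)=\{x\in\mathbb{R}^P: x_p\ge 0 \text{ for all } p,\ x_{p_1}+\dots+x_{p_k}\le 1 \text{ whenever } p_1<\dots<p_k \text{ in } P\}$. For a polytope $\mathcal{P}$, $f_2(\mathcal{P})$ is the number of $2$-dimensional faces, $f_2^\Delta(\mathcal{P})$ the number of $2$-faces with exactly three vertices (triangular faces) and $f_2^\Box(\mathcal{P})$ the number of $2$-faces with exactly four vertices (square faces). $\mathbf{X}$ denotes the five-element poset with elements $d_1,d_2,e,u_1,u_2$ where $d_1,d_2<e<u_1,u_2$, $d_1\parallel d_2$ and $u_1\parallel u_2$; $P$ is $\mathbf{X}$-free if it contains no (induced) subposet isomorphic to $\mathbf{X}$. *)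

theory Defs
  imports "HOL-Analysis.Analysis"
begin

(* A finite poset P is a subset of a finite ordered type, with the induced order; unlike the
   choice P = UNIV, this does not exclude the empty poset.  The space R^P is identified with
   the coordinate subspace of real ^ 'a of the vectors vanishing outside P, so for P = UNIV the
   first condition in the two definitions below is void. *)

definition order_polytope :: "'a set \<Rightarrow> (real ^ 'a::{finite,order}) set" where
  "order_polytope P = {x. (\<forall>p. p \<notin> P \<longrightarrow> x $ p = 0) \<and>
     (\<forall>p\<in>P. 0 \<le> x $ p \<and> x $ p \<le> 1) \<and>
     (\<forall>p\<in>P. \<forall>q\<in>P. p \<le> q \<longrightarrow> x $ p \<le> x $ q)}"

definition chain_polytope :: "'a set \<Rightarrow> (real ^ 'a::{finite,order}) set" where
  "chain_polytope P = {x. (\<forall>p. p \<notin> P \<longrightarrow> x $ p = 0) \<and>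
     (\<forall>p\<in>P. 0 \<le> x $ p) \<and>
     (\<forall>ps. set ps \<subseteq> P \<and> sorted_wrt (<) ps \<longrightarrow> (\<Sum>p\<leftarrow>ps. x $ p) \<le> 1)}"

(* S itself is among its faces, so a polygon has exactly one 2-face. *)
definition two_faces :: "'b::euclidean_space set \<Rightarrow> 'b set set" where
  "two_faces S = {F. F face_of S \<and> aff_dim F = 2}"

definition f2 :: "'b::euclidean_space set \<Rightarrow> nat" where
  "f2 S = card (two_faces S)"

definition f2_triangle :: "'b::euclidean_space set \<Rightarrow> nat" where
  "f2_triangle S = card {F \<in> two_faces S. card {v. v extreme_point_of F} = 3}"

(* As usual for 2-faces, "square" only means having four vertices. *)
definition f2_square :: "'b::euclidean_space set \<Rightarrow> nat" where
  "f2_square S = card {F \<in> two_faces S. card {v. v extreme_point_of F} = 4}"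

definition incomparable :: "'a::order \<Rightarrow> 'a \<Rightarrow> bool" where
  "incomparable x y \<longleftrightarrow> \<not> x \<le> y \<and> \<not> y \<le> x"

(* The conditions force the five elements to be distinct and determine all relations among
   them, so they say exactly that d1, d2, e, u1, u2 form an induced copy of the poset X. *)
definition X_free :: "'a::order set \<Rightarrow> bool" where
  "X_free P \<longleftrightarrow> \<not> (\<exists>d1\<in>P. \<exists>d2\<in>P. \<exists>e\<in>P. \<exists>u1\<in>P. \<exists>u2\<in>P.
     d1 < e \<and> d2 < e \<and> e < u1 \<and> e < u2 \<and> incomparable d1 d2 \<and> incomparable u1 u2)"

end

theory Submission
  imports Defs
begin

text \<open>
  All vertices of both polytopes are 0/1 vectors, and a plane contains at most four vertices of the
  cube, so every 2-face is a triangle or a parallelogram. Two vertices, viewed as filters or as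
  antichains, span the face whose dimension is the number of connected components of their symmetric
  difference. Squares therefore correspond, in both polytopes, to an order-convex set \<open>E\<close> with two
  components and a filter (antichain) of the elements incomparable to \<open>E\<close>, and there are as many
  filters as antichains. Triangles are triples of vertices whose pairwise symmetric differences are connected.
  For the order polytope they are given by a connected order-convex \<open>E\<close> split into a connected
  downset and a connected upset; for the chain polytope by \<open>E\<close> and an antichain \<open>M\<close> in \<open>E\<close> whose
  symmetric differences with the sets of minimal and of maximal elements of \<open>E\<close> are connected.
  After fixing which minimal and which maximal elements lie on which side, both counts run over the
  remaining free elements \<open>Z\<close>: the first counts downsets \<open>I\<close> with \<open>f I\<close> and \<open>g (Z - I)\<close>, the second
  antichains \<open>A\<close> with \<open>f A\<close> and \<open>g A\<close>, where \<open>f\<close> and \<open>g\<close> are monotone connectivity conditions.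
  A Harris-type inequality, proved by removing a maximal element of \<open>Z\<close>, compares the two; it is
  strict as soon as an element is relevant to both \<open>f\<close> and \<open>g\<close>, which is a copy of the poset X.
\<close>

section \<open>Downsets and antichains\<close>

text \<open>Why antichains win: \<open>f\<close> and \<open>g\<close> both increase with their
  argument, so \<open>f A\<close> and \<open>g A\<close> grow together with \<open>A\<close>, while
  \<open>f I\<close> and \<open>g (Z - I)\<close> pull in opposite directions when \<open>I\<close>
  grows. The surplus is obtained as a number, not through an injection: removing a maximal
  \<open>p\<close> leaves two smaller differences and a sum of products of increments of
  \<open>f\<close> and \<open>g\<close>, which is nonnegative for monotone functions and vanishes
  when every element matters to at most one of the two. The two counts share \<open>Z\<close>,
  \<open>f\<close> and \<open>g\<close> only because the boundary data are read in opposite ways: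
  \<open>A\<close> is the set of minimal elements of \<open>E\<close> inside the downset
  \<open>D\<close>, but outside the antichain \<open>M\<close>, whereas \<open>B\<close> is the set
  of maximal elements inside \<open>D\<close> and inside \<open>M\<close>. With this choice
  \<open>A\<close> is the bottom layer of the lower piece of the split in both polytopes, and the
  elements whose membership \<open>A\<close> and \<open>B\<close> decide are the same.\<close>

definition antichains :: "'a::order set \<Rightarrow> 'a set set" where
  "antichains Z = {A. A \<subseteq> Z \<and> (\<forall>x\<in>A. \<forall>y\<in>A. x \<le> y \<longrightarrow> x = y)}"

definition downsets :: "'a::order set \<Rightarrow> 'a set set" where
  "downsets Z = {I. I \<subseteq> Z \<and> (\<forall>x\<in>I. \<forall>y\<in>Z. y \<le> x \<longrightarrow> y \<in> I)}"

definition filters :: "'a::order set \<Rightarrow> 'a set set" where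
  "filters Z = {I. I \<subseteq> Z \<and> (\<forall>x\<in>I. \<forall>y\<in>Z. x \<le> y \<longrightarrow> y \<in> I)}"

text \<open>Integer values allow the difference of two counts: for 0/1-valued \<open>f\<close> and
  \<open>g\<close> each of the sums is a cardinality.\<close>

definition gap :: "('a::order set \<Rightarrow> int) \<Rightarrow> ('a set \<Rightarrow> int) \<Rightarrow> 'a set \<Rightarrow> int" where
  "gap f g Z = (\<Sum>A\<in>antichains Z. f A * g A) - (\<Sum>I\<in>downsets Z. f I * g (Z - I))"

text \<open>On finite sets, \<open>f S\<close> then depends only on the maximal elements of
  \<open>S\<close> if \<open>le\<close> is \<open>\<le>\<close>, and only on the minimal ones if
  \<open>le\<close> is \<open>\<ge>\<close>.\<close>

definition absorbs :: "('a \<Rightarrow> 'a \<Rightarrow> bool) \<Rightarrow> ('a set \<Rightarrow> int) \<Rightarrow> bool" where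
  "absorbs le f \<longleftrightarrow> (\<forall>S x y. y \<in> S \<and> le x y \<longrightarrow> f (insert x S) = f S)"

lemma absorbs_Un:
  assumes f: "absorbs le f" and "finite X" and "\<And>x. x \<in> X \<Longrightarrow> \<exists>y\<in>S. le x y"
  shows "f (S \<union> X) = f S"
  using assms(2,3)
proof (induction X rule: finite_induct)
  case (insert x X)
  obtain y where "y \<in> S" "le x y" using insert.prems by blast
  then have "f (insert x (S \<union> X)) = f (S \<union> X)"
    using f unfolding absorbs_def by blast
  then show ?case using insert by auto
qed simp

lemma absorbs_insert: "absorbs le f \<Longrightarrow> absorbs le (\<lambda>S. f (insert p S))"
  unfolding absorbs_def by (metis insert_commute insert_iff)

lemma finite_antichains [simp]: "finite Z \<Longrightarrow> finite (antichains Z)"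
  unfolding antichains_def by (rule finite_subset [of _ "Pow Z"]) auto

lemma finite_downsets [simp]: "finite Z \<Longrightarrow> finite (downsets Z)"
  unfolding downsets_def by (rule finite_subset [of _ "Pow Z"]) auto

lemma finite_filters [simp]: "finite Z \<Longrightarrow> finite (filters Z)"
  unfolding filters_def by (rule finite_subset [of _ "Pow Z"]) auto

section \<open>Comparison of antichain sums and downset sums by removal of a maximal element\<close>

lemma antichains_maximal:
  assumes "p \<in> Z" and max: "\<forall>z\<in>Z. p \<le> z \<longrightarrow> z = p"
  shows "antichains Z = antichains (Z - {p}) \<union> insert p ` antichains {z\<in>Z. \<not> z \<le> p}"
proof (intro equalityI subsetI)
  fix A assume A: "A \<in> antichains Z"
  show "A \<in> antichains (Z - {p}) \<union> insert p ` antichains {z\<in>Z. \<not> z \<le> p}"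
  proof (cases "p \<in> A")
    case True
    then have "A = insert p (A - {p})" by blast
    moreover have "A - {p} \<in> antichains {z\<in>Z. \<not> z \<le> p}"
      using A True unfolding antichains_def by blast
    ultimately show ?thesis by blast
  next
    case False
    then show ?thesis using A unfolding antichains_def by auto
  qed
next
  fix A assume "A \<in> antichains (Z - {p}) \<union> insert p ` antichains {z\<in>Z. \<not> z \<le> p}"
  then show "A \<in> antichains Z"
    using assms unfolding antichains_def by auto
qed

text \<open>A downset through the maximal element \<open>p\<close> contains everything below
  \<open>p\<close>; the rest is a downset of the elements not below \<open>p\<close>, the same
  ground set that remains for an antichain through \<open>p\<close>. This coincidence makes the two
  sums comparable.\<close>

lemma downsets_maximal:
  assumes "p \<in> Z" and max: "\<forall>z\<in>Z. p \<le> z \<longrightarrow> z = p"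
  shows "downsets Z = downsets (Z - {p}) \<union>
    (\<lambda>I. I \<union> {z\<in>Z. z \<le> p}) ` downsets {z\<in>Z. \<not> z \<le> p}"
proof (intro equalityI subsetI)
  fix I assume I: "I \<in> downsets Z"
  show "I \<in> downsets (Z - {p}) \<union> (\<lambda>I. I \<union> {z\<in>Z. z \<le> p}) ` downsets {z\<in>Z. \<not> z \<le> p}"
  proof (cases "p \<in> I")
    case True
    have "I - {z\<in>Z. z \<le> p} \<in> downsets {z\<in>Z. \<not> z \<le> p}"
      using I unfolding downsets_def by blast
    moreover have "I = (I - {z\<in>Z. z \<le> p}) \<union> {z\<in>Z. z \<le> p}"
      using I True unfolding downsets_def by blast
    ultimately show ?thesis by blast
  next
    case False
    then show ?thesis using I unfolding downsets_def by auto
  qed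
next
  fix I assume "I \<in> downsets (Z - {p}) \<union> (\<lambda>I. I \<union> {z\<in>Z. z \<le> p}) ` downsets {z\<in>Z. \<not> z \<le> p}"
  then show "I \<in> downsets Z"
  proof
    assume "I \<in> downsets (Z - {p})"
    then show ?thesis
      using assms unfolding downsets_def by blast
  next
    assume "I \<in> (\<lambda>I. I \<union> {z\<in>Z. z \<le> p}) ` downsets {z\<in>Z. \<not> z \<le> p}"
    then obtain J where J: "J \<in> downsets {z\<in>Z. \<not> z \<le> p}" "I = J \<union> {z\<in>Z. z \<le> p}" by blast
    then show ?thesis
      unfolding downsets_def by (blast intro: order_trans)
  qed
qed

text \<open>For downsets, the terms without and with \<open>p\<close> already are the downset sums
  of the two smaller gaps. For antichains, with \<open>A'\<close> for \<open>insert p A\<close>, the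
  mismatch is \<open>f A' * g A' - f A * g A' + f A * g A - f A' * g A\<close>, which factors into
  the two increments.\<close>

lemma gap_maximal:
  fixes f g :: "'a::order set \<Rightarrow> int"
  assumes fin: "finite Z" and p: "p \<in> Z" and max: "\<forall>z\<in>Z. p \<le> z \<longrightarrow> z = p"
    and f: "absorbs (\<le>) f" and g: "absorbs (\<ge>) g"
  shows "gap f g Z = gap f (\<lambda>S. g (insert p S)) (Z - {p})
    + gap (\<lambda>S. f (insert p S)) g {z\<in>Z. \<not> z \<le> p}
    + (\<Sum>A\<in>antichains {z\<in>Z. \<not> z \<le> p}. (f (insert p A) - f A) * (g (insert p A) - g A))"
proof -
  let ?Y = "{z\<in>Z. \<not> z \<le> p}" and ?X = "Z - {p}"
  have fin': "finite ?Y" "finite ?X" using fin by auto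
  have inj: "inj_on (insert p) (antichains ?Y)"
  proof (rule inj_onI)
    fix A B assume "A \<in> antichains ?Y" "B \<in> antichains ?Y" and eq: "insert p A = insert p B"
    then have "p \<notin> A" "p \<notin> B" unfolding antichains_def by auto
    then show "A = B" using eq by (simp add: insert_ident)
  qed
  have "antichains ?X \<inter> insert p ` antichains ?Y = {}"
    unfolding antichains_def by auto
  then have 1: "(\<Sum>A\<in>antichains Z. f A * g A) = (\<Sum>A\<in>antichains ?X. f A * g A)
      + (\<Sum>A\<in>antichains ?Y. f (insert p A) * g (insert p A))"
    unfolding antichains_maximal [OF p max]
    using fin' inj by (simp add: sum.union_disjoint sum.reindex)
  have sub: "antichains ?Y \<subseteq> antichains ?X" unfolding antichains_def by auto
  \<comment> \<open>Replacing \<open>g A\<close> by \<open>g (insert p A)\<close> matters only if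
    \<open>A\<close> has no element below \<open>p\<close>; otherwise \<open>g\<close> absorbs
    \<open>p\<close>.\<close>
  have "(\<Sum>A\<in>antichains ?X. f A * (g (insert p A) - g A)) =
      (\<Sum>A\<in>antichains ?Y. f A * (g (insert p A) - g A))"
  proof (rule sum.mono_neutral_right [OF finite_antichains [OF fin'(2)] sub], intro ballI)
    fix A assume A: "A \<in> antichains ?X - antichains ?Y"
    then obtain y where "y \<in> A" "y \<le> p" unfolding antichains_def by auto
    then have "g (insert p A) = g A" using g unfolding absorbs_def by blast
    then show "f A * (g (insert p A) - g A) = 0" by simp
  qed
  then have 2: "(\<Sum>A\<in>antichains ?X. f A * g A) = (\<Sum>A\<in>antichains ?X. f A * g (insert p A))
      - (\<Sum>A\<in>antichains ?Y. f A * (g (insert p A) - g A))"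
    by (simp add: right_diff_distrib sum_subtractf)
  let ?h = "\<lambda>I. I \<union> {z\<in>Z. z \<le> p}"
  have injh: "inj_on ?h (downsets ?Y)"
  proof (rule inj_onI)
    fix I J assume "I \<in> downsets ?Y" "J \<in> downsets ?Y" and eq: "?h I = ?h J"
    then have "I = ?h I - {z\<in>Z. z \<le> p}" "J = ?h J - {z\<in>Z. z \<le> p}"
      unfolding downsets_def by blast+
    then show "I = J" using eq by simp
  qed
  have "p \<in> ?h I" for I using p by auto
  then have "downsets ?X \<inter> ?h ` downsets ?Y = {}"
    unfolding downsets_def by auto
  then have "(\<Sum>I\<in>downsets Z. f I * g (Z - I)) = (\<Sum>I\<in>downsets ?X. f I * g (Z - I))
      + (\<Sum>I\<in>downsets ?Y. f (?h I) * g (Z - ?h I))"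
    unfolding downsets_maximal [OF p max]
    using fin' injh by (simp add: sum.union_disjoint sum.reindex)
  also have "(\<Sum>I\<in>downsets ?X. f I * g (Z - I)) = (\<Sum>I\<in>downsets ?X. f I * g (insert p (?X - I)))"
  proof (intro sum.cong refl)
    fix I assume "I \<in> downsets ?X"
    then have "Z - I = insert p (?X - I)" using p unfolding downsets_def by auto
    then show "f I * g (Z - I) = f I * g (insert p (?X - I))" by simp
  qed
  also have "(\<Sum>I\<in>downsets ?Y. f (?h I) * g (Z - ?h I)) =
      (\<Sum>I\<in>downsets ?Y. f (insert p I) * g (?Y - I))"
  proof (intro sum.cong refl)
    fix I assume "I \<in> downsets ?Y"
    \<comment> \<open>\<open>f\<close> sees the whole principal downset of \<open>p\<close> through
      \<open>p\<close> alone.\<close>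
    have "f (insert p I \<union> {z\<in>Z. z \<le> p}) = f (insert p I)"
      by (rule absorbs_Un [OF f]) (use fin in auto)
    moreover have "insert p I \<union> {z\<in>Z. z \<le> p} = ?h I" using p by auto
    moreover have "Z - ?h I = ?Y - I" by auto
    ultimately show "f (?h I) * g (Z - ?h I) = f (insert p I) * g (?Y - I)" by simp
  qed
  finally have 3: "(\<Sum>I\<in>downsets Z. f I * g (Z - I)) =
      (\<Sum>I\<in>downsets ?X. f I * g (insert p (?X - I))) + (\<Sum>I\<in>downsets ?Y. f (insert p I) * g (?Y - I))" .
  show ?thesis
    unfolding gap_def 1 2 3 by (simp add: algebra_simps sum.distrib sum_subtractf)
qed

lemma ex_maximal:
  fixes Z :: "'a::order set"
  assumes "finite Z" "Z \<noteq> {}"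
  obtains p where "p \<in> Z" "\<forall>z\<in>Z. p \<le> z \<longrightarrow> z = p"
  using finite_has_maximal [OF assms] by metis

lemma gap_empty [simp]: "gap f g ({} :: 'a::order set) = 0"
proof -
  have "antichains ({}::'a set) = {{}}" "downsets ({}::'a set) = {{}}"
    unfolding antichains_def downsets_def by auto
  then show ?thesis unfolding gap_def by simp
qed

lemma card_removed:
  fixes p :: "'a::order"
  assumes "finite Z" "p \<in> Z"
  shows "card (Z - {p}) < card Z" "card {z\<in>Z. \<not> z \<le> p} < card Z"
proof -
  show "card (Z - {p}) < card Z" using assms by (rule card_Diff1_less)
  show "card {z\<in>Z. \<not> z \<le> p} < card Z" using assms by (intro psubset_card_mono) auto
qed

lemma mono_insert:
  assumes "mono f"
  shows "mono (\<lambda>S. f (insert p S))"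
  by (intro monoI monoD [OF assms] insert_mono)

text \<open>Each step of the recursion freezes \<open>p\<close> into one of the two functions, so
  the induction has to range over all \<open>f\<close> and \<open>g\<close>; monotonicity and
  absorption survive the freezing, and a product of two increments of monotone functions is
  nonnegative.\<close>

lemma gap_nonneg:
  fixes f g :: "'a::order set \<Rightarrow> int"
  assumes "finite Z" "absorbs (\<le>) f" "absorbs (\<ge>) g" "mono f" "mono g"
  shows "0 \<le> gap f g Z"
  using assms
proof (induction "card Z" arbitrary: Z f g rule: less_induct)
  case less
  show ?case
  proof (cases "Z = {}")
    case False
    obtain p where p: "p \<in> Z" "\<forall>z\<in>Z. p \<le> z \<longrightarrow> z = p"
      using ex_maximal [OF less.prems(1) False] by blast
    have "card (Z - {p}) < card Z" "card {z\<in>Z. \<not> z \<le> p} < card Z"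
      by (fact card_removed [OF less.prems(1) p(1)])+
    moreover have "mono (\<lambda>S. f (insert p S))" "mono (\<lambda>S. g (insert p S))"
      by (rule mono_insert [OF less.prems(4)], rule mono_insert [OF less.prems(5)])
    ultimately have "0 \<le> gap f (\<lambda>S. g (insert p S)) (Z - {p})"
      "0 \<le> gap (\<lambda>S. f (insert p S)) g {z\<in>Z. \<not> z \<le> p}"
      using less.prems by (auto intro!: less.hyps absorbs_insert)
    moreover have "0 \<le> (f (insert p A) - f A) * (g (insert p A) - g A)" for A
      using monoD [OF less.prems(4), of A "insert p A"] monoD [OF less.prems(5), of A "insert p A"]
      by (simp add: subset_insertI)
    ultimately show ?thesis
      unfolding gap_maximal [OF less.prems(1) p less.prems(2,3)]
      by (intro add_nonneg_nonneg sum_nonneg)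
  qed simp
qed

text \<open>Irrelevance is stated for all sets \<open>S\<close>, so it survives the insertion of
  \<open>p\<close> into either function; at each step one of the two increments at \<open>p\<close>
  vanishes.\<close>

lemma gap_eq_0:
  fixes f g :: "'a::order set \<Rightarrow> int"
  assumes "finite Z" "absorbs (\<le>) f" "absorbs (\<ge>) g"
    and "\<And>z. z \<in> Z \<Longrightarrow> (\<forall>S. f (insert z S) = f S) \<or> (\<forall>S. g (insert z S) = g S)"
  shows "gap f g Z = 0"
  using assms
proof (induction "card Z" arbitrary: Z f g rule: less_induct)
  case less
  note irrelevant = less.prems(4)
  show ?case
  proof (cases "Z = {}")
    case False
    obtain p where p: "p \<in> Z" "\<forall>z\<in>Z. p \<le> z \<longrightarrow> z = p"
      using ex_maximal [OF less.prems(1) False] by blast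
    have "card (Z - {p}) < card Z" "card {z\<in>Z. \<not> z \<le> p} < card Z"
      by (fact card_removed [OF less.prems(1) p(1)])+
    moreover have "(\<forall>S. f (insert z S) = f S) \<or> (\<forall>S. g (insert p (insert z S)) = g (insert p S))"
      "(\<forall>S. f (insert p (insert z S)) = f (insert p S)) \<or> (\<forall>S. g (insert z S) = g S)"
      if "z \<in> Z" for z
      using irrelevant [OF that] by (metis insert_commute)+
    ultimately have "gap f (\<lambda>S. g (insert p S)) (Z - {p}) = 0"
      "gap (\<lambda>S. f (insert p S)) g {z\<in>Z. \<not> z \<le> p} = 0"
      using less.prems(1-3) by (auto intro!: less.hyps absorbs_insert)
    moreover have "(f (insert p A) - f A) * (g (insert p A) - g A) = 0" for A
      using less.prems(4) [OF p(1)] by auto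
    ultimately show ?thesis
      unfolding gap_maximal [OF less.prems(1) p less.prems(2,3)]
      by (simp only: add_0 sum.neutral_const)
  qed simp
qed

text \<open>Either the removed \<open>p\<close> already matters to both functions on the empty set,
  and the product of increments at \<open>A = {}\<close> is positive, or \<open>e\<close> survives
  with its property in one of the two smaller gaps.\<close>

lemma gap_pos:
  fixes f g :: "'a::order set \<Rightarrow> int"
  assumes "finite Z" "absorbs (\<le>) f" "absorbs (\<ge>) g" "mono f" "mono g"
    and "e \<in> Z" "f {} < f {e}" "g {} < g {e}"
  shows "0 < gap f g Z"
  using assms
proof (induction "card Z" arbitrary: Z f g rule: less_induct)
  case less
  then have "Z \<noteq> {}" by auto
  then obtain p where p: "p \<in> Z" "\<forall>z\<in>Z. p \<le> z \<longrightarrow> z = p"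
    using ex_maximal [OF less.prems(1)] by blast
  let ?X = "Z - {p}" and ?Y = "{z\<in>Z. \<not> z \<le> p}"
  let ?t = "\<lambda>A. (f (insert p A) - f A) * (g (insert p A) - g A)"
  have fin: "finite ?X" "finite ?Y" using less.prems(1) by auto
  have card: "card ?X < card Z" "card ?Y < card Z"
    by (fact card_removed [OF less.prems(1) p(1)])+
  have mono: "mono (\<lambda>S. f (insert p S))" "mono (\<lambda>S. g (insert p S))"
    by (rule mono_insert [OF less.prems(4)], rule mono_insert [OF less.prems(5)])
  have le: "f {} \<le> f {p}" "g {} \<le> g {p}" "f {e} \<le> f {p, e}" "g {e} \<le> g {p, e}"
    by (auto intro!: monoD [OF less.prems(4)] monoD [OF less.prems(5)])
  have n1: "0 \<le> gap f (\<lambda>S. g (insert p S)) ?X"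
    and n2: "0 \<le> gap (\<lambda>S. f (insert p S)) g ?Y"
    using less.prems fin mono absorbs_insert by (auto intro!: gap_nonneg)
  have t: "0 \<le> ?t A" for A
    using monoD [OF less.prems(4), of A "insert p A"] monoD [OF less.prems(5), of A "insert p A"]
    by (simp add: subset_insertI)
  have n3: "0 \<le> sum ?t (antichains ?Y)" by (intro sum_nonneg t)
  note rec = gap_maximal [OF less.prems(1) p less.prems(2,3)]
  consider (both) "f {} < f {p}" "g {} < g {p}" | (g) "g {p} = g {}"
    | (f) "g {} < g {p}" "f {p} = f {}"
    using le by linarith
  then show ?case
  proof cases
    case both
    have "{} \<in> antichains ?Y" unfolding antichains_def by simp
    then have "?t {} \<le> sum ?t (antichains ?Y)"
      using fin t by (intro member_le_sum) auto
    then have "0 < sum ?t (antichains ?Y)" using both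
      by (metis (no_types, lifting) diff_gt_0_iff_gt mult_pos_pos order_less_le_trans)
    then show ?thesis using rec n1 n2 by linarith
  next
    case g
    \<comment> \<open>Freezing \<open>p\<close> leaves \<open>g\<close> unchanged at the empty set,
      so \<open>e\<close> still matters to the new function.\<close>
    then have "e \<noteq> p" using less.prems by auto
    then have "0 < gap f (\<lambda>S. g (insert p S)) ?X"
      using less.prems card fin mono absorbs_insert g le
      by (intro less.hyps) auto
    then show ?thesis using rec n2 n3 by linarith
  next
    case f
    \<comment> \<open>An \<open>e\<close> below \<open>p\<close> would be absorbed:
      \<open>f {p, e} = f {p} = f {}\<close>, against \<open>f {} < f {e}\<close> and
      monotonicity.\<close>
    have "\<not> e \<le> p"
    proof
      assume "e \<le> p"
      then have "f {e, p} = f {p}" using less.prems(2) unfolding absorbs_def by blast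
      then show False using f le less.prems by (simp add: insert_commute)
    qed
    then have "0 < gap (\<lambda>S. f (insert p S)) g ?Y"
      using less.prems card fin mono absorbs_insert f le
      by (intro less.hyps) auto
    then show ?thesis using rec n1 n3 by linarith
  qed
qed

text \<open>No element matters to a constant function, so the gap of the two constants 1, which is
  the number of antichains minus the number of downsets, is zero; complements of downsets are
  filters.\<close>

lemma card_filters_eq_antichains:
  fixes Z :: "'a::order set"
  assumes "finite Z"
  shows "card (filters Z) = card (antichains Z)"
proof -
  have "gap (\<lambda>_. 1) (\<lambda>_. 1) Z = 0"
    using assms by (intro gap_eq_0) (auto simp: absorbs_def)
  then have "card (antichains Z) = card (downsets Z)"
    unfolding gap_def by simp
  moreover have "bij_betw (\<lambda>I. Z - I) (filters Z) (downsets Z)"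
    by (rule bij_betwI [where g = "\<lambda>I. Z - I"]) (auto simp: filters_def downsets_def)
  ultimately show ?thesis by (simp add: bij_betw_same_card)
qed

section \<open>Splitting a connected poset\<close>

text \<open>The unions of connected components of the comparability graph of \<open>E\<close>. For
  \<open>k\<close> components there are \<open>2 ^ k\<close> of them, so one component shows as
  cardinality 2 and two components as cardinality 4.\<close>

definition comp_unions :: "'a::order set \<Rightarrow> 'a set set" where
  "comp_unions E = {X. X \<subseteq> E \<and> (\<forall>p\<in>X. \<forall>q\<in>E - X. incomparable p q)}"

definition poset_connected :: "'a::order set \<Rightarrow> bool" where
  "poset_connected E \<longleftrightarrow> E \<noteq> {} \<and> comp_unions E = {{}, E}"

definition minimals :: "'a::order set \<Rightarrow> 'a set" where
  "minimals E = {x\<in>E. \<forall>y\<in>E. y \<le> x \<longrightarrow> y = x}"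

definition maximals :: "'a::order set \<Rightarrow> 'a set" where
  "maximals E = {x\<in>E. \<forall>y\<in>E. x \<le> y \<longrightarrow> y = x}"

text \<open>Connectedness of the hypergraph on \<open>A\<close> whose edges are the sets of all
  \<open>a\<close> in \<open>A\<close> with \<open>le a x\<close>, one for each \<open>x\<close> in
  \<open>X\<close>. It is trivially true when \<open>A\<close> has at most one element, so
  \<open>A \<noteq> {}\<close> appears as a separate condition.\<close>

definition linked :: "('a \<Rightarrow> 'a \<Rightarrow> bool) \<Rightarrow> 'a set \<Rightarrow> 'a set \<Rightarrow> bool" where
  "linked le A X \<longleftrightarrow> (\<forall>Y. Y \<subseteq> A \<and> Y \<noteq> {} \<and> Y \<noteq> A \<longrightarrow>
     (\<exists>x\<in>X. \<exists>a\<in>Y. \<exists>b\<in>A - Y. le a x \<and> le b x))"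

lemma comp_unions_trivial [simp]: "{} \<in> comp_unions E" "E \<in> comp_unions E"
  unfolding comp_unions_def by auto

lemma poset_connectedD:
  "poset_connected E \<Longrightarrow> X \<subseteq> E \<Longrightarrow> X \<noteq> {} \<Longrightarrow> X \<noteq> E \<Longrightarrow> \<exists>p\<in>X. \<exists>q\<in>E - X. p \<le> q \<or> q \<le> p"
  unfolding poset_connected_def comp_unions_def incomparable_def by blast

lemma poset_connectedI:
  assumes "E \<noteq> {}"
    and "\<And>X. X \<subseteq> E \<Longrightarrow> X \<noteq> {} \<Longrightarrow> X \<noteq> E \<Longrightarrow> \<exists>p\<in>X. \<exists>q\<in>E - X. p \<le> q \<or> q \<le> p"
  shows "poset_connected E"
proof -
  have "X = {} \<or> X = E" if "X \<in> comp_unions E" for X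
    using that assms(2) [of X] unfolding comp_unions_def incomparable_def by blast
  then have "comp_unions E = {{}, E}" using comp_unions_trivial by blast
  then show ?thesis using assms(1) unfolding poset_connected_def by simp
qed

text \<open>Every element of \<open>D\<close> hangs on some element of \<open>A\<close>, so
  connectedness is decided by which elements of \<open>A\<close> have a common bound in
  \<open>D\<close>. The two choices of \<open>le\<close> serve the lower and the upper piece of a
  split.\<close>

lemma poset_connected_iff_linked:
  fixes D :: "'a::order set"
  assumes le: "le = (\<le>) \<or> le = (\<lambda>x y. y \<le> x)"
    and A: "A \<subseteq> D" "\<And>x. x \<in> D \<Longrightarrow> \<exists>a\<in>A. le a x"
  shows "poset_connected D \<longleftrightarrow> A \<noteq> {} \<and> linked le A D"
proof
  assume D: "poset_connected D"
  then have "D \<noteq> {}" unfolding poset_connected_def by simp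
  then have "A \<noteq> {}" using A(2) by blast
  moreover have "linked le A D"
    unfolding linked_def
  proof (intro allI impI, elim conjE)
    fix Y assume Y: "Y \<subseteq> A" "Y \<noteq> {}" "Y \<noteq> A"
    show "\<exists>x\<in>D. \<exists>a\<in>Y. \<exists>b\<in>A - Y. le a x \<and> le b x"
    proof (rule ccontr)
      assume no: "\<not> ?thesis"
      \<comment> \<open>If no link left \<open>Y\<close>, the elements hanging on \<open>Y\<close>
        would be closed under comparability in \<open>D\<close>.\<close>
      let ?X = "{x\<in>D. \<exists>a\<in>Y. le a x}"
      obtain b where b: "b \<in> A - Y" using Y by blast
      have refl: "le x x" for x using le by auto
      have trans: "le x y \<Longrightarrow> le y z \<Longrightarrow> le x z" for x y z using le by auto
      have "b \<notin> ?X" using no b A(1) refl by blast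
      moreover have "b \<in> D" using b A(1) by blast
      moreover have "?X \<noteq> {}" using Y A(1) refl by blast
      ultimately obtain p q where pq: "p \<in> ?X" "q \<in> D - ?X" "p \<le> q \<or> q \<le> p"
        using poset_connectedD [OF D, of ?X] by blast
      then have "le p q \<or> le q p" using le by auto
      moreover obtain c where "c \<in> A" "le c q" using A(2) pq(2) by blast
      ultimately show False using pq no trans by blast
    qed
  qed
  ultimately show "A \<noteq> {} \<and> linked le A D" ..
next
  assume R: "A \<noteq> {} \<and> linked le A D"
  show "poset_connected D"
  proof (rule poset_connectedI)
    show "D \<noteq> {}" using R A(1) by blast
    fix X assume X: "X \<subseteq> D" "X \<noteq> {}" "X \<noteq> D"
    have le': "le x y \<Longrightarrow> x \<le> y \<or> y \<le> x" for x y using le by auto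
    consider "X \<inter> A = {}" | "A \<subseteq> X" | "X \<inter> A \<noteq> {}" "X \<inter> A \<noteq> A" by blast
    then show "\<exists>p\<in>X. \<exists>q\<in>D - X. p \<le> q \<or> q \<le> p"
    proof cases
      case 1
      obtain x where "x \<in> X" using X by blast
      moreover then obtain a where "a \<in> A" "le a x" using A(2) X by blast
      ultimately show ?thesis using 1 A(1) le' by blast
    next
      case 2
      obtain x where "x \<in> D - X" using X by blast
      moreover then obtain a where "a \<in> A" "le a x" using A(2) X by blast
      ultimately show ?thesis using 2 A(1) le' by blast
    next
      case 3
      then obtain x a b where "x \<in> D" "a \<in> X \<inter> A" "b \<in> A - X \<inter> A" "le a x" "le b x"
        using R unfolding linked_def by (metis Int_lower2)
      then show ?thesis using A(1) le' by blast
    qed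
  qed
qed

text \<open>A link through \<open>x\<close> may be rerouted through any element that bounds the same
  two members of \<open>A\<close>; in this way links are moved to boundary elements or to free
  elements.\<close>

lemma linked_transfer:
  assumes "linked le A X"
    and "\<And>x a b. x \<in> X \<Longrightarrow> a \<in> A \<Longrightarrow> b \<in> A \<Longrightarrow> a \<noteq> b \<Longrightarrow> le a x \<Longrightarrow> le b x
      \<Longrightarrow> \<exists>y\<in>X'. le a y \<and> le b y"
  shows "linked le A X'"
  unfolding linked_def
proof (intro allI impI)
  fix Y assume Y: "Y \<subseteq> A \<and> Y \<noteq> {} \<and> Y \<noteq> A"
  then obtain x a b where "x \<in> X" "a \<in> Y" "b \<in> A - Y" "le a x" "le b x"
    using assms(1) unfolding linked_def by meson
  moreover from this obtain y where "y \<in> X'" "le a y" "le b y"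
    using assms(2) [of x a b] Y by blast
  ultimately show "\<exists>x\<in>X'. \<exists>a\<in>Y. \<exists>b\<in>A - Y. le a x \<and> le b x" by blast
qed

lemma linked_cong:
  assumes "\<And>x a b. x \<in> X \<Longrightarrow> a \<in> A \<Longrightarrow> b \<in> A \<Longrightarrow> a \<noteq> b \<Longrightarrow> le a x \<Longrightarrow> le b x
      \<Longrightarrow> \<exists>y\<in>X'. le a y \<and> le b y"
    and "\<And>x a b. x \<in> X' \<Longrightarrow> a \<in> A \<Longrightarrow> b \<in> A \<Longrightarrow> a \<noteq> b \<Longrightarrow> le a x \<Longrightarrow> le b x
      \<Longrightarrow> \<exists>y\<in>X. le a y \<and> le b y"
  shows "linked le A X \<longleftrightarrow> linked le A X'"
  using linked_transfer [OF _ assms(1)] linked_transfer [OF _ assms(2)] by (intro iffI) assumption+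

lemma linked_mono: "linked le A X \<Longrightarrow> X \<subseteq> X' \<Longrightarrow> linked le A X'"
  by (erule linked_transfer) auto

lemma ex_minimals_le:
  assumes "finite E" "x \<in> E"
  shows "\<exists>l\<in>minimals E. l \<le> x"
proof -
  have "finite {y\<in>E. y \<le> x}" "{y\<in>E. y \<le> x} \<noteq> {}" using assms by auto
  then obtain m where "m \<in> {y\<in>E. y \<le> x}" "\<forall>y\<in>{y\<in>E. y \<le> x}. y \<le> m \<longrightarrow> m = y"
    using finite_has_minimal by blast
  then have "m \<in> minimals E" "m \<le> x" unfolding minimals_def by auto
  then show ?thesis by blast
qed

lemma ex_maximals_ge:
  assumes "finite E" "x \<in> E"
  shows "\<exists>u\<in>maximals E. x \<le> u"
proof -
  have "finite {y\<in>E. x \<le> y}" "{y\<in>E. x \<le> y} \<noteq> {}" using assms by auto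
  then obtain m where "m \<in> {y\<in>E. x \<le> y}" "\<forall>y\<in>{y\<in>E. x \<le> y}. m \<le> y \<longrightarrow> m = y"
    using finite_has_maximal by blast
  then have "m \<in> maximals E" "x \<le> m" unfolding maximals_def by auto
  then show ?thesis by blast
qed

lemma minimals_subset: "minimals E \<subseteq> E" and maximals_subset: "maximals E \<subseteq> E"
  unfolding minimals_def maximals_def by auto

lemma minimalsD: "l \<in> minimals E \<Longrightarrow> y \<in> E \<Longrightarrow> y \<le> l \<Longrightarrow> y = l"
  and maximalsD: "u \<in> maximals E \<Longrightarrow> y \<in> E \<Longrightarrow> u \<le> y \<Longrightarrow> y = u"
  unfolding minimals_def maximals_def by auto

section \<open>The two kinds of splits of a region as sums over free elements\<close>

definition order_splits :: "'a::order set \<Rightarrow> 'a set set" where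
  "order_splits E = {D\<in>downsets E. poset_connected D \<and> poset_connected (E - D)}"

definition chain_splits :: "'a::order set \<Rightarrow> 'a set set" where
  "chain_splits E = {M\<in>antichains E. poset_connected (sym_diff (minimals E) M) \<and>
     poset_connected (sym_diff M (maximals E))}"

text \<open>The elements whose membership the boundary data do not decide. An element above a
  minimal one outside \<open>A\<close> is excluded from \<open>D\<close>, and excluded from
  \<open>M\<close> because that minimal element belongs to \<open>M\<close>; an element below some
  \<open>u\<close> in \<open>B\<close> is forced into \<open>D\<close> and excluded from
  \<open>M\<close>.\<close>

definition free_part :: "'a::order set \<Rightarrow> 'a set \<Rightarrow> 'a set \<Rightarrow> 'a set" where
  "free_part E A B = {x \<in> E - minimals E - maximals E.
     (\<forall>l\<in>minimals E - A. \<not> l \<le> x) \<and> (\<forall>u\<in>B. \<not> x \<le> u)}"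

text \<open>\<open>A\<close> is the bottom layer of the lower piece, \<open>B\<close> its prescribed
  maximal elements and \<open>S\<close> its free ones. For the upper piece, \<open>high_link\<close>
  is used with \<open>maximals E - B\<close> and \<open>minimals E - A\<close> in these
  roles.\<close>

definition low_link :: "'a::order set \<Rightarrow> 'a set \<Rightarrow> 'a set \<Rightarrow> int" where
  "low_link A B S = of_bool (A \<noteq> {} \<and> linked (\<le>) A (B \<union> S))"

definition high_link :: "'a::order set \<Rightarrow> 'a set \<Rightarrow> 'a set \<Rightarrow> int" where
  "high_link A B S = of_bool (A \<noteq> {} \<and> linked (\<ge>) A (B \<union> S))"

lemma mono_low_link: "mono (low_link A B)"
proof (rule monoI)
  fix S T :: "'a set" assume "S \<subseteq> T"
  then have "linked (\<le>) A (B \<union> T)" if "linked (\<le>) A (B \<union> S)"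
    using linked_mono [OF that, of "B \<union> T"] by auto
  then show "low_link A B S \<le> low_link A B T" unfolding low_link_def by simp
qed

lemma mono_high_link: "mono (high_link A B)"
proof (rule monoI)
  fix S T :: "'a set" assume "S \<subseteq> T"
  then have "linked (\<ge>) A (B \<union> T)" if "linked (\<ge>) A (B \<union> S)"
    using linked_mono [OF that, of "B \<union> T"] by auto
  then show "high_link A B S \<le> high_link A B T" unfolding high_link_def by simp
qed

text \<open>Whatever two elements of \<open>A\<close> the smaller element bounds, the larger one
  bounds them too.\<close>

lemma absorbs_low_link:
  fixes A :: "'a::order set"
  shows "absorbs (\<le>) (low_link A B)"
  unfolding absorbs_def
proof (intro allI impI, elim conjE)
  fix S and x y :: 'a assume "y \<in> S" "x \<le> y"
  then have "linked (\<le>) A (B \<union> insert x S) = linked (\<le>) A (B \<union> S)"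
    by (intro linked_cong) (auto intro: order_trans)
  then show "low_link A B (insert x S) = low_link A B S" unfolding low_link_def by simp
qed

lemma absorbs_high_link:
  fixes A :: "'a::order set"
  shows "absorbs (\<ge>) (high_link A B)"
  unfolding absorbs_def
proof (intro allI impI, elim conjE)
  fix S and x y :: 'a assume "y \<in> S" "y \<le> x"
  then have "linked (\<ge>) A (B \<union> insert x S) = linked (\<ge>) A (B \<union> S)"
    by (intro linked_cong) (auto intro: order_trans)
  then show "high_link A B (insert x S) = high_link A B S" unfolding high_link_def by simp
qed

context
  fixes E A B :: "'a::order set"
  assumes fin: "finite E" and disj: "minimals E \<inter> maximals E = {}"
    and A: "A \<subseteq> minimals E" and B: "B \<subseteq> maximals E"
begin

text \<open>A link in \<open>D\<close> goes through an element above two minimal ones. If it lies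
  below some \<open>u\<close> in \<open>B\<close>, the link moves up to \<open>u\<close>; if not, it
  is neither minimal nor maximal and all minimal elements below it are in \<open>A\<close>, so it is
  free.\<close>

lemma connected_lower_iff:
  assumes D: "D \<in> downsets E" "minimals E \<inter> D = A" "maximals E \<inter> D = B"
  shows "poset_connected D \<longleftrightarrow> A \<noteq> {} \<and> linked (\<le>) A (B \<union> (D \<inter> free_part E A B))"
proof -
  have DE: "D \<subseteq> E" and down: "\<And>x y. x \<in> D \<Longrightarrow> y \<in> E \<Longrightarrow> y \<le> x \<Longrightarrow> y \<in> D"
    using D(1) unfolding downsets_def by auto
  have "\<exists>a\<in>A. a \<le> x" if "x \<in> D" for x
    using ex_minimals_le [OF fin, of x] that down D(2) DE minimals_subset [of E] by blast
  then have "poset_connected D \<longleftrightarrow> A \<noteq> {} \<and> linked (\<le>) A D"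
    using D(2) by (intro poset_connected_iff_linked) auto
  also have "linked (\<le>) A D = linked (\<le>) A (B \<union> (D \<inter> free_part E A B))"
  proof (rule linked_cong)
    fix x a b assume x: "x \<in> D" and ab: "a \<in> A" "b \<in> A" "a \<noteq> b" "a \<le> x" "b \<le> x"
    have "x \<notin> minimals E"
      using ab A minimals_subset [of E] minimalsD [of x E] by blast
    show "\<exists>y\<in>B \<union> (D \<inter> free_part E A B). a \<le> y \<and> b \<le> y"
    proof (cases "\<exists>u\<in>B. x \<le> u")
      case True
      then show ?thesis using ab by (meson UnI1 order_trans)
    next
      case False
      then have "x \<notin> maximals E" using x D(3) by auto
      moreover have "l \<in> A" if "l \<in> minimals E" "l \<le> x" for l
        using down [OF x] that D(2) minimals_subset [of E] by blast
      ultimately have "x \<in> free_part E A B" using x DE \<open>x \<notin> minimals E\<close> False unfolding free_part_def by auto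
      then show ?thesis using x ab by blast
    qed
  next
    fix x a b assume "x \<in> B \<union> (D \<inter> free_part E A B)" "a \<le> x" "b \<le> x"
    then show "\<exists>y\<in>D. a \<le> y \<and> b \<le> y" using D(3) by blast
  qed
  finally show ?thesis .
qed

text \<open>Dually, a link moves down to a minimal element outside \<open>A\<close>, or else goes
  through a free element, which now has to lie outside \<open>D\<close>.\<close>

lemma connected_upper_iff:
  assumes D: "D \<in> downsets E" "minimals E \<inter> D = A" "maximals E \<inter> D = B"
  shows "poset_connected (E - D) \<longleftrightarrow>
    maximals E - B \<noteq> {} \<and> linked (\<ge>) (maximals E - B) ((minimals E - A) \<union> (free_part E A B - D))"
proof -
  have DE: "D \<subseteq> E" and down: "\<And>x y. x \<in> D \<Longrightarrow> y \<in> E \<Longrightarrow> y \<le> x \<Longrightarrow> y \<in> D"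
    using D(1) unfolding downsets_def by auto
  have "\<exists>u\<in>maximals E - B. x \<le> u" if "x \<in> E - D" for x
    using ex_maximals_ge [OF fin, of x] that down D(3) by blast
  moreover have "maximals E - B \<subseteq> E - D" using D(3) maximals_subset by blast
  ultimately have "poset_connected (E - D) \<longleftrightarrow> maximals E - B \<noteq> {} \<and> linked (\<ge>) (maximals E - B) (E - D)"
    by (intro poset_connected_iff_linked) auto
  also have "linked (\<ge>) (maximals E - B) (E - D) = linked (\<ge>) (maximals E - B) ((minimals E - A) \<union> (free_part E A B - D))"
  proof (rule linked_cong)
    fix x a b assume x: "x \<in> E - D" and ab: "a \<in> maximals E - B" "b \<in> maximals E - B" "a \<noteq> b" "x \<le> a" "x \<le> b"
    have "x \<notin> maximals E"
      using ab maximals_subset [of E] maximalsD [of x E] by blast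
    show "\<exists>y\<in>(minimals E - A) \<union> (free_part E A B - D). y \<le> a \<and> y \<le> b"
    proof (cases "\<exists>l\<in>minimals E - A. l \<le> x")
      case True
      then show ?thesis using ab by (meson UnI1 order_trans)
    next
      case False
      then have "x \<notin> minimals E" using x D(2) by blast
      moreover have "u \<notin> B" if "x \<le> u" for u
        using down [of u x] that D(3) x by blast
      ultimately have "x \<in> free_part E A B" using x \<open>x \<notin> maximals E\<close> False unfolding free_part_def by auto
      then show ?thesis using x ab by blast
    qed
  next
    fix x a b assume "x \<in> (minimals E - A) \<union> (free_part E A B - D)" "x \<le> a" "x \<le> b"
    then show "\<exists>y\<in>E - D. y \<le> a \<and> y \<le> b"
      using D(2) minimals_subset [of E] unfolding free_part_def by blast
  qed
  finally show ?thesis .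
qed

text \<open>An element of \<open>M\<close> off the two prescribed parts is incomparable to the
  boundary elements in \<open>M\<close>, and therefore free. The second claim holds because a
  minimal and a maximal element of \<open>M\<close> that are comparable would coincide, against
  \<open>disj\<close>.\<close>

lemma antichain_split:
  assumes M: "M \<in> antichains E" "minimals E - M = A" "maximals E \<inter> M = B"
  shows "M = (minimals E - A) \<union> B \<union> (M \<inter> free_part E A B)" "\<forall>l\<in>minimals E - A. \<forall>u\<in>B. \<not> l \<le> u"
proof -
  have ME: "M \<subseteq> E" and anti: "\<And>x y. x \<in> M \<Longrightarrow> y \<in> M \<Longrightarrow> x \<le> y \<Longrightarrow> x = y"
    using M(1) unfolding antichains_def by auto
  have "x \<in> free_part E A B" if "x \<in> M" "x \<notin> minimals E - A" "x \<notin> B" for x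
    using that ME anti M(2,3) unfolding free_part_def by blast
  then show "M = (minimals E - A) \<union> B \<union> (M \<inter> free_part E A B)"
    using M(2,3) by blast
  show "\<forall>l\<in>minimals E - A. \<forall>u\<in>B. \<not> l \<le> u"
    using M(2,3) anti disj by blast
qed

text \<open>The set tested here is \<open>sym_diff (minimals E) M\<close> for the antichain
  \<open>M\<close> with free part \<open>S\<close>. All its elements lie over \<open>A\<close>,
  because a minimal element outside \<open>A\<close> is below none of them, by \<open>no\<close> and
  by freeness. The criterion agrees with the one for downsets, with \<open>S\<close> as the free
  elements.\<close>

lemma connected_low_antichain_iff:
  assumes S: "S \<subseteq> free_part E A B" and no: "\<forall>l\<in>minimals E - A. \<forall>u\<in>B. \<not> l \<le> u"
  shows "poset_connected (A \<union> (B \<union> S)) \<longleftrightarrow> A \<noteq> {} \<and> linked (\<le>) A (B \<union> S)"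
proof -
  have "\<exists>a\<in>A. a \<le> x" if "x \<in> A \<union> (B \<union> S)" for x
  proof (cases "x \<in> A")
    case False
    then have x: "x \<in> B \<union> S" using that by blast
    then have "x \<in> E" using B maximals_subset [of E] S unfolding free_part_def by blast
    then obtain l where "l \<in> minimals E" "l \<le> x" using ex_minimals_le [OF fin] by blast
    then show ?thesis using x no S unfolding free_part_def by blast
  qed auto
  then have "poset_connected (A \<union> (B \<union> S)) \<longleftrightarrow> A \<noteq> {} \<and> linked (\<le>) A (A \<union> (B \<union> S))"
    by (intro poset_connected_iff_linked) auto
  also have "linked (\<le>) A (A \<union> (B \<union> S)) = linked (\<le>) A (B \<union> S)"
  proof (rule linked_cong)
    fix x a b assume "x \<in> A \<union> (B \<union> S)" and ab: "a \<in> A" "b \<in> A" "a \<noteq> b" "a \<le> x" "b \<le> x"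
    moreover have "x \<notin> A"
      using ab A minimals_subset [of E] minimalsD [of x E] by blast
    ultimately show "\<exists>y\<in>B \<union> S. a \<le> y \<and> b \<le> y" by blast
  qed blast
  finally show ?thesis .
qed

lemma connected_high_antichain_iff:
  assumes S: "S \<subseteq> free_part E A B" and no: "\<forall>l\<in>minimals E - A. \<forall>u\<in>B. \<not> l \<le> u"
  shows "poset_connected ((maximals E - B) \<union> ((minimals E - A) \<union> S)) \<longleftrightarrow>
    maximals E - B \<noteq> {} \<and> linked (\<ge>) (maximals E - B) ((minimals E - A) \<union> S)"
proof -
  have "\<exists>u\<in>maximals E - B. x \<le> u" if "x \<in> (maximals E - B) \<union> ((minimals E - A) \<union> S)" for x
  proof (cases "x \<in> maximals E - B")
    case False
    then have x: "x \<in> (minimals E - A) \<union> S" using that by blast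
    then have "x \<in> E" using minimals_subset [of E] S unfolding free_part_def by blast
    then obtain u where "u \<in> maximals E" "x \<le> u" using ex_maximals_ge [OF fin] by blast
    then show ?thesis using x no S unfolding free_part_def by blast
  qed auto
  then have "poset_connected ((maximals E - B) \<union> ((minimals E - A) \<union> S)) \<longleftrightarrow>
      maximals E - B \<noteq> {} \<and> linked (\<ge>) (maximals E - B) ((maximals E - B) \<union> ((minimals E - A) \<union> S))"
    by (intro poset_connected_iff_linked) auto
  also have "linked (\<ge>) (maximals E - B) ((maximals E - B) \<union> ((minimals E - A) \<union> S)) =
      linked (\<ge>) (maximals E - B) ((minimals E - A) \<union> S)"
  proof (rule linked_cong)
    fix x a b assume "x \<in> (maximals E - B) \<union> ((minimals E - A) \<union> S)"
      and ab: "a \<in> maximals E - B" "b \<in> maximals E - B" "a \<noteq> b" "x \<le> a" "x \<le> b"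
    moreover have "x \<notin> maximals E - B"
      using ab maximals_subset [of E] maximalsD [of x E] by blast
    ultimately show "\<exists>y\<in>(minimals E - A) \<union> S. y \<le> a \<and> y \<le> b" by blast
  qed blast
  finally show ?thesis .
qed

text \<open>The downset is rebuilt from its free part by adding what is forced into it:
  \<open>A\<close> and everything below \<open>B\<close>. The hypothesis \<open>no\<close> prevents
  minimal elements outside \<open>A\<close> from being swept in.\<close>

lemma order_fibre_bij:
  assumes no: "\<forall>l\<in>minimals E - A. \<forall>u\<in>B. \<not> l \<le> u"
  shows "bij_betw (\<lambda>D. D \<inter> free_part E A B) {D\<in>downsets E. minimals E \<inter> D = A \<and> maximals E \<inter> D = B} (downsets (free_part E A B))"
proof (rule bij_betwI [where g = "\<lambda>I. I \<union> A \<union> {x\<in>E. \<exists>b\<in>B. x \<le> b}"])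
  show "(\<lambda>D. D \<inter> free_part E A B) \<in> {D\<in>downsets E. minimals E \<inter> D = A \<and> maximals E \<inter> D = B} \<rightarrow> downsets (free_part E A B)"
    unfolding downsets_def free_part_def by blast
next
  have "I \<union> A \<union> {x\<in>E. \<exists>b\<in>B. x \<le> b} \<in> downsets E \<and>
      minimals E \<inter> (I \<union> A \<union> {x\<in>E. \<exists>b\<in>B. x \<le> b}) = A \<and> maximals E \<inter> (I \<union> A \<union> {x\<in>E. \<exists>b\<in>B. x \<le> b}) = B"
    if I: "I \<in> downsets (free_part E A B)" for I
  proof (intro conjI)
    let ?D = "I \<union> A \<union> {x\<in>E. \<exists>b\<in>B. x \<le> b}"
    have IF: "I \<subseteq> free_part E A B" "\<And>x y. x \<in> I \<Longrightarrow> y \<in> free_part E A B \<Longrightarrow> y \<le> x \<Longrightarrow> y \<in> I"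
      using I unfolding downsets_def by auto
    \<comment> \<open>All minimal elements below the rebuilt set are in \<open>A\<close>. This gives
      its trace on \<open>minimals E\<close> and is also half of the freeness of elements below
      \<open>I\<close>.\<close>
    have low_le: "l \<in> A" if "l \<in> minimals E" "l \<le> x" "x \<in> ?D" for x l
    proof -
      consider "x \<in> free_part E A B" | "x \<in> A" | b where "b \<in> B" "x \<le> b" using \<open>x \<in> ?D\<close> IF(1) by blast
      then show ?thesis
      proof cases
        case 1
        then show ?thesis using that unfolding free_part_def by blast
      next
        case 2
        then show ?thesis using that A minimalsD [of x E l] minimals_subset [of E] by blast
      next
        case 3
        then show ?thesis using that no by (meson DiffI order_trans)
      qed
    qed
    have sub: "?D \<subseteq> E" using IF(1) A minimals_subset [of E] unfolding free_part_def by blast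
    have "y \<in> ?D" if x: "x \<in> ?D" and y: "y \<in> E" "y \<le> x" for x y
    proof -
      consider "x \<in> I" | "x \<in> A" | b where "b \<in> B" "x \<le> b" using x by blast
      then show ?thesis
      proof cases
        case 1
        show ?thesis
        proof (cases "y \<in> minimals E \<or> (\<exists>b\<in>B. y \<le> b)")
          case True
          then show ?thesis using low_le [OF _ y(2) x] y by blast
        next
          case False
          have "l \<in> A" if "l \<in> minimals E" "l \<le> y" for l
            using low_le [OF that(1) _ x] that(2) y(2) by (meson order_trans)
          moreover have "y \<notin> maximals E"
            using 1 IF(1) y maximalsD [of y E x] unfolding free_part_def by blast
          ultimately have "y \<in> free_part E A B" using False y unfolding free_part_def by blast
          then show ?thesis using IF(2) 1 y by blast
        qed
      next
        case 2
        then show ?thesis using y A minimalsD [of x E y] by blast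
      next
        case 3
        then show ?thesis using y by (blast intro: order_trans)
      qed
    qed
    then show "?D \<in> downsets E" using sub unfolding downsets_def by blast
    show "minimals E \<inter> ?D = A" using low_le A by blast
    show "maximals E \<inter> ?D = B"
    proof -
      have "x \<in> B" if "x \<in> maximals E" "b \<in> B" "x \<le> b" for x b
        using that B maximalsD [of x E b] maximals_subset [of E] by blast
      moreover have "maximals E \<inter> I = {}" using IF(1) unfolding free_part_def by blast
      moreover have "maximals E \<inter> A = {}" using disj A by blast
      moreover have "B \<subseteq> E" using B maximals_subset [of E] by blast
      ultimately show ?thesis using B by blast
    qed
  qed
  then show "(\<lambda>I. I \<union> A \<union> {x\<in>E. \<exists>b\<in>B. x \<le> b}) \<in> downsets (free_part E A B) \<rightarrow>
      {D\<in>downsets E. minimals E \<inter> D = A \<and> maximals E \<inter> D = B}" by blast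
next
  fix D assume "D \<in> {D\<in>downsets E. minimals E \<inter> D = A \<and> maximals E \<inter> D = B}"
  then have D: "D \<in> downsets E" "minimals E \<inter> D = A" "maximals E \<inter> D = B" by auto
  then have DE: "D \<subseteq> E" and down: "\<And>x y. x \<in> D \<Longrightarrow> y \<in> E \<Longrightarrow> y \<le> x \<Longrightarrow> y \<in> D"
    unfolding downsets_def by auto
  have "x \<in> free_part E A B" if "x \<in> D" "x \<notin> A" "\<not> (\<exists>b\<in>B. x \<le> b)" for x
  proof -
    have "l \<in> A" if "l \<in> minimals E" "l \<le> x" for l
      using down [OF \<open>x \<in> D\<close>] that D(2) minimals_subset [of E] by blast
    then show ?thesis using that DE D(2,3) unfolding free_part_def by blast
  qed
  moreover have "x \<in> D" if "x \<in> E" "b \<in> B" "x \<le> b" for x b using that down D(3) by blast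
  ultimately show "D \<inter> free_part E A B \<union> A \<union> {x\<in>E. \<exists>b\<in>B. x \<le> b} = D" using D DE by blast
next
  fix I assume "I \<in> downsets (free_part E A B)"
  then have "I \<subseteq> free_part E A B" unfolding downsets_def by blast
  moreover have "A \<inter> free_part E A B = {}" "{x\<in>E. \<exists>b\<in>B. x \<le> b} \<inter> free_part E A B = {}"
    using A unfolding free_part_def by auto
  ultimately show "(I \<union> A \<union> {x\<in>E. \<exists>b\<in>B. x \<le> b}) \<inter> free_part E A B = I" by blast
qed

text \<open>Freeness says that no element of \<open>S\<close> is comparable to the boundary elements
  prescribed for \<open>M\<close>, and \<open>no\<close> does the same among the latter.\<close>

lemma chain_fibre_bij:
  assumes no: "\<forall>l\<in>minimals E - A. \<forall>u\<in>B. \<not> l \<le> u"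
  shows "bij_betw (\<lambda>M. M \<inter> free_part E A B) {M\<in>antichains E. minimals E - M = A \<and> maximals E \<inter> M = B} (antichains (free_part E A B))"
proof (rule bij_betwI [where g = "\<lambda>S. (minimals E - A) \<union> B \<union> S"])
  show "(\<lambda>M. M \<inter> free_part E A B) \<in> {M\<in>antichains E. minimals E - M = A \<and> maximals E \<inter> M = B} \<rightarrow> antichains (free_part E A B)"
    unfolding antichains_def by auto
next
  have "(minimals E - A) \<union> B \<union> S \<in> antichains E \<and>
      minimals E - ((minimals E - A) \<union> B \<union> S) = A \<and> maximals E \<inter> ((minimals E - A) \<union> B \<union> S) = B"
    if S: "S \<in> antichains (free_part E A B)" for S
  proof (intro conjI)
    let ?M = "(minimals E - A) \<union> B \<union> S"
    have SF: "S \<subseteq> free_part E A B" and anti: "\<And>x y. x \<in> S \<Longrightarrow> y \<in> S \<Longrightarrow> x \<le> y \<Longrightarrow> x = y"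
      using S unfolding antichains_def by auto
    have SE: "S \<inter> minimals E = {}" "S \<inter> maximals E = {}" using SF unfolding free_part_def by auto
    have sub: "minimals E \<subseteq> E" "maximals E \<subseteq> E" "S \<subseteq> E"
      using SF minimals_subset [of E] maximals_subset [of E] unfolding free_part_def by auto
    have "x = y" if "x \<in> ?M" "y \<in> ?M" "x \<le> y" for x y
    proof -
      have xE: "x \<in> E" and yE: "y \<in> E" using that sub B by auto
      show ?thesis
      proof (cases "y \<in> minimals E \<or> x \<in> maximals E")
        case True
        then show ?thesis using that(3) xE yE minimalsD [of y E x] maximalsD [of x E y] by blast
      next
        case False
        then have x: "x \<in> (minimals E - A) \<union> S" and y: "y \<in> B \<union> S" using that B by blast+
        then show ?thesis
          using that(3) no anti SF unfolding free_part_def by blast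
      qed
    qed
    then show "?M \<in> antichains E" using sub B unfolding antichains_def by blast
    show "minimals E - ?M = A" using A B disj SE by blast
    show "maximals E \<inter> ?M = B" using B disj SE by blast
  qed
  then show "(\<lambda>S. (minimals E - A) \<union> B \<union> S) \<in> antichains (free_part E A B) \<rightarrow>
    {M\<in>antichains E. minimals E - M = A \<and> maximals E \<inter> M = B}" by blast
next
  fix M assume "M \<in> {M\<in>antichains E. minimals E - M = A \<and> maximals E \<inter> M = B}"
  then show "(minimals E - A) \<union> B \<union> (M \<inter> free_part E A B) = M" using antichain_split(1) by blast
next
  fix S assume "S \<in> antichains (free_part E A B)"
  then have "S \<subseteq> free_part E A B" unfolding antichains_def by blast
  moreover have "(minimals E - A) \<inter> free_part E A B = {}" "B \<inter> free_part E A B = {}"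
    using B unfolding free_part_def by auto
  ultimately show "((minimals E - A) \<union> B \<union> S) \<inter> free_part E A B = S" by blast
qed

lemma card_filter_eq_sum: "finite X \<Longrightarrow> int (card {x\<in>X. Q x}) = (\<Sum>x\<in>X. of_bool (Q x))"
  by (simp add: Int_def)

lemma card_order_fibre:
  assumes no: "\<forall>l\<in>minimals E - A. \<forall>u\<in>B. \<not> l \<le> u"
  shows "int (card {D\<in>order_splits E. minimals E \<inter> D = A \<and> maximals E \<inter> D = B}) =
    (\<Sum>I\<in>downsets (free_part E A B). low_link A B I * high_link (maximals E - B) (minimals E - A) (free_part E A B - I))"
proof -
  let ?T = "{D\<in>downsets E. minimals E \<inter> D = A \<and> maximals E \<inter> D = B}"
  have "{D\<in>order_splits E. minimals E \<inter> D = A \<and> maximals E \<inter> D = B} =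
      {D\<in>?T. poset_connected D \<and> poset_connected (E - D)}"
    unfolding order_splits_def by auto
  then have "int (card {D\<in>order_splits E. minimals E \<inter> D = A \<and> maximals E \<inter> D = B}) =
      int (card {D\<in>?T. poset_connected D \<and> poset_connected (E - D)})" by (simp only:)
  also have "\<dots> = (\<Sum>D\<in>?T. of_bool (poset_connected D \<and> poset_connected (E - D)))"
    by (rule card_filter_eq_sum) (use fin in simp)
  also have "\<dots> = (\<Sum>D\<in>?T. low_link A B (D \<inter> free_part E A B) * high_link (maximals E - B) (minimals E - A) (free_part E A B - D \<inter> free_part E A B))"
  proof (intro sum.cong refl)
    fix D assume "D \<in> ?T"
    then have D: "D \<in> downsets E" "minimals E \<inter> D = A" "maximals E \<inter> D = B" by auto
    have eq: "free_part E A B - D \<inter> free_part E A B = free_part E A B - D" by blast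
    show "of_bool (poset_connected D \<and> poset_connected (E - D)) =
        low_link A B (D \<inter> free_part E A B) * high_link (maximals E - B) (minimals E - A) (free_part E A B - D \<inter> free_part E A B)"
      unfolding low_link_def high_link_def connected_lower_iff [OF D] connected_upper_iff [OF D] eq
      by (simp only: of_bool_conj)
  qed
  also have "\<dots> = (\<Sum>I\<in>downsets (free_part E A B). low_link A B I * high_link (maximals E - B) (minimals E - A) (free_part E A B - I))"
    by (rule sum.reindex_bij_betw [OF order_fibre_bij [OF no],
          of "\<lambda>I. low_link A B I * high_link (maximals E - B) (minimals E - A) (free_part E A B - I)"])
  finally show ?thesis .
qed

text \<open>Unlike the free part of a downset, which is divided between the two pieces of the split,
  the free part of \<open>M\<close> belongs to both symmetric differences; so both factors are
  evaluated at the same \<open>S\<close>.\<close>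

lemma card_chain_fibre:
  assumes no: "\<forall>l\<in>minimals E - A. \<forall>u\<in>B. \<not> l \<le> u"
  shows "int (card {M\<in>chain_splits E. minimals E - M = A \<and> maximals E \<inter> M = B}) =
    (\<Sum>S\<in>antichains (free_part E A B). low_link A B S * high_link (maximals E - B) (minimals E - A) S)"
proof -
  let ?T = "{M\<in>antichains E. minimals E - M = A \<and> maximals E \<inter> M = B}"
  have "{M\<in>chain_splits E. minimals E - M = A \<and> maximals E \<inter> M = B} =
      {M\<in>?T. poset_connected (sym_diff (minimals E) M) \<and> poset_connected (sym_diff M (maximals E))}"
    unfolding chain_splits_def by auto
  then have "int (card {M\<in>chain_splits E. minimals E - M = A \<and> maximals E \<inter> M = B}) =
      int (card {M\<in>?T. poset_connected (sym_diff (minimals E) M) \<and> poset_connected (sym_diff M (maximals E))})"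
    by (simp only:)
  also have "\<dots> = (\<Sum>M\<in>?T. of_bool (poset_connected (sym_diff (minimals E) M) \<and> poset_connected (sym_diff M (maximals E))))"
    by (rule card_filter_eq_sum) (use fin in simp)
  also have "\<dots> = (\<Sum>M\<in>?T. low_link A B (M \<inter> free_part E A B) * high_link (maximals E - B) (minimals E - A) (M \<inter> free_part E A B))"
  proof (intro sum.cong refl)
    fix M assume "M \<in> ?T"
    then have M: "M \<in> antichains E" "minimals E - M = A" "maximals E \<inter> M = B" by auto
    have cover: "M \<subseteq> (minimals E - A) \<union> B \<union> (M \<inter> free_part E A B)" using antichain_split(1) [OF M] by (rule equalityD1)
    have F: "free_part E A B \<inter> minimals E = {}" "free_part E A B \<inter> maximals E = {}" unfolding free_part_def by auto
    have "M - minimals E = B \<union> (M \<inter> free_part E A B)" using cover F M(3) B disj by auto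
    moreover have "M - maximals E = (minimals E - A) \<union> (M \<inter> free_part E A B)" using cover F M(2) B disj by auto
    moreover have "maximals E - M = maximals E - B" using M(3) by auto
    ultimately have sd: "sym_diff (minimals E) M = A \<union> (B \<union> (M \<inter> free_part E A B))"
      "sym_diff M (maximals E) = (maximals E - B) \<union> ((minimals E - A) \<union> (M \<inter> free_part E A B))"
      using M(2) by auto
    have MF: "M \<inter> free_part E A B \<subseteq> free_part E A B" by blast
    show "of_bool (poset_connected (sym_diff (minimals E) M) \<and> poset_connected (sym_diff M (maximals E))) =
        low_link A B (M \<inter> free_part E A B) * high_link (maximals E - B) (minimals E - A) (M \<inter> free_part E A B)"
      unfolding sd low_link_def high_link_def connected_low_antichain_iff [OF MF no]
        connected_high_antichain_iff [OF MF no]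
      by (simp only: of_bool_conj)
  qed
  also have "\<dots> = (\<Sum>S\<in>antichains (free_part E A B). low_link A B S * high_link (maximals E - B) (minimals E - A) S)"
    by (rule sum.reindex_bij_betw [OF chain_fibre_bij [OF no],
          of "\<lambda>S. low_link A B S * high_link (maximals E - B) (minimals E - A) S"])
  finally show ?thesis .
qed

text \<open>A downset containing \<open>u\<close> contains \<open>l\<close>, and an antichain cannot
  contain both; such boundary data contribute nothing to either count.\<close>

lemma fibres_empty:
  assumes "l \<in> minimals E - A" "u \<in> B" "l \<le> u"
  shows "{D\<in>order_splits E. minimals E \<inter> D = A \<and> maximals E \<inter> D = B} = {}"
    "{M\<in>chain_splits E. minimals E - M = A \<and> maximals E \<inter> M = B} = {}"
proof -
  have "False" if "D \<in> order_splits E" "minimals E \<inter> D = A" "maximals E \<inter> D = B" for D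
  proof -
    have "D \<in> downsets E" "u \<in> D" "l \<in> E" "l \<notin> D"
      using that assms minimals_subset [of E] unfolding order_splits_def by auto
    then show False using assms(3) unfolding downsets_def by blast
  qed
  then show "{D\<in>order_splits E. minimals E \<inter> D = A \<and> maximals E \<inter> D = B} = {}" by auto
  have "False" if "M \<in> chain_splits E" "minimals E - M = A" "maximals E \<inter> M = B" for M
  proof -
    have "M \<in> antichains E" using that unfolding chain_splits_def by auto
    from antichain_split(2) [OF this that(2,3)] show False using assms by auto
  qed
  then show "{M\<in>chain_splits E. minimals E - M = A \<and> maximals E \<inter> M = B} = {}" by auto
qed

lemma fibre_gap:
  "int (card {M\<in>chain_splits E. minimals E - M = A \<and> maximals E \<inter> M = B})
    - int (card {D\<in>order_splits E. minimals E \<inter> D = A \<and> maximals E \<inter> D = B}) =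
   (if \<forall>l\<in>minimals E - A. \<forall>u\<in>B. \<not> l \<le> u
    then gap (low_link A B) (high_link (maximals E - B) (minimals E - A)) (free_part E A B) else 0)"
proof (cases "\<forall>l\<in>minimals E - A. \<forall>u\<in>B. \<not> l \<le> u")
  case True
  then show ?thesis by (simp add: card_chain_fibre card_order_fibre gap_def)
next
  case False
  then obtain l u where lu: "l \<in> minimals E - A" "u \<in> B" "l \<le> u" by blast
  show ?thesis unfolding fibres_empty [OF lu] if_not_P [OF False] by simp
qed

end

text \<open>Both families are grouped over the same pairs: \<open>A\<close> is cut out of
  \<open>minimals E\<close> by \<open>D\<close> in one case and by the complement of
  \<open>M\<close> in the other.\<close>

lemma card_splits_gap:
  fixes E :: "'a::order set"
  assumes fin: "finite E" and disj: "minimals E \<inter> maximals E = {}"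
  shows "int (card (chain_splits E)) - int (card (order_splits E)) =
    (\<Sum>(A, B)\<in>Pow (minimals E) \<times> Pow (maximals E).
      if \<forall>l\<in>minimals E - A. \<forall>u\<in>B. \<not> l \<le> u
      then gap (low_link A B) (high_link (maximals E - B) (minimals E - A)) (free_part E A B) else 0)"
    (is "_ = ?rhs")
proof -
  let ?L = "minimals E" and ?U = "maximals E"
  let ?T = "Pow ?L \<times> Pow ?U"
  have "finite ?L" "finite ?U"
    using fin minimals_subset [of E] maximals_subset [of E] by (auto intro: finite_subset)
  then have finT: "finite ?T" by auto
  have finC: "finite (chain_splits E)" "finite (order_splits E)"
    using fin unfolding chain_splits_def order_splits_def by auto
  have "int (card (chain_splits E)) = (\<Sum>M\<in>chain_splits E. 1)" by simp
  also have "\<dots> = (\<Sum>t\<in>?T. \<Sum>M\<in>{M\<in>chain_splits E. (?L - M, ?U \<inter> M) = t}. 1)"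
    using finC finT by (intro sum.group [symmetric]) auto
  finally have c: "int (card (chain_splits E)) =
      (\<Sum>(A,B)\<in>?T. int (card {M\<in>chain_splits E. ?L - M = A \<and> ?U \<inter> M = B}))"
    by (simp add: case_prod_unfold prod_eq_iff)
  have "int (card (order_splits E)) = (\<Sum>D\<in>order_splits E. 1)" by simp
  also have "\<dots> = (\<Sum>t\<in>?T. \<Sum>D\<in>{D\<in>order_splits E. (?L \<inter> D, ?U \<inter> D) = t}. 1)"
    using finC finT by (intro sum.group [symmetric]) auto
  finally have o: "int (card (order_splits E)) =
      (\<Sum>(A,B)\<in>?T. int (card {D\<in>order_splits E. ?L \<inter> D = A \<and> ?U \<inter> D = B}))"
    by (simp add: case_prod_unfold prod_eq_iff)
  show ?thesis
    unfolding c o sum_subtractf [symmetric]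
    by (intro sum.cong refl) (use fibre_gap [OF fin disj] in auto)
qed

section \<open>Inequality, equality and strictness for the numbers of splits\<close>

lemma finite_free_part: "finite E \<Longrightarrow> finite (free_part E A B)"
  unfolding free_part_def by auto

lemma card_order_splits_le:
  assumes "finite E" "minimals E \<inter> maximals E = {}"
  shows "card (order_splits E) \<le> card (chain_splits E)"
proof -
  have "0 \<le> int (card (chain_splits E)) - int (card (order_splits E))"
    unfolding card_splits_gap [OF assms]
    by (intro sum_nonneg) (auto intro!: gap_nonneg finite_free_part assms
        absorbs_low_link absorbs_high_link mono_low_link mono_high_link)
  then show ?thesis by simp
qed

lemma linked_pair:
  assumes "le a x" "le b x"
  shows "linked le {a, b} {x}"
  unfolding linked_def
proof (intro allI impI)
  fix Y assume "Y \<subseteq> {a, b} \<and> Y \<noteq> {} \<and> Y \<noteq> {a, b}"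
  then have "(a \<in> Y \<and> b \<in> {a, b} - Y) \<or> (b \<in> Y \<and> a \<in> {a, b} - Y)" by blast
  then show "\<exists>x\<in>{x}. \<exists>c\<in>Y. \<exists>d\<in>{a, b} - Y. le c x \<and> le d x" using assms by blast
qed

lemma linked_insert_irrelevant:
  assumes "\<And>a b. a \<in> A \<Longrightarrow> b \<in> A \<Longrightarrow> le a z \<Longrightarrow> le b z \<Longrightarrow> a = b"
  shows "linked le A (B \<union> insert z S) = linked le A (B \<union> S)"
  by (rule linked_cong) (use assms in blast)+

text \<open>A free \<open>z\<close> lying over two elements of \<open>A\<close> and under two
  elements of \<open>maximals E - B\<close> would form a copy of X with them. Hence each
  \<open>z\<close> is irrelevant to one of the two link functions, and every gap vanishes.\<close>

lemma card_order_splits_eq: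
  assumes "finite E" "minimals E \<inter> maximals E = {}" and "X_free P" "E \<subseteq> P"
  shows "card (order_splits E) = card (chain_splits E)"
proof -
  have "gap (low_link A B) (high_link (maximals E - B) (minimals E - A)) (free_part E A B) = 0"
    if AB: "A \<subseteq> minimals E" for A B
  proof (rule gap_eq_0 [OF finite_free_part [OF assms(1)] absorbs_low_link absorbs_high_link])
    fix z assume z: "z \<in> free_part E A B"
    then have zE: "z \<in> E" "z \<notin> minimals E" "z \<notin> maximals E" unfolding free_part_def by auto
    consider (low) "\<And>a b. a \<in> A \<Longrightarrow> b \<in> A \<Longrightarrow> a \<le> z \<Longrightarrow> b \<le> z \<Longrightarrow> a = b"
      | (high) "\<And>a b. a \<in> maximals E - B \<Longrightarrow> b \<in> maximals E - B \<Longrightarrow> z \<le> a \<Longrightarrow> z \<le> b \<Longrightarrow> a = b"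
    proof (rule ccontr)
      assume "\<not> thesis"
      then obtain a b c d where ab: "a \<in> A" "b \<in> A" "a \<le> z" "b \<le> z" "a \<noteq> b"
        and cd: "c \<in> maximals E" "d \<in> maximals E" "z \<le> c" "z \<le> d" "c \<noteq> d"
        using low high by blast
      then have "a < z" "b < z" "z < c" "z < d" using zE AB by (auto simp: less_le)
      moreover have "incomparable a b" "incomparable c d"
        using ab cd AB minimals_subset [of E] maximals_subset [of E] minimalsD maximalsD
        unfolding incomparable_def by blast+
      moreover have "{a, b, c, d, z} \<subseteq> P"
        using ab cd AB zE \<open>E \<subseteq> P\<close> minimals_subset [of E] maximals_subset [of E] by blast
      ultimately show False using \<open>X_free P\<close> unfolding X_free_def by blast
    qed
    then show "(\<forall>S. low_link A B (insert z S) = low_link A B S) \<or>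
        (\<forall>S. high_link (maximals E - B) (minimals E - A) (insert z S) =
          high_link (maximals E - B) (minimals E - A) S)"
    proof cases
      case low
      then have "linked (\<le>) A (B \<union> insert z S) = linked (\<le>) A (B \<union> S)" for S
        by (rule linked_insert_irrelevant)
      then show ?thesis unfolding low_link_def by simp
    next
      case high
      then have "linked (\<ge>) (maximals E - B) ((minimals E - A) \<union> insert z S) =
          linked (\<ge>) (maximals E - B) ((minimals E - A) \<union> S)" for S
        by (rule linked_insert_irrelevant)
      then show ?thesis unfolding high_link_def by simp
    qed
  qed
  then have "int (card (chain_splits E)) - int (card (order_splits E)) = 0"
    unfolding card_splits_gap [OF assms(1,2)] by (intro sum.neutral) auto
  then show ?thesis by simp
qed

text \<open>All gaps are nonnegative, so a single positive one suffices. It belongs to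
  \<open>A = minimals E\<close> and \<open>B = {}\<close>: there \<open>e\<close> is free and alone
  links both the two minimal and the two maximal elements, which are unlinked when no free element
  is present.\<close>

lemma card_order_splits_less:
  fixes d1 d2 e u1 u2 :: "'a::order"
  assumes fin: "finite E" and E: "minimals E = {d1, d2}" "maximals E = {u1, u2}" "e \<in> E"
    and X: "d1 < e" "d2 < e" "e < u1" "e < u2" "incomparable d1 d2" "incomparable u1 u2"
  shows "card (order_splits E) < card (chain_splits E)"
proof -
  let ?L = "minimals E" and ?U = "maximals E"
  have disj: "?L \<inter> ?U = {}" using E X by auto
  have ne: "d1 \<noteq> d2" "u1 \<noteq> u2" using X unfolding incomparable_def by auto
  have "e \<in> free_part E ?L {}" using E X unfolding free_part_def by auto
  moreover have "linked (\<le>) {d1, d2} {e}" "linked (\<ge>) {u1, u2} {e}"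
    using X by (auto intro!: linked_pair)
  then have "low_link ?L {} {e} = 1" "high_link ?U {} {e} = 1"
    unfolding low_link_def high_link_def E by auto
  moreover have "\<not> linked (\<le>) {d1, d2} {}" "\<not> linked (\<ge>) {u1, u2} {}"
    using ne unfolding linked_def by blast+
  then have "low_link ?L {} {} = 0" "high_link ?U {} {} = 0"
    unfolding low_link_def high_link_def E by auto
  ultimately have "0 < gap (low_link ?L {}) (high_link (?U - {}) (?L - ?L)) (free_part E ?L {})"
    by (intro gap_pos [of _ _ _ e] finite_free_part fin
        absorbs_low_link absorbs_high_link mono_low_link mono_high_link) auto
  then have "0 < int (card (chain_splits E)) - int (card (order_splits E))"
    unfolding card_splits_gap [OF fin disj]
    by (intro sum_pos2 [of _ "(?L, {})"]) (auto intro!: gap_nonneg finite_free_part fin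
        absorbs_low_link absorbs_high_link mono_low_link mono_high_link simp: E)
  then show ?thesis by simp
qed

section \<open>Polytopes with 0/1 vertices\<close>

definition ind :: "'a::finite set \<Rightarrow> real ^ 'a" where
  "ind V = (\<chi> p. of_bool (p \<in> V))"

definition verts :: "(real ^ 'a::finite) set \<Rightarrow> 'a set set" where
  "verts F = {V. ind V \<in> F}"

definition hull01 :: "'a::finite set set \<Rightarrow> (real ^ 'a) set" where
  "hull01 W = convex hull (ind ` W)"

definition unit_cube :: "(real ^ 'a::finite) set" where
  "unit_cube = {x. \<forall>p. 0 \<le> x $ p \<and> x $ p \<le> 1}"

lemma ind_nth [simp]: "ind V $ p = of_bool (p \<in> V)"
  by (simp add: ind_def)

lemma ind_eq_iff [simp]: "ind V = ind W \<longleftrightarrow> V = W"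
  by (auto simp: vec_eq_iff)

lemma inj_ind: "inj ind"
  by (simp add: inj_def)

text \<open>The values 0 and 1 are extremal for a coordinate on the cube, so along a segment with
  \<open>ind V\<close> in its interior no coordinate can vary.\<close>

lemma extreme_point_ind:
  assumes T: "T \<subseteq> unit_cube" and "ind V \<in> T"
  shows "ind V extreme_point_of T"
  unfolding extreme_point_of_def
proof (intro conjI ballI notI)
  fix a b assume ab: "a \<in> T" "b \<in> T" "ind V \<in> open_segment a b"
  then obtain u where u: "0 < u" "u < 1" "ind V = (1 - u) *\<^sub>R a + u *\<^sub>R b" and "a \<noteq> b"
    by (auto simp: in_segment)
  have "a $ p = b $ p" for p
  proof -
    have bounds: "0 \<le> a $ p" "a $ p \<le> 1" "0 \<le> b $ p" "b $ p \<le> 1"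
      using ab T unfolding unit_cube_def by auto
    have eq: "of_bool (p \<in> V) = (1 - u) * a $ p + u * b $ p"
      using arg_cong [OF u(3), of "\<lambda>x. x $ p"] by simp
    show ?thesis
    proof (cases "p \<in> V")
      case True
      then have "(1 - u) * (1 - a $ p) + u * (1 - b $ p) = 0" using eq by (simp add: algebra_simps)
      moreover have "0 \<le> (1 - u) * (1 - a $ p)" "0 \<le> u * (1 - b $ p)" using u bounds by auto
      ultimately have "(1 - u) * (1 - a $ p) = 0" "u * (1 - b $ p) = 0" by linarith+
      then show ?thesis using u by simp
    next
      case False
      then have "(1 - u) * a $ p + u * b $ p = 0" using eq by simp
      moreover have "0 \<le> (1 - u) * a $ p" "0 \<le> u * b $ p" using u bounds by auto
      ultimately have "(1 - u) * a $ p = 0" "u * b $ p = 0" by linarith+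
      then show ?thesis using u by simp
    qed
  qed
  then show False using \<open>a \<noteq> b\<close> by (simp add: vec_eq_iff)
qed (use assms in auto)

lemma convex_unit_cube: "convex unit_cube"
proof -
  have eq: "unit_cube = cbox (0 :: real ^ 'a) 1"
    unfolding unit_cube_def by (auto simp: mem_box_cart)
  show "convex (unit_cube :: (real ^ 'a) set)" unfolding eq by (rule convex_box)
qed

lemma hull01_unit_cube: "hull01 W \<subseteq> unit_cube"
  unfolding hull01_def by (intro hull_minimal convex_unit_cube) (auto simp: unit_cube_def)

text \<open>Cube vertices remain extreme in every subset of the cube, so a hull of some of them
  contains no others. Faces can therefore be identified with families of sets.\<close>

lemma verts_hull01 [simp]: "verts (hull01 W) = W"
proof (intro equalityI subsetI)
  fix V assume "V \<in> verts (hull01 W)"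
  then have "ind V extreme_point_of (hull01 W)"
    using hull01_unit_cube by (auto simp: verts_def intro: extreme_point_ind)
  then have "ind V \<in> ind ` W" unfolding hull01_def by (rule extreme_point_of_convex_hull)
  then show "V \<in> W" by auto
next
  fix V assume "V \<in> W"
  then show "V \<in> verts (hull01 W)" unfolding verts_def hull01_def by (simp add: hull_inc)
qed

lemma ind_mem_hull01: "V \<in> \<W> \<Longrightarrow> ind V \<in> hull01 \<W>"
  unfolding hull01_def by (simp add: hull_inc)

lemma hull01_segment:
  "a \<in> hull01 \<W> \<Longrightarrow> b \<in> hull01 \<W> \<Longrightarrow> 0 \<le> r \<Longrightarrow> r \<le> 1 \<Longrightarrow> (1 - r) *\<^sub>R a + r *\<^sub>R b \<in> hull01 \<W>"
  unfolding hull01_def by (rule convexD [OF convex_convex_hull]) auto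

lemma inj_hull01: "inj hull01"
  by (metis injI verts_hull01)

section \<open>Cube vertices in a plane\<close>

lemma affine_independent_ind:
  assumes "A \<noteq> B" "A \<noteq> C" "B \<noteq> C"
  shows "\<not> affine_dependent {ind A, ind B, ind C}"
proof
  assume "affine_dependent {ind A, ind B, ind C}"
  then have "collinear {ind A, ind B, ind C}" by (simp add: collinear_3_eq_affine_dependent)
  then obtain u where B: "ind B = u *\<^sub>R ind A + (1 - u) *\<^sub>R ind C"
    using assms by (auto simp: collinear_3_expand)
  have eq: "of_bool (p \<in> B) = u * of_bool (p \<in> A) + (1 - u) * of_bool (p \<in> C)" for p
    using arg_cong [OF B, of "\<lambda>x. x $ p"] by simp
  obtain p where "p \<in> A \<longleftrightarrow> p \<notin> C" using assms(2) by blast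
  then have "u = 0 \<or> u = 1" using eq [of p] by (cases "p \<in> A"; cases "p \<in> B") auto
  then show False
  proof
    assume "u = 0"
    then have "p \<in> B \<longleftrightarrow> p \<in> C" for p using eq [of p] by (simp add: of_bool_eq_iff)
    then have "B = C" by blast
    then show False using assms by simp
  next
    assume "u = 1"
    then have "p \<in> B \<longleftrightarrow> p \<in> A" for p using eq [of p] by (simp add: of_bool_eq_iff)
    then have "B = A" by blast
    then show False using assms by simp
  qed
qed

text \<open>At a coordinate separating \<open>A\<close> from both \<open>B\<close> and
  \<open>C\<close>, \<open>ind D\<close> takes the value \<open>u\<close> or \<open>1 - u\<close>,
  so \<open>u\<close> is 0 or 1. A coordinate that separates two of the three sets separates one of
  these two from the other sets, so at least two coefficients are 0 or 1. As \<open>D\<close> is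
  new, only the permutations of \<open>(1, 1, -1)\<close> are left.\<close>

lemma ind_affine_cases:
  assumes "A \<noteq> B" "A \<noteq> C" "B \<noteq> C" "D \<noteq> A" "D \<noteq> B" "D \<noteq> C"
    and D: "ind D = u *\<^sub>R ind A + v *\<^sub>R ind B + w *\<^sub>R ind C" and uvw: "u + v + w = 1"
  shows "ind A + ind B = ind C + ind D \<or> ind A + ind C = ind B + ind D \<or> ind B + ind C = ind A + ind D"
proof -
  have eq: "of_bool (p \<in> D) = u * of_bool (p \<in> A) + v * of_bool (p \<in> B) + w * of_bool (p \<in> C)" for p
    using arg_cong [OF D, of "\<lambda>x. x $ p"] by simp
  have u: "u = 0 \<or> u = 1" if "p \<in> A \<longleftrightarrow> p \<notin> B" "p \<in> A \<longleftrightarrow> p \<notin> C" for p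
    using eq [of p] that uvw by (cases "p \<in> A"; cases "p \<in> D") auto
  have v: "v = 0 \<or> v = 1" if "p \<in> B \<longleftrightarrow> p \<notin> A" "p \<in> B \<longleftrightarrow> p \<notin> C" for p
    using eq [of p] that uvw by (cases "p \<in> B"; cases "p \<in> D") auto
  have w: "w = 0 \<or> w = 1" if "p \<in> C \<longleftrightarrow> p \<notin> A" "p \<in> C \<longleftrightarrow> p \<notin> B" for p
    using eq [of p] that uvw by (cases "p \<in> C"; cases "p \<in> D") auto
  have uv: "(u = 0 \<or> u = 1) \<or> (v = 0 \<or> v = 1)" using assms(1) u v by blast
  have uw: "(u = 0 \<or> u = 1) \<or> (w = 0 \<or> w = 1)" using assms(2) u w by blast
  have vw: "(v = 0 \<or> v = 1) \<or> (w = 0 \<or> w = 1)" using assms(3) v w by blast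
  have nA: "\<not> (u = 1 \<and> v = 0 \<and> w = 0)" and nB: "\<not> (u = 0 \<and> v = 1 \<and> w = 0)"
    and nC: "\<not> (u = 0 \<and> v = 0 \<and> w = 1)"
    using D assms(4-6) by auto
  have "(u = 1 \<and> v = 1 \<and> w = -1) \<or> (u = 1 \<and> w = 1 \<and> v = -1) \<or> (v = 1 \<and> w = 1 \<and> u = -1)"
    using uv uw vw nA nB nC uvw by (smt (verit))
  then show ?thesis unfolding D by auto
qed

text \<open>The sum of the two relations is \<open>2 *\<^sub>R ind A = ind D + ind D'\<close>, which
  for 0/1 vectors forces \<open>D\<close> and \<open>D'\<close> to be \<open>A\<close>. Hence a
  triangle has no two completions of different type by new vertices.\<close>

lemma ind_parallelogram_unique:
  assumes "ind A + ind B = ind C + ind D" "ind A + ind C = ind B + ind D'"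
  shows "D = A"
proof (rule set_eqI)
  fix p
  have "of_bool (p \<in> A) + of_bool (p \<in> B) = (of_bool (p \<in> C) + of_bool (p \<in> D) :: real)"
    "of_bool (p \<in> A) + of_bool (p \<in> C) = (of_bool (p \<in> B) + of_bool (p \<in> D') :: real)"
    using arg_cong [OF assms(1), of "\<lambda>x. x $ p"] arg_cong [OF assms(2), of "\<lambda>x. x $ p"] by auto
  then show "p \<in> D \<longleftrightarrow> p \<in> A"
    by (auto simp: of_bool_def split: if_splits)
qed

text \<open>Three affinely independent vertices span the plane, and any further one completes them
  to a parallelogram. Completions of different types clash and those of the same type coincide, so
  there is at most one.\<close>

lemma planar_ind_cases:
  assumes dim: "aff_dim (ind ` \<W>) = 2"
  shows "card \<W> = 3 \<or> (card \<W> = 4 \<and> (\<exists>A B C D. \<W> = {A, B, C, D} \<and> distinct [A, B, C, D] \<and>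
    ind A + ind B = ind C + ind D))"
proof -
  obtain T where T: "T \<subseteq> ind ` \<W>" "affine hull T = affine hull (ind ` \<W>)"
      "\<not> affine_dependent T" "of_nat (card T) = aff_dim (ind ` \<W>) + 1"
    using aff_dim_inner_basis_exists by blast
  then have "card T = 3" using dim by simp
  moreover obtain \<T> where \<T>: "\<T> \<subseteq> \<W>" "T = ind ` \<T>" using T(1) by (auto simp: subset_image_iff)
  ultimately have "card \<T> = 3" using card_image [OF inj_on_subset [OF inj_ind, of \<T>]] by auto
  then obtain A B C where ABC: "\<T> = {A, B, C}" "A \<noteq> B" "A \<noteq> C" "B \<noteq> C"
    by (auto simp: card_3_iff)
  have hull: "ind D \<in> affine hull {ind A, ind B, ind C}" if "D \<in> \<W>" for D
  proof -
    have "ind D \<in> affine hull (ind ` \<W>)" using that by (simp add: hull_inc)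
    then show ?thesis using T(2) \<T>(2) ABC(1) by simp
  qed
  define par where "par D \<longleftrightarrow> ind A + ind B = ind C + ind D \<or> ind A + ind C = ind B + ind D \<or>
    ind B + ind C = ind A + ind D" for D
  have par: "par D" if D: "D \<in> \<W>" "D \<notin> \<T>" for D
  proof -
    obtain u v w where uvw: "u + v + w = 1" "ind D = u *\<^sub>R ind A + v *\<^sub>R ind B + w *\<^sub>R ind C"
      using hull [OF D(1)] unfolding affine_hull_3 by blast
    have "D \<noteq> A" "D \<noteq> B" "D \<noteq> C" using D ABC(1) by auto
    then show ?thesis unfolding par_def
      using ind_affine_cases [OF ABC(2-4) _ _ _ uvw(2,1)] by blast
  qed
  have unique: "D = D'" if "D \<in> \<W>" "D \<notin> \<T>" "D' \<in> \<W>" "D' \<notin> \<T>" for D D'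
  proof -
    have ne: "D \<noteq> A" "D \<noteq> B" "D \<noteq> C" "D' \<noteq> A" "D' \<noteq> B" "D' \<noteq> C" using that ABC(1) by auto
    have clash: False if "ind X + ind Y = ind Z + ind G" "ind X + ind Z = ind Y + ind G'" "G \<noteq> X"
      for X Y Z G G' :: "'a set"
      using ind_parallelogram_unique [OF that(1,2)] that(3) by simp
    note parD = par [OF that(1,2)] and parD' = par [OF that(3,4)]
    consider "ind A + ind B = ind C + ind D" | "ind A + ind C = ind B + ind D"
      | "ind B + ind C = ind A + ind D" using parD unfolding par_def by blast
    note D = this
    consider "ind A + ind B = ind C + ind D'" | "ind A + ind C = ind B + ind D'"
      | "ind B + ind C = ind A + ind D'" using parD' unfolding par_def by blast
    note D' = this
    show ?thesis
      using D
    proof cases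
      case 1
      show ?thesis
        using D'
      proof cases
        case 2
        then show ?thesis using clash [of A B C D D'] 1 ne by simp
      next
        case 3
        then show ?thesis using clash [of B A C D D'] 1 ne by (simp add: add.commute)
      qed (use 1 in \<open>metis add_left_cancel ind_eq_iff\<close>)
    next
      case 2
      show ?thesis
        using D'
      proof cases
        case 1
        then show ?thesis using clash [of A C B D D'] 2 ne by simp
      next
        case 3
        then show ?thesis using clash [of C A B D D'] 2 ne by (simp add: add.commute)
      qed (use 2 in \<open>metis add_left_cancel ind_eq_iff\<close>)
    next
      case 3
      show ?thesis
        using D'
      proof cases
        case 1
        then show ?thesis using clash [of B C A D D'] 3 ne by (simp add: add.commute)
      next
        case 2
        then show ?thesis using clash [of C B A D D'] 3 ne by (simp add: add.commute)
      qed (use 3 in \<open>metis add_left_cancel ind_eq_iff\<close>)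
    qed
  qed
  show ?thesis
  proof (cases "\<W> = \<T>")
    case True
    then show ?thesis using \<open>card \<T> = 3\<close> by simp
  next
    case False
    then obtain D where D: "D \<in> \<W>" "D \<notin> \<T>" using \<T>(1) by blast
    have W: "\<W> = {A, B, C, D}"
    proof (intro equalityI subsetI)
      fix X assume "X \<in> \<W>"
      then show "X \<in> {A, B, C, D}" using unique [OF _ _ D] ABC(1) by (cases "X \<in> \<T>") auto
    qed (use D \<T>(1) ABC(1) in auto)
    have ne: "D \<noteq> A" "D \<noteq> B" "D \<noteq> C" using D ABC(1) by auto
    have "card \<W> = 4" using W ABC ne by simp
    moreover have "\<exists>A B C D. \<W> = {A, B, C, D} \<and> distinct [A, B, C, D] \<and>
        ind A + ind B = ind C + ind D"
    proof -
      have ex: ?thesis if "ind X + ind Y = ind Z + ind D" "\<W> = {X, Y, Z, D}" "distinct [X, Y, Z, D]"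
        for X Y Z using that by blast
      have "\<W> = {A, C, B, D}" "\<W> = {B, C, A, D}" unfolding W by blast+
      moreover have "distinct [A, B, C, D]" "distinct [A, C, B, D]" "distinct [B, C, A, D]"
        using ABC(2-4) ne by auto
      ultimately show ?thesis
        using par [OF D] ex [OF _ W] ex [of A C B] ex [of B C A] unfolding par_def by argo
    qed
    ultimately show ?thesis by blast
  qed
qed

section \<open>Faces cut out by tight inequalities\<close>

definition affine_form :: "('b::real_vector \<Rightarrow> real) \<Rightarrow> bool" where
  "affine_form f \<longleftrightarrow> (\<forall>x y u v. u + v = 1 \<longrightarrow> f (u *\<^sub>R x + v *\<^sub>R y) = u * f x + v * f y)"

text \<open>The points of \<open>S\<close> at which every valid affine inequality that is tight on
  \<open>W\<close> is tight too. Since this is a face, the hull of a subset \<open>W\<close> of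
  \<open>S\<close> is shown to be a face by exhibiting enough tight inequalities to confine this set
  to the hull.\<close>

definition tight_hull :: "'b::real_vector set \<Rightarrow> 'b set \<Rightarrow> 'b set" where
  "tight_hull S W = {y\<in>S. \<forall>f. affine_form f \<and> (\<forall>x\<in>S. 0 \<le> f x) \<and> (\<forall>w\<in>W. f w = 0) \<longrightarrow> f y = 0}"

lemma affine_form_nth: "affine_form (\<lambda>x. x $ p)"
  by (simp add: affine_form_def)

lemma affine_form_const: "affine_form (\<lambda>x. c)"
  unfolding affine_form_def by (metis distrib_right mult_1)

lemma affine_form_diff: "affine_form f \<Longrightarrow> affine_form g \<Longrightarrow> affine_form (\<lambda>x. f x - g x)"
  by (simp add: affine_form_def algebra_simps)

lemmas affine_form_intros = affine_form_nth affine_form_const affine_form_diff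

lemma tight_hullD:
  "y \<in> tight_hull S W \<Longrightarrow> affine_form f \<Longrightarrow> (\<And>x. x \<in> S \<Longrightarrow> 0 \<le> f x) \<Longrightarrow> (\<And>w. w \<in> W \<Longrightarrow> f w = 0)
    \<Longrightarrow> f y = 0"
  unfolding tight_hull_def by blast

lemma tight_hull_subset: "tight_hull S W \<subseteq> S"
  unfolding tight_hull_def by blast

lemma tight_hull_superset: "W \<subseteq> S \<Longrightarrow> W \<subseteq> tight_hull S W"
  unfolding tight_hull_def by blast

text \<open>A nonnegative affine function that vanishes at an interior point of a segment vanishes
  at both ends.\<close>

lemma tight_hull_face_of:
  assumes "convex S"
  shows "tight_hull S W face_of S"
  unfolding face_of_def
proof (intro conjI ballI impI)
  show "tight_hull S W \<subseteq> S" by (rule tight_hull_subset)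
  show "convex (tight_hull S W)"
  proof (rule convexI)
    fix x y and u v :: real assume xy: "x \<in> tight_hull S W" "y \<in> tight_hull S W" and uv: "0 \<le> u" "0 \<le> v" "u + v = 1"
    have "u *\<^sub>R x + v *\<^sub>R y \<in> S"
      using xy uv assms tight_hull_subset by (meson convexD subsetD)
    moreover have "f (u *\<^sub>R x + v *\<^sub>R y) = 0" if "affine_form f" "\<forall>x\<in>S. 0 \<le> f x" "\<forall>w\<in>W. f w = 0" for f
    proof -
      have "f x = 0" "f y = 0" using xy that unfolding tight_hull_def by blast+
      then show ?thesis using that(1) uv(3) unfolding affine_form_def by simp
    qed
    ultimately show "u *\<^sub>R x + v *\<^sub>R y \<in> tight_hull S W" unfolding tight_hull_def by blast
  qed
  have "f a = 0 \<and> f b = 0"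
    if "a \<in> S" "b \<in> S" "x \<in> tight_hull S W" "x \<in> open_segment a b"
      and f: "affine_form f" "\<forall>x\<in>S. 0 \<le> f x" "\<forall>w\<in>W. f w = 0" for a b x f
  proof -
    note x = that(4)
    obtain u where u: "0 < u" "u < 1" "x = (1 - u) *\<^sub>R a + u *\<^sub>R b"
      using x by (auto simp: in_segment)
    have "f x = 0" using that(3) f unfolding tight_hull_def by blast
    moreover have "f x = (1 - u) * f a + u * f b"
      using f(1) u(3) unfolding affine_form_def by simp
    moreover have "0 \<le> (1 - u) * f a" "0 \<le> u * f b" using f(2) that(1,2) u by auto
    ultimately have "(1 - u) * f a = 0" "u * f b = 0" by linarith+
    then show ?thesis using u by simp
  qed
  then show "a \<in> tight_hull S W" "b \<in> tight_hull S W"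
    if "a \<in> S" "b \<in> S" "x \<in> tight_hull S W" "x \<in> open_segment a b" for a b x
    using that unfolding tight_hull_def [of S W] by blast+
qed

section \<open>A common frame for the two polytopes\<close>

lemma comp_unionsD: "X \<in> comp_unions E \<Longrightarrow> p \<in> X \<Longrightarrow> q \<in> E \<Longrightarrow> p \<le> q \<or> q \<le> p \<Longrightarrow> q \<in> X"
  unfolding comp_unions_def incomparable_def by auto

lemma comp_unions_Diff: "X \<in> comp_unions E \<Longrightarrow> E - X \<in> comp_unions E"
  unfolding comp_unions_def incomparable_def by blast

text \<open>If the symmetric difference has \<open>k\<close> components, these are the corners of a
  \<open>k\<close>-dimensional parallelepiped with \<open>V\<close> and \<open>W\<close> as opposite
  corners; for \<open>k = 2\<close> it is the square.\<close>

definition square_verts :: "'a::order set \<Rightarrow> 'a set \<Rightarrow> 'a set set" where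
  "square_verts V W = sym_diff V ` comp_unions (sym_diff V W)"

text \<open>Reflects the cube so that \<open>ind V\<close> becomes the origin. In these coordinates
  the inequalities of the two polytopes look alike.\<close>

definition coord :: "'a::finite set \<Rightarrow> real ^ 'a \<Rightarrow> 'a \<Rightarrow> real" where
  "coord V y p = (if p \<in> V then 1 - y $ p else y $ p)"

lemma affine_form_coord: "affine_form (\<lambda>y. coord V y p)"
proof (cases "p \<in> V")
  case True
  then show ?thesis unfolding coord_def by (simp add: affine_form_intros)
next
  case False
  then show ?thesis unfolding coord_def by (simp add: affine_form_nth)
qed

lemma coord_ind: "coord V (ind W) p = of_bool (p \<in> sym_diff V W)"
  unfolding coord_def by auto

lemma sym_diff_cancel [simp]: "sym_diff V (sym_diff V X) = X"
  by blast

lemma inj_sym_diff: "inj (sym_diff V)"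
  by (rule inj_on_inverseI [where g = "sym_diff V"]) (rule sym_diff_cancel)

text \<open>A nonempty union of components inside one of two components is that component, put in a
  form that fits an explicit list of the four unions.\<close>

lemma four_sets:
  assumes "A \<in> {{}, X, Y, E}" "p \<in> A" "A \<subseteq> Z" "Z = X \<or> Z = Y" "X \<inter> Y = {}"
    and "{} \<noteq> X" "{} \<noteq> Y" "X \<noteq> E" "Y \<noteq> E" "X \<subseteq> E" "Y \<subseteq> E"
  shows "A = Z"
  using assms by auto

text \<open>\<open>exchange\<close> lets the components of a symmetric difference be toggled
  independently. \<open>tight\<close> provides a valid inequality for every comparable pair in it:
  \<open>y $ p \<le> y $ q\<close> for filters, where both or neither of \<open>p\<close>,
  \<open>q\<close> are in \<open>V\<close>, and \<open>y $ p + y $ q \<le> 1\<close> for antichains,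
  where exactly one is. Both are comparisons of reflected coordinates.\<close>

locale zero_one_polytope =
  fixes S :: "(real ^ 'a::{finite,order}) set" and \<V> :: "'a set set"
  assumes compact: "compact S" and convex: "convex S" and unit: "S \<subseteq> unit_cube"
    and ind_mem: "V \<in> \<V> \<Longrightarrow> ind V \<in> S"
    and extreme: "x extreme_point_of S \<Longrightarrow> x \<in> ind ` \<V>"
    and exchange: "V \<in> \<V> \<Longrightarrow> W \<in> \<V> \<Longrightarrow> X \<in> comp_unions (sym_diff V W) \<Longrightarrow> sym_diff V X \<in> \<V>"
    and tight: "V \<in> \<V> \<Longrightarrow> W \<in> \<V> \<Longrightarrow> p \<in> sym_diff V W \<Longrightarrow> q \<in> sym_diff V W \<Longrightarrow> p < q \<Longrightarrow>
      (\<forall>y\<in>S. coord V y p \<le> coord V y q) \<or> (\<forall>y\<in>S. coord V y q \<le> coord V y p)"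
begin

lemma verts_face: "F face_of S \<Longrightarrow> verts F \<subseteq> \<V>"
proof
  fix V assume F: "F face_of S" and "V \<in> verts F"
  then have "ind V \<in> S" using face_of_imp_subset unfolding verts_def by blast
  then have "ind V extreme_point_of S" using unit by (rule extreme_point_ind [rotated])
  then show "V \<in> \<V>" using extreme by fastforce
qed

lemma extreme_points_face:
  assumes "F face_of S"
  shows "{v. v extreme_point_of F} = ind ` verts F"
proof -
  have sub: "F \<subseteq> unit_cube" using assms unit face_of_imp_subset by blast
  have "v \<in> ind ` verts F" if "v extreme_point_of F" for v
  proof -
    have "v \<in> F" "v extreme_point_of S"
      using that extreme_point_of_face [OF assms] by auto
    then show ?thesis using extreme unfolding verts_def by blast
  qed
  moreover have "v extreme_point_of F" if "v \<in> ind ` verts F" for v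
    using that extreme_point_ind [OF sub] unfolding verts_def by auto
  ultimately show ?thesis by blast
qed

lemma card_extreme_points_face:
  "F face_of S \<Longrightarrow> card {v. v extreme_point_of F} = card (verts F)"
  by (simp add: extreme_points_face card_image inj_on_subset [OF inj_ind])

lemma face_eq_hull01:
  assumes "F face_of S"
  shows "F = hull01 (verts F)"
proof -
  have "compact F" using face_of_imp_compact [OF convex compact assms] .
  moreover have "convex F" using face_of_imp_convex [OF assms] .
  ultimately have "F = convex hull {v. v extreme_point_of F}" by (rule Krein_Milman_Minkowski)
  then show ?thesis using extreme_points_face [OF assms] unfolding hull01_def by simp
qed

text \<open>Toggling \<open>X\<close> in both \<open>V\<close> and \<open>W\<close> preserves
  \<open>ind V + ind W\<close>, as \<open>X\<close> lies in the symmetric difference. The new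
  segment has the same midpoint, and a face containing the midpoint contains the ends.\<close>

lemma exchange_face:
  assumes F: "F face_of S" and VW: "V \<in> verts F" "W \<in> verts F"
    and X: "X \<in> comp_unions (sym_diff V W)"
  shows "sym_diff V X \<in> verts F"
proof -
  let ?V = "sym_diff V X" and ?W = "sym_diff W X"
  have eq: "sym_diff W V = sym_diff V W" by blast
  have "V \<in> \<V>" "W \<in> \<V>" using VW verts_face [OF F] by auto
  then have "?V \<in> \<V>" "?W \<in> \<V>" using exchange [of V W X] exchange [of W V X] X eq by auto
  then have S: "ind ?V \<in> S" "ind ?W \<in> S" by (auto intro: ind_mem)
  have XE: "X \<subseteq> sym_diff V W" using X unfolding comp_unions_def by blast
  have "ind ?V + ind ?W = ind V + ind W"
  proof -
    have "(ind ?V + ind ?W) $ p = (ind V + ind W) $ p" for p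
      using XE by (cases "p \<in> X"; cases "p \<in> V"; cases "p \<in> W") auto
    then show ?thesis by (simp add: vec_eq_iff)
  qed
  then have mid: "midpoint (ind ?V) (ind ?W) = midpoint (ind V) (ind W)" by (simp add: midpoint_def)
  have "midpoint (ind V) (ind W) \<in> F"
    using VW face_of_imp_convex [OF F] unfolding verts_def
    by (auto simp: midpoint_def intro!: convexD [of F _ _ "1/2" "1/2", simplified scaleR_add_right [symmetric]])
  then have mF: "midpoint (ind ?V) (ind ?W) \<in> F" using mid by simp
  show ?thesis
  proof (cases "?V = ?W")
    case True
    then show ?thesis using mF unfolding verts_def by simp
  next
    case False
    then have "midpoint (ind ?V) (ind ?W) \<in> open_segment (ind ?V) (ind ?W)" by simp
    then show ?thesis using face_ofD [OF F _ S mF] unfolding verts_def by blast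
  qed
qed

lemma square_verts_face:
  "F face_of S \<Longrightarrow> V \<in> verts F \<Longrightarrow> W \<in> verts F \<Longrightarrow> square_verts V W \<subseteq> verts F"
  unfolding square_verts_def using exchange_face by blast

text \<open>A proper union of components and its complement would bring four vertices into the
  face.\<close>

lemma connected_of_card_3:
  assumes F: "F face_of S" and VW: "V \<in> verts F" "W \<in> verts F" "V \<noteq> W" and card: "card (verts F) = 3"
  shows "poset_connected (sym_diff V W)"
proof -
  let ?E = "sym_diff V W"
  have "X = {} \<or> X = ?E" if X: "X \<in> comp_unions ?E" for X
  proof (rule ccontr)
    assume ne: "\<not> ?thesis"
    have XE: "X \<subseteq> ?E" using X unfolding comp_unions_def by blast
    have "{{}, X, ?E - X, ?E} \<subseteq> comp_unions ?E" using X comp_unions_Diff by auto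
    then have "sym_diff V ` {{}, X, ?E - X, ?E} \<subseteq> verts F"
      using square_verts_face [OF F VW(1,2)] unfolding square_verts_def by blast
    then have "card (sym_diff V ` {{}, X, ?E - X, ?E}) \<le> card (verts F)" by (intro card_mono) auto
    moreover have "card (sym_diff V ` {{}, X, ?E - X, ?E}) = card {{}, X, ?E - X, ?E}"
      by (rule card_image [OF inj_on_subset [OF inj_sym_diff]]) auto
    moreover have "card {{}, X, ?E - X, ?E} = 4"
    proof -
      have "{} \<noteq> X" "{} \<noteq> ?E - X" "{} \<noteq> ?E" "X \<noteq> ?E - X" "X \<noteq> ?E" "?E - X \<noteq> ?E"
        using ne XE by blast+
      then show ?thesis by simp
    qed
    ultimately show False using card by simp
  qed
  then have "comp_unions ?E = {{}, ?E}" using comp_unions_trivial by blast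
  then show ?thesis using VW(3) unfolding poset_connected_def by blast
qed

text \<open>In coordinates reflected at \<open>V\<close>, the values of \<open>V'\<close> and
  \<open>W'\<close> add up to 1 on the symmetric difference of \<open>V\<close> and
  \<open>W\<close>. An inequality between comparable \<open>p\<close> and \<open>q\<close> that
  holds for both vertices is then an equality, so \<open>sym_diff V V'\<close> is closed under
  comparability.\<close>

lemma parallelogram_comp_unions:
  assumes V: "V \<in> \<V>" "W \<in> \<V>" "V' \<in> \<V>" "W' \<in> \<V>" and eq: "ind V + ind W = ind V' + ind W'"
  shows "sym_diff V V' \<in> comp_unions (sym_diff V W)"
proof -
  have nth: "of_bool (p \<in> V) + of_bool (p \<in> W) = (of_bool (p \<in> V') + of_bool (p \<in> W') :: real)" for p
    using arg_cong [OF eq, of "\<lambda>x. x $ p"] by simp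
  have sub: "sym_diff V V' \<subseteq> sym_diff V W"
  proof
    fix p assume "p \<in> sym_diff V V'"
    then show "p \<in> sym_diff V W"
      using nth [of p] by (auto simp: of_bool_def split: if_splits)
  qed
  have comp: "p \<in> sym_diff V V' \<longleftrightarrow> q \<in> sym_diff V V'"
    if pq: "p \<in> sym_diff V W" "q \<in> sym_diff V W" "p < q" for p q
  proof -
    have co: "coord V (ind V') r + coord V (ind W') r = 1" if "r \<in> sym_diff V W" for r
      using that nth [of r] unfolding coord_def by (auto simp: of_bool_def split: if_splits)
    have "ind V' \<in> S" "ind W' \<in> S" using ind_mem V by auto
    then have "(coord V (ind V') p \<le> coord V (ind V') q \<and> coord V (ind W') p \<le> coord V (ind W') q) \<or>
        (coord V (ind V') q \<le> coord V (ind V') p \<and> coord V (ind W') q \<le> coord V (ind W') p)"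
      using tight [OF V(1,2) pq] by blast
    then have "coord V (ind V') p = coord V (ind V') q"
      using co [OF pq(1)] co [OF pq(2)] by linarith
    then show ?thesis unfolding coord_ind by (simp only: of_bool_eq_iff)
  qed
  show ?thesis
    unfolding comp_unions_def incomparable_def
  proof (intro CollectI conjI ballI notI)
    show "sym_diff V V' \<subseteq> sym_diff V W" by (rule sub)
    fix p q assume p: "p \<in> sym_diff V V'" and q: "q \<in> sym_diff V W - sym_diff V V'"
    then have pq: "p \<in> sym_diff V W" "q \<in> sym_diff V W" "q \<notin> sym_diff V V'" "p \<noteq> q" using sub by blast+
    show False if "p \<le> q"
      using comp [OF pq(1,2)] that pq p by (simp only: order_le_less) blast
    show False if "q \<le> p"
      using comp [OF pq(2,1)] that pq p by (simp only: order_le_less) blast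
  qed
qed

text \<open>In a parallelogram with diagonal \<open>A\<close>, \<open>B\<close>, the other two
  corners arise by toggling unions of components, and conversely all toggles stay in the face;
  toggling is injective, so there are four unions.\<close>

lemma two_face_cases:
  assumes "F \<in> two_faces S"
  shows "card (verts F) = 3 \<or> (card (verts F) = 4 \<and> (\<exists>V\<in>\<V>. \<exists>W\<in>\<V>.
    card (comp_unions (sym_diff V W)) = 4 \<and> verts F = square_verts V W))"
proof -
  have F: "F face_of S" and "aff_dim F = 2" using assms unfolding two_faces_def by auto
  then have "aff_dim (ind ` verts F) = 2"
    using face_eq_hull01 [OF F] unfolding hull01_def by (metis aff_dim_convex_hull)
  from planar_ind_cases [OF this] show ?thesis
  proof (elim disjE conjE exE)
    fix A B C D
    assume card: "card (verts F) = 4" and W: "verts F = {A, B, C, D}" "distinct [A, B, C, D]"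
      and eq: "ind A + ind B = ind C + ind D"
    have V: "A \<in> \<V>" "B \<in> \<V>" "C \<in> \<V>" "D \<in> \<V>" using W(1) verts_face [OF F] by auto
    have sub: "square_verts A B \<subseteq> verts F" using square_verts_face [OF F] W(1) by simp
    have "sym_diff A C \<in> comp_unions (sym_diff A B)"
      by (rule parallelogram_comp_unions [OF V eq])
    moreover have "sym_diff A D \<in> comp_unions (sym_diff A B)"
      by (rule parallelogram_comp_unions [OF V(1,2,4,3)]) (use eq in \<open>simp add: add.commute\<close>)
    ultimately have "{{}, sym_diff A C, sym_diff A D, sym_diff A B} \<subseteq> comp_unions (sym_diff A B)"
      by simp
    then have "sym_diff A ` {{}, sym_diff A C, sym_diff A D, sym_diff A B} \<subseteq> square_verts A B"
      unfolding square_verts_def by (rule image_mono)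
    then have "verts F \<subseteq> square_verts A B" unfolding W(1) by auto
    then have eqF: "verts F = square_verts A B" using sub by blast
    then have "card (comp_unions (sym_diff A B)) = 4"
      using card card_image [OF inj_on_subset [OF inj_sym_diff, of "comp_unions (sym_diff A B)" A]]
      unfolding square_verts_def by simp
    then show ?thesis using card eqF V by blast
  qed simp
qed

text \<open>At a point of the tight hull the reflected coordinates agree along comparable pairs, so
  they are constant on each of the two components, and they vanish off the symmetric difference. The
  two constants are the parameters of the parallelogram.\<close>

lemma square_face:
  assumes V: "V \<in> \<V>" "W \<in> \<V>" and card: "card (comp_unions (sym_diff V W)) = 4"
  shows "hull01 (square_verts V W) \<in> two_faces S"
proof -
  let ?E = "sym_diff V W"
  have "\<not> comp_unions ?E \<subseteq> {{}, ?E}"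
  proof
    assume "comp_unions ?E \<subseteq> {{}, ?E}"
    then have "card (comp_unions ?E) \<le> card {{}, ?E}" by (intro card_mono) auto
    also have "\<dots> \<le> 2" by (simp add: card_insert_if)
    finally show False using card by simp
  qed
  then obtain X where X: "X \<in> comp_unions ?E" "X \<noteq> {}" "X \<noteq> ?E" by blast
  have XE: "X \<subseteq> ?E" using X(1) unfolding comp_unions_def by blast
  let ?Y = "?E - X"
  have Y: "?Y \<in> comp_unions ?E" using comp_unions_Diff [OF X(1)] .
  have dist: "{} \<noteq> X" "{} \<noteq> ?Y" "{} \<noteq> ?E" "X \<noteq> ?Y" "X \<noteq> ?E" "?Y \<noteq> ?E" using X XE by blast+
  have comp: "comp_unions ?E = {{}, X, ?Y, ?E}"
  proof (rule card_subset_eq [symmetric])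
    show "finite (comp_unions ?E)" by simp
    show "{{}, X, ?Y, ?E} \<subseteq> comp_unions ?E" using X(1) Y by simp
    show "card {{}, X, ?Y, ?E} = card (comp_unions ?E)" using dist card by simp
  qed
  have sq: "square_verts V W = {V, sym_diff V X, sym_diff V ?Y, W}"
    unfolding square_verts_def comp by auto
  let ?P = "ind ` square_verts V W"
  have sqV: "square_verts V W \<subseteq> \<V>"
    unfolding square_verts_def using exchange [OF V] by blast
  then have PS: "?P \<subseteq> S" using ind_mem by blast
  have sub: "tight_hull S ?P \<subseteq> hull01 (square_verts V W)"
  proof
    fix y assume y: "y \<in> tight_hull S ?P"
    have yc: "y \<in> unit_cube" using y tight_hull_subset unit by blast
    have tightP: "coord V w p = coord V w q"
      if "p \<in> ?E" "q \<in> ?E" "p < q" "w \<in> ?P" for p q w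
    proof -
      note w = that(4) and pq = that(1,2) less_imp_le [OF that(3)]
      obtain Z where Z: "Z \<in> comp_unions ?E" "w = ind (sym_diff V Z)"
        using w unfolding square_verts_def by blast
      have "p \<in> Z \<longleftrightarrow> q \<in> Z"
        using comp_unionsD [OF Z(1), of p q] comp_unionsD [OF Z(1), of q p] pq by auto
      then show ?thesis unfolding Z(2) coord_ind sym_diff_cancel by simp
    qed
    have eq: "coord V y p = coord V y q" if pq: "p \<in> ?E" "q \<in> ?E" "p < q" for p q
      using tight [OF V pq]
    proof
      assume le: "\<forall>y\<in>S. coord V y p \<le> coord V y q"
      have "coord V y q - coord V y p = 0"
      proof (rule tight_hullD [OF y affine_form_diff [OF affine_form_coord affine_form_coord]])
        show "0 \<le> coord V x q - coord V x p" if "x \<in> S" for x using le that by simp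
        show "coord V w q - coord V w p = 0" if "w \<in> ?P" for w using tightP [OF pq that] by simp
      qed
      then show ?thesis by simp
    next
      assume le: "\<forall>y\<in>S. coord V y q \<le> coord V y p"
      have "coord V y p - coord V y q = 0"
      proof (rule tight_hullD [OF y affine_form_diff [OF affine_form_coord affine_form_coord]])
        show "0 \<le> coord V x p - coord V x q" if "x \<in> S" for x using le that by simp
        show "coord V w p - coord V w q = 0" if "w \<in> ?P" for w using tightP [OF pq that] by simp
      qed
      then show ?thesis by simp
    qed
    have const: "\<exists>s. 0 \<le> s \<and> s \<le> 1 \<and> (\<forall>p\<in>Z. coord V y p = s)"
      if Z: "Z = X \<or> Z = ?Y" for Z
    proof -
      have "Z \<in> comp_unions ?E" using Z X(1) Y by blast
      moreover have "Z \<noteq> {}" using Z dist(1,2) by blast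
      moreover have "Z \<subseteq> ?E" using Z XE by blast
      ultimately have ZE: "Z \<in> comp_unions ?E" "Z \<noteq> {}" "Z \<subseteq> ?E" .
      then obtain p0 where p0: "p0 \<in> Z" by blast
      \<comment> \<open>A level set of the coordinate function is again a union of components, hence
        all of \<open>Z\<close>.\<close>
      let ?Z = "{p\<in>Z. coord V y p = coord V y p0}"
      have cmp: "coord V y p = coord V y q \<and> q \<in> Z" if "p \<in> Z" "q \<in> ?E" "p \<le> q \<or> q \<le> p" for p q
      proof
        have "p \<in> ?E" using that(1) ZE(3) by blast
        then show "coord V y p = coord V y q"
          using eq [of p q] eq [of q p] that by (auto simp only: order_le_less)
        show "q \<in> Z" using ZE(1) that unfolding comp_unions_def incomparable_def by blast
      qed
      have "?Z \<in> comp_unions ?E"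
        unfolding comp_unions_def incomparable_def
      proof (intro CollectI conjI ballI)
        show "?Z \<subseteq> ?E" using ZE(3) by blast
        fix p q assume pq: "p \<in> ?Z" "q \<in> ?E - ?Z"
        show "\<not> p \<le> q" "\<not> q \<le> p" using cmp [of p q] pq by auto
      qed
      then have mem: "?Z \<in> {{}, X, ?Y, ?E}" unfolding comp .
      have "p0 \<in> ?Z" "?Z \<subseteq> Z" "X \<inter> ?Y = {}" "?Y \<subseteq> ?E" using p0 by simp blast+
      then have "?Z = Z" by (intro four_sets [OF mem _ _ Z _ dist(1,2,5,6) XE])
      then have "\<forall>p\<in>Z. coord V y p = coord V y p0" by blast
      moreover have "0 \<le> coord V y p0" "coord V y p0 \<le> 1"
        using yc unfolding unit_cube_def coord_def by auto
      ultimately show ?thesis by blast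
    qed
    obtain s where s: "0 \<le> s" "s \<le> 1" "\<And>p. p \<in> X \<Longrightarrow> coord V y p = s" using const [of X] by blast
    obtain t where t: "0 \<le> t" "t \<le> 1" "\<And>p. p \<in> ?Y \<Longrightarrow> coord V y p = t" using const [of ?Y] by blast
    have out: "coord V y p = 0" if "p \<notin> ?E" for p
    proof (rule tight_hullD [OF y affine_form_coord])
      show "0 \<le> coord V x p" if "x \<in> S" for x
        using that unit unfolding unit_cube_def coord_def by auto
      show "coord V w p = 0" if "w \<in> ?P" for w
      proof -
        note w = that
        obtain Z where "Z \<in> comp_unions ?E" "w = ind (sym_diff V Z)"
          using w unfolding square_verts_def by blast
        moreover from this have "p \<notin> Z" using \<open>p \<notin> ?E\<close> unfolding comp_unions_def by blast
        ultimately show ?thesis by (simp only: coord_ind sym_diff_cancel of_bool_def if_False)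
      qed
    qed
    \<comment> \<open>\<open>?a\<close> and \<open>?b\<close> lie on opposite sides:
      \<open>s\<close> moves along the component \<open>X\<close>, and \<open>t\<close> along
      \<open>?Y\<close>.\<close>
    let ?a = "(1 - s) *\<^sub>R ind V + s *\<^sub>R ind (sym_diff V X)"
    let ?b = "(1 - s) *\<^sub>R ind (sym_diff V ?Y) + s *\<^sub>R ind W"
    have "y $ p = ((1 - t) *\<^sub>R ?a + t *\<^sub>R ?b) $ p" for p
    proof -
      have "y $ p = (if p \<in> V then 1 - coord V y p else coord V y p)" unfolding coord_def by simp
      moreover consider "p \<in> X" | "p \<in> ?Y" | "p \<notin> ?E" by blast
      then have "((1 - t) *\<^sub>R ?a + t *\<^sub>R ?b) $ p = (if p \<in> V then 1 - coord V y p else coord V y p)"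
      proof cases
        case 1
        then have "p \<in> ?E" using XE by blast
        with 1 show ?thesis using s(3) [OF 1] by (cases "p \<in> V") (auto simp: algebra_simps)
      next
        case 2
        then show ?thesis using t(3) [OF 2] by (cases "p \<in> V") (auto simp: algebra_simps)
      next
        case 3
        then have "p \<notin> X" "p \<in> V \<longleftrightarrow> p \<in> W" using XE by blast+
        then show ?thesis using out [OF 3] by (cases "p \<in> V") (auto simp: algebra_simps)
      qed
      ultimately show ?thesis by simp
    qed
    then have "y = (1 - t) *\<^sub>R ?a + t *\<^sub>R ?b" by (simp add: vec_eq_iff)
    moreover have "V \<in> square_verts V W" "sym_diff V X \<in> square_verts V W"
      "sym_diff V ?Y \<in> square_verts V W" "W \<in> square_verts V W" unfolding sq by simp_all
    then have "?a \<in> hull01 (square_verts V W)" "?b \<in> hull01 (square_verts V W)"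
      using s(1,2) by (simp_all only: hull01_segment ind_mem_hull01)
    then have "(1 - t) *\<^sub>R ?a + t *\<^sub>R ?b \<in> hull01 (square_verts V W)"
      using t(1,2) by (rule hull01_segment)
    ultimately show "y \<in> hull01 (square_verts V W)" by (simp only:)
  qed
  have face: "tight_hull S ?P face_of S" by (rule tight_hull_face_of [OF convex])
  then have "hull01 (square_verts V W) \<subseteq> tight_hull S ?P"
    unfolding hull01_def
    by (intro hull_minimal tight_hull_superset [OF PS] face_of_imp_convex)
  then have "hull01 (square_verts V W) = tight_hull S ?P" using sub by blast
  then have "hull01 (square_verts V W) face_of S" using face by simp
  moreover have "aff_dim (hull01 (square_verts V W)) = 2"
  proof -
    have d: "V \<noteq> sym_diff V X" "V \<noteq> sym_diff V ?Y" "sym_diff V X \<noteq> sym_diff V ?Y"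
      using dist XE by blast+
    \<comment> \<open>The fourth corner is an affine combination of the other three and does not
      raise the dimension.\<close>
    have "ind W = (-1) *\<^sub>R ind V + 1 *\<^sub>R ind (sym_diff V X) + 1 *\<^sub>R ind (sym_diff V ?Y)"
    proof -
      have "ind W $ p = ((-1) *\<^sub>R ind V + 1 *\<^sub>R ind (sym_diff V X) + 1 *\<^sub>R ind (sym_diff V ?Y)) $ p" for p
        using XE by (cases "p \<in> X"; cases "p \<in> V"; cases "p \<in> W") auto
      then show ?thesis by (simp add: vec_eq_iff)
    qed
    then have "ind W \<in> affine hull {ind V, ind (sym_diff V X), ind (sym_diff V ?Y)}"
      unfolding affine_hull_3 by fastforce
    moreover have "?P = insert (ind W) {ind V, ind (sym_diff V X), ind (sym_diff V ?Y)}"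
      unfolding sq by auto
    ultimately have "aff_dim ?P = aff_dim {ind V, ind (sym_diff V X), ind (sym_diff V ?Y)}"
      by (simp add: aff_dim_insert)
    also have "\<dots> = 2"
      using aff_dim_affine_independent [OF affine_independent_ind [OF d]] d by simp
    finally show ?thesis unfolding hull01_def by (simp add: aff_dim_convex_hull)
  qed
  ultimately show ?thesis unfolding two_faces_def by simp
qed

text \<open>Three distinct cube vertices are affinely independent, so the dimension is automatic and
  the inclusion of the tight hull supplies the face property.\<close>

lemma triangle_face:
  assumes W: "\<W> \<subseteq> \<V>" "card \<W> = 3" and sub: "tight_hull S (ind ` \<W>) \<subseteq> hull01 \<W>"
  shows "hull01 \<W> \<in> two_faces S"
proof -
  obtain A B C where ABC: "\<W> = {A, B, C}" "A \<noteq> B" "A \<noteq> C" "B \<noteq> C" using W(2) by (auto simp: card_3_iff)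
  have PS: "ind ` \<W> \<subseteq> S" using W(1) ind_mem by blast
  have face: "tight_hull S (ind ` \<W>) face_of S" by (rule tight_hull_face_of [OF convex])
  then have "hull01 \<W> \<subseteq> tight_hull S (ind ` \<W>)"
    unfolding hull01_def by (intro hull_minimal tight_hull_superset [OF PS] face_of_imp_convex)
  then have "hull01 \<W> = tight_hull S (ind ` \<W>)" using sub by blast
  then have "hull01 \<W> face_of S" using face by simp
  moreover have "aff_dim (hull01 \<W>) = 2"
    using aff_dim_affine_independent [OF affine_independent_ind [OF ABC(2-4)]] ABC
    unfolding hull01_def by (simp add: aff_dim_convex_hull)
  ultimately show ?thesis unfolding two_faces_def by simp
qed

lemma finite_two_faces: "finite (two_faces S)"
proof (rule finite_subset)
  show "two_faces S \<subseteq> range hull01"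
    using face_eq_hull01 unfolding two_faces_def by blast
qed simp

text \<open>Sufficiency and necessity meet in \<open>\<T>\<close>: its members span faces, and it
  contains every triple with connected pairwise symmetric differences, a property shared by the
  vertices of all triangular faces.\<close>

lemma f2_triangle_eq:
  assumes "\<And>\<W>. \<W> \<in> \<T> \<Longrightarrow> \<W> \<subseteq> \<V> \<and> card \<W> = 3 \<and> tight_hull S (ind ` \<W>) \<subseteq> hull01 \<W>"
    and "\<And>\<W>. \<W> \<subseteq> \<V> \<Longrightarrow> card \<W> = 3 \<Longrightarrow>
      (\<And>V W. V \<in> \<W> \<Longrightarrow> W \<in> \<W> \<Longrightarrow> V \<noteq> W \<Longrightarrow> poset_connected (sym_diff V W)) \<Longrightarrow> \<W> \<in> \<T>"
  shows "f2_triangle S = card \<T>"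
proof -
  have "{F \<in> two_faces S. card {v. v extreme_point_of F} = 3} = hull01 ` \<T>"
  proof (intro equalityI subsetI)
    fix F assume "F \<in> {F \<in> two_faces S. card {v. v extreme_point_of F} = 3}"
    then have F: "F face_of S" "card {v. v extreme_point_of F} = 3" unfolding two_faces_def by auto
    then have card: "card (verts F) = 3" using card_extreme_points_face by simp
    have "verts F \<in> \<T>"
      using verts_face [OF F(1)] card connected_of_card_3 [OF F(1) _ _ _ card] by (rule assms(2))
    then show "F \<in> hull01 ` \<T>" using face_eq_hull01 [OF F(1)] by blast
  next
    fix F assume "F \<in> hull01 ` \<T>"
    then obtain \<W> where W: "\<W> \<in> \<T>" "F = hull01 \<W>" by blast
    then have "F \<in> two_faces S" using triangle_face assms(1) by blast
    moreover from this have "card {v. v extreme_point_of F} = card \<W>"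
      using card_extreme_points_face [of F] W(2) unfolding two_faces_def by simp
    ultimately show "F \<in> {F \<in> two_faces S. card {v. v extreme_point_of F} = 3}"
      using W(1) assms(1) by simp
  qed
  then show ?thesis
    unfolding f2_triangle_def by (simp add: card_image inj_on_subset [OF inj_hull01])
qed

lemma f2_square_eq:
  "f2_square S = card {square_verts V W | V W. V \<in> \<V> \<and> W \<in> \<V> \<and> card (comp_unions (sym_diff V W)) = 4}"
    (is "_ = card ?Q")
proof -
  have "{F \<in> two_faces S. card {v. v extreme_point_of F} = 4} = hull01 ` ?Q"
  proof (intro equalityI subsetI)
    fix F assume "F \<in> {F \<in> two_faces S. card {v. v extreme_point_of F} = 4}"
    then have F: "F \<in> two_faces S" "F face_of S" "card {v. v extreme_point_of F} = 4"
      unfolding two_faces_def by auto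
    then have "card (verts F) = 4" using card_extreme_points_face by simp
    then have "verts F \<in> ?Q" using two_face_cases [OF F(1)] by auto
    then show "F \<in> hull01 ` ?Q" using face_eq_hull01 [OF F(2)] by blast
  next
    fix F assume "F \<in> hull01 ` ?Q"
    then obtain V W where VW: "V \<in> \<V>" "W \<in> \<V>" "card (comp_unions (sym_diff V W)) = 4"
      "F = hull01 (square_verts V W)" by blast
    then have "F \<in> two_faces S" using square_face by blast
    moreover from this have "card {v. v extreme_point_of F} = card (square_verts V W)"
      using card_extreme_points_face [of F] VW(4) unfolding two_faces_def by simp
    moreover have "card (square_verts V W) = 4"
      unfolding square_verts_def using VW(3) by (simp add: card_image inj_on_subset [OF inj_sym_diff])
    ultimately show "F \<in> {F \<in> two_faces S. card {v. v extreme_point_of F} = 4}" by simp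
  qed
  then show ?thesis
    unfolding f2_square_def by (simp add: card_image inj_on_subset [OF inj_hull01])
qed

lemma f2_eq: "f2 S = f2_triangle S + f2_square S"
proof -
  let ?c = "\<lambda>F. card {v. v extreme_point_of F}"
  have "?c F = 3 \<or> ?c F = 4" if "F \<in> two_faces S" for F
    using two_face_cases [OF that] card_extreme_points_face [of F] that unfolding two_faces_def by auto
  then have "two_faces S = {F \<in> two_faces S. ?c F = 3} \<union> {F \<in> two_faces S. ?c F = 4}" by blast
  then have "f2 S = card ({F \<in> two_faces S. ?c F = 3} \<union> {F \<in> two_faces S. ?c F = 4})"
    unfolding f2_def by (rule arg_cong)
  also have "\<dots> = f2_triangle S + f2_square S"
    unfolding f2_triangle_def f2_square_def using finite_two_faces by (intro card_Un_disjoint) auto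
  finally show ?thesis .
qed

end

section \<open>Regions of order-convex sets\<close>

definition incomp_part :: "'a::order set \<Rightarrow> 'a set \<Rightarrow> 'a set" where
  "incomp_part P E = {p\<in>P. \<forall>e\<in>E. incomparable p e}"

definition order_convex :: "'a::order set \<Rightarrow> 'a set \<Rightarrow> bool" where
  "order_convex P E \<longleftrightarrow> E \<subseteq> P \<and> (\<forall>x\<in>E. \<forall>y\<in>E. \<forall>z\<in>P. x \<le> z \<and> z \<le> y \<longrightarrow> z \<in> E)"

definition above :: "'a::order set \<Rightarrow> 'a set \<Rightarrow> 'a set" where
  "above P E = {p\<in>P. \<exists>e\<in>E. e \<le> p}"

definition order_hull :: "'a::order set \<Rightarrow> 'a set \<Rightarrow> 'a set" where
  "order_hull P T = {p\<in>P. (\<exists>a\<in>T. a \<le> p) \<and> (\<exists>b\<in>T. p \<le> b)}"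

text \<open>If \<open>K\<close> and \<open>K - E\<close> are filters and \<open>K\<close> contains
  \<open>E\<close>, then elements outside \<open>E\<close> but above \<open>E\<close> must belong to
  \<open>K - E\<close>, elements below \<open>E\<close> must not, and only those incomparable to all
  of \<open>E\<close> are free. \<open>R\<close> records their choice.\<close>

definition base_filter :: "'a::order set \<Rightarrow> 'a set \<Rightarrow> 'a set \<Rightarrow> 'a set" where
  "base_filter P E R = R \<union> (above P E - E)"

definition boundary :: "'a::order set \<Rightarrow> 'a set" where
  "boundary E = minimals E \<union> maximals E"

text \<open>Convexity enters for elements above but outside \<open>E\<close>: going further up from
  them never leads back into \<open>E\<close>. The choices \<open>{}\<close>, \<open>E - D\<close>
  and \<open>E\<close> for \<open>X\<close> give the vertices of a triangle.\<close>

lemma base_filter_Un: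
  assumes E: "order_convex P E" and R: "R \<in> filters (incomp_part P E)" and X: "X \<in> filters E"
  shows "base_filter P E R \<union> X \<in> filters P"
  unfolding filters_def
proof (intro CollectI conjI ballI impI)
  have RQ: "R \<subseteq> incomp_part P E" and RF: "\<And>p q. p \<in> R \<Longrightarrow> q \<in> incomp_part P E \<Longrightarrow> p \<le> q \<Longrightarrow> q \<in> R"
    using R unfolding filters_def by auto
  have XE: "X \<subseteq> E" and XF: "\<And>p q. p \<in> X \<Longrightarrow> q \<in> E \<Longrightarrow> p \<le> q \<Longrightarrow> q \<in> X"
    using X unfolding filters_def by auto
  have EP: "E \<subseteq> P" using E unfolding order_convex_def by simp
  show "base_filter P E R \<union> X \<subseteq> P"
    using RQ XE EP unfolding base_filter_def above_def incomp_part_def by auto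
  fix p q assume p: "p \<in> base_filter P E R \<union> X" and q: "q \<in> P" "p \<le> q"
  consider "p \<in> R" | "p \<in> above P E" "p \<notin> E" | "p \<in> X" using p unfolding base_filter_def by blast
  then show "q \<in> base_filter P E R \<union> X"
  proof cases
    case 1
    then have inc: "\<not> p \<le> e" "\<not> e \<le> p" if "e \<in> E" for e
      using RQ that unfolding incomp_part_def incomparable_def by auto
    then have "q \<notin> E" using q(2) by blast
    show ?thesis
    proof (cases "\<exists>e\<in>E. e \<le> q")
      case True
      then show ?thesis using \<open>q \<notin> E\<close> q(1) unfolding base_filter_def above_def by blast
    next
      case False
      then have "q \<in> incomp_part P E"
        using q inc(1) order_trans unfolding incomp_part_def incomparable_def by blast
      then show ?thesis using RF [OF 1 _ q(2)] unfolding base_filter_def by blast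
    qed
  next
    case 2
    then obtain e where e: "e \<in> E" "e \<le> p" "p \<in> P" unfolding above_def by blast
    then have "q \<in> above P E" using q order_trans unfolding above_def by blast
    moreover have "q \<notin> E" using 2 e q E unfolding order_convex_def by blast
    ultimately show ?thesis unfolding base_filter_def by blast
  next
    case 3
    then have "q \<in> above P E" using XE q unfolding above_def by blast
    then show ?thesis using XF [OF 3 _ q(2)] unfolding base_filter_def by blast
  qed
qed

lemma base_filter_disjoint:
  assumes "R \<in> filters (incomp_part P E)"
  shows "base_filter P E R \<inter> E = {}"
proof -
  have "R \<subseteq> incomp_part P E" using assms unfolding filters_def by blast
  moreover have "incomp_part P E \<inter> E = {}" unfolding incomp_part_def incomparable_def by auto
  ultimately show ?thesis unfolding base_filter_def by blast
qed

lemma base_filter_Int_incomp_part: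
  assumes "R \<in> filters (incomp_part P E)"
  shows "base_filter P E R \<inter> incomp_part P E = R"
proof -
  have "R \<subseteq> incomp_part P E" using assms unfolding filters_def by blast
  moreover have "incomp_part P E \<inter> above P E = {}"
    unfolding incomp_part_def incomparable_def above_def by auto
  ultimately show ?thesis unfolding base_filter_def by blast
qed

text \<open>The converse construction: a nested pair of filters comes from the convex set between
  them and the trace of the smaller one on the elements incomparable to that set.\<close>

lemma filter_pair:
  assumes I: "I \<in> filters P" and K: "K \<in> filters P" and IK: "I \<subseteq> K"
  shows "order_convex P (K - I)" "I \<inter> incomp_part P (K - I) \<in> filters (incomp_part P (K - I))"
    "base_filter P (K - I) (I \<inter> incomp_part P (K - I)) = I"
proof -
  let ?E = "K - I"
  have IP: "I \<subseteq> P" and If: "\<And>p q. p \<in> I \<Longrightarrow> q \<in> P \<Longrightarrow> p \<le> q \<Longrightarrow> q \<in> I"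
    using I unfolding filters_def by auto
  have KP: "K \<subseteq> P" and Kf: "\<And>p q. p \<in> K \<Longrightarrow> q \<in> P \<Longrightarrow> p \<le> q \<Longrightarrow> q \<in> K"
    using K unfolding filters_def by auto
  show "order_convex P ?E"
    unfolding order_convex_def
  proof (intro conjI ballI impI)
    fix x y z assume xyz: "x \<in> ?E" "y \<in> ?E" "z \<in> P" "x \<le> z \<and> z \<le> y"
    then have "z \<in> K" using Kf [of x z] by blast
    moreover have "z \<notin> I" using If [of z y] xyz KP by blast
    ultimately show "z \<in> ?E" by blast
  qed (use KP in blast)
  show "I \<inter> incomp_part P ?E \<in> filters (incomp_part P ?E)"
    unfolding filters_def
  proof (intro CollectI conjI ballI impI)
    fix x y assume "x \<in> I \<inter> incomp_part P ?E" "y \<in> incomp_part P ?E" "x \<le> y"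
    then show "y \<in> I \<inter> incomp_part P ?E" using If [of x y] unfolding incomp_part_def by blast
  qed blast
  have "i \<in> incomp_part P ?E" if "i \<in> I" "i \<notin> above P ?E" for i
  proof -
    have "\<not> i \<le> e" if "e \<in> ?E" for e using If [of i e] \<open>i \<in> I\<close> that KP by blast
    moreover have "\<not> e \<le> i" if "e \<in> ?E" for e
      using \<open>i \<notin> above P ?E\<close> \<open>i \<in> I\<close> that IP unfolding above_def by blast
    ultimately show ?thesis using \<open>i \<in> I\<close> IP unfolding incomp_part_def incomparable_def by blast
  qed
  moreover have "above P ?E - ?E \<subseteq> I"
  proof
    fix p assume p: "p \<in> above P ?E - ?E"
    then obtain e where "e \<in> ?E" "e \<le> p" "p \<in> P" unfolding above_def by blast
    then have "p \<in> K" using Kf [of e p] by blast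
    then show "p \<in> I" using p by blast
  qed
  ultimately show "base_filter P ?E (I \<inter> incomp_part P ?E) = I"
    unfolding base_filter_def by blast
qed

section \<open>Components seen on the minimal and maximal elements\<close>

text \<open>Each element lies over a minimal one, so a union of components is determined by its
  minimal elements. Conversely, two minimal elements with a common upper bound have a common maximal
  one, so the interior connects nothing that the boundary leaves apart. This is needed because a
  symmetric difference of antichains shows only the boundary of a region.\<close>

lemma comp_unions_boundary:
  assumes fin: "finite E"
  shows "bij_betw (\<lambda>X. X \<inter> boundary E) (comp_unions E) (comp_unions (boundary E))"
  unfolding bij_betw_def
proof
  have bd: "boundary E \<subseteq> E"
    using minimals_subset [of E] maximals_subset [of E] unfolding boundary_def by blast
  have minb: "l \<in> boundary E" if "l \<in> minimals E" for l using that unfolding boundary_def by blast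
  show "inj_on (\<lambda>X. X \<inter> boundary E) (comp_unions E)"
  proof (rule inj_onI)
    have "X \<subseteq> Y" if XY: "X \<in> comp_unions E" "Y \<in> comp_unions E" "X \<inter> boundary E = Y \<inter> boundary E"
      for X Y
    proof
      fix x assume x: "x \<in> X"
      then have xE: "x \<in> E" using XY(1) unfolding comp_unions_def by blast
      obtain l where l: "l \<in> minimals E" "l \<le> x" using ex_minimals_le [OF fin xE] by blast
      then have "l \<in> E" using minimals_subset [of E] by blast
      then have "l \<in> X" using comp_unionsD [OF XY(1) x] l by blast
      then have "l \<in> Y" using XY(3) minb [OF l(1)] by blast
      then show "x \<in> Y" using comp_unionsD [OF XY(2) _ xE] l by blast
    qed
    then show "X = Y" if "X \<in> comp_unions E" "Y \<in> comp_unions E" "X \<inter> boundary E = Y \<inter> boundary E"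
      for X Y
      using that by (intro equalityI) auto
  qed
  show "(\<lambda>X. X \<inter> boundary E) ` comp_unions E = comp_unions (boundary E)"
  proof (intro equalityI subsetI)
    fix B assume "B \<in> (\<lambda>X. X \<inter> boundary E) ` comp_unions E"
    then show "B \<in> comp_unions (boundary E)" using bd unfolding comp_unions_def by blast
  next
    fix B assume B: "B \<in> comp_unions (boundary E)"
    then have BE: "B \<subseteq> boundary E" unfolding comp_unions_def by blast
    \<comment> \<open>By \<open>up\<close>, if one minimal element below \<open>x\<close> is in
      \<open>B\<close>, then all of them are.\<close>
    let ?X = "{x\<in>E. \<exists>l\<in>minimals E \<inter> B. l \<le> x}"
    have up: "l \<in> B" if xl: "x \<in> E" "l \<in> minimals E" "l \<le> x" "l' \<in> minimals E \<inter> B" "l' \<le> x" for x l l'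
    proof -
      obtain u where u: "u \<in> maximals E" "x \<le> u" using ex_maximals_ge [OF fin xl(1)] by blast
      then have ub: "u \<in> boundary E" unfolding boundary_def by blast
      have "l' \<le> u" "l \<le> u" using xl u(2) by (auto intro: order_trans)
      then have "u \<in> B" using comp_unionsD [OF B _ ub, of l'] xl(4) by blast
      then show ?thesis using comp_unionsD [OF B _ minb [OF xl(2)], of u] \<open>l \<le> u\<close> by blast
    qed
    have "?X \<in> comp_unions E"
      unfolding comp_unions_def incomparable_def
    proof (intro CollectI conjI ballI notI)
      fix p q assume p: "p \<in> ?X" and q: "q \<in> E - ?X"
      then obtain l where l: "l \<in> minimals E \<inter> B" "l \<le> p" by blast
      show False if "p \<le> q" using l q that order_trans [of l p q] by blast
      show False if "q \<le> p"
      proof -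
        obtain l' where l': "l' \<in> minimals E" "l' \<le> q" using ex_minimals_le [OF fin, of q] q by blast
        then have "l' \<in> B" using up [of p l' l] p l that by (auto intro: order_trans)
        then show False using l' q by blast
      qed
    qed blast
    moreover have "?X \<inter> boundary E = B"
    proof (intro equalityI subsetI)
      fix x assume x: "x \<in> ?X \<inter> boundary E"
      then obtain l where "l \<in> B" "l \<le> x" by blast
      then show "x \<in> B" using comp_unionsD [OF B, of l x] x by blast
    next
      fix b assume b: "b \<in> B"
      then have bE: "b \<in> E" using BE bd by blast
      obtain l where l: "l \<in> minimals E" "l \<le> b" using ex_minimals_le [OF fin bE] by blast
      then have "l \<in> B" using comp_unionsD [OF B b minb [OF l(1)]] by blast
      then show "b \<in> ?X \<inter> boundary E" using l bE b BE by blast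
    qed
    ultimately show "B \<in> (\<lambda>X. X \<inter> boundary E) ` comp_unions E" by blast
  qed
qed

lemma card_comp_unions_boundary:
  "finite E \<Longrightarrow> card (comp_unions (boundary E)) = card (comp_unions E)"
  using bij_betw_same_card [OF comp_unions_boundary] by metis

lemma poset_connected_iff_card: "finite E \<Longrightarrow> poset_connected E \<longleftrightarrow> card (comp_unions E) = 2"
proof
  assume "poset_connected E"
  then have "{} \<noteq> E" "comp_unions E = {{}, E}" unfolding poset_connected_def by auto
  then show "card (comp_unions E) = 2" by simp
next
  assume fin: "finite E" and card: "card (comp_unions E) = 2"
  have "E \<noteq> {}"
  proof
    assume "E = {}"
    then have "comp_unions E = {{}}" unfolding comp_unions_def by auto
    then show False using card by simp
  qed
  moreover have "comp_unions E = {{}, E}"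
  proof (rule card_subset_eq [symmetric])
    show "finite (comp_unions E)" using card card.infinite by fastforce
    show "card {{}, E} = card (comp_unions E)" using card calculation by simp
  qed simp
  ultimately show "poset_connected E" unfolding poset_connected_def by blast
qed

lemma poset_connected_boundary: "finite E \<Longrightarrow> poset_connected (boundary E) \<longleftrightarrow> poset_connected E"
proof -
  assume fin: "finite E"
  then have "finite (boundary E)"
    using finite_subset [OF _ fin] minimals_subset [of E] maximals_subset [of E]
    unfolding boundary_def by blast
  then show ?thesis using fin by (simp add: poset_connected_iff_card card_comp_unions_boundary)
qed

section \<open>Squares encoded by convex regions\<close>

lemma square_verts_mem: "V \<in> square_verts V W" "W \<in> square_verts V W"
proof -
  have eq: "W = sym_diff V (sym_diff V W)" by blast
  show "V \<in> square_verts V W"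
    unfolding square_verts_def by (rule image_eqI [where x = "{}"]) auto
  show "W \<in> square_verts V W"
    unfolding square_verts_def by (rule image_eqI [where x = "sym_diff V W"], rule eq, rule comp_unions_trivial)
qed

text \<open>All corners contain the common part of \<open>V\<close> and \<open>W\<close>, which are
  corners themselves. Together with the union this recovers the data of a square from its unordered
  set of corners.\<close>

lemma Inter_square_verts: "\<Inter> (square_verts V W) = V \<inter> W"
proof (intro equalityI subsetI)
  fix x assume x: "x \<in> \<Inter> (square_verts V W)"
  have "x \<in> V" "x \<in> W"
    by (rule InterD [OF x square_verts_mem(1)], rule InterD [OF x square_verts_mem(2)])
  then show "x \<in> V \<inter> W" by simp
next
  fix x assume x: "x \<in> V \<inter> W"
  have "x \<in> sym_diff V X" if "X \<in> comp_unions (sym_diff V W)" for X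
    using that x unfolding comp_unions_def by blast
  then show "x \<in> \<Inter> (square_verts V W)" unfolding square_verts_def by blast
qed

lemma Union_square_verts: "\<Union> (square_verts V W) = V \<union> W"
proof (intro equalityI subsetI)
  fix x assume x: "x \<in> V \<union> W"
  then show "x \<in> \<Union> (square_verts V W)"
    by (elim UnE) (rule UnionI [OF square_verts_mem(1)], assumption,
        rule UnionI [OF square_verts_mem(2)], assumption)
next
  fix x assume "x \<in> \<Union> (square_verts V W)"
  then obtain X where "X \<in> comp_unions (sym_diff V W)" "x \<in> sym_diff V X"
    unfolding square_verts_def by blast
  then show "x \<in> V \<union> W" unfolding comp_unions_def by blast
qed

lemma comp_unions_sym_diff:
  assumes "X \<in> comp_unions E" "Y \<in> comp_unions E"
  shows "sym_diff X Y \<in> comp_unions E"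
proof -
  have XY: "X \<subseteq> E" "Y \<subseteq> E" using assms unfolding comp_unions_def by auto
  show ?thesis
    unfolding comp_unions_def incomparable_def
  proof (intro CollectI conjI ballI)
    fix p q assume p: "p \<in> sym_diff X Y" and q: "q \<in> E - sym_diff X Y"
    have "q \<in> sym_diff X Y" if "p \<le> q \<or> q \<le> p"
    proof -
      have "p \<in> E" "q \<in> E" "q \<le> p \<or> p \<le> q" using p q XY that by auto
      then have "q \<in> X \<longleftrightarrow> p \<in> X" "q \<in> Y \<longleftrightarrow> p \<in> Y"
        using comp_unionsD [OF assms(1), of p q] comp_unionsD [OF assms(1), of q p]
          comp_unionsD [OF assms(2), of p q] comp_unionsD [OF assms(2), of q p] by argo+
      then show ?thesis using p by blast
    qed
    then show "\<not> p \<le> q" "\<not> q \<le> p" using q by blast+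
  qed (use XY in blast)
qed

text \<open>Unions of components form a group under symmetric difference, so any corner can serve as
  base point together with the opposite corner.\<close>

lemma square_verts_sym_diff:
  assumes X: "X \<in> comp_unions (sym_diff V W)"
  shows "square_verts (sym_diff V X) (sym_diff W X) = square_verts V W"
proof -
  have eq: "sym_diff (sym_diff V X) (sym_diff W X) = sym_diff V W" by blast
  have "sym_diff (sym_diff V X) ` comp_unions (sym_diff V W) = sym_diff V ` comp_unions (sym_diff V W)"
  proof (intro equalityI subsetI)
    fix A assume "A \<in> sym_diff (sym_diff V X) ` comp_unions (sym_diff V W)"
    then obtain Y where Y: "Y \<in> comp_unions (sym_diff V W)" "A = sym_diff (sym_diff V X) Y" by blast
    have "A = sym_diff V (sym_diff X Y)" unfolding Y(2) by blast
    then show "A \<in> sym_diff V ` comp_unions (sym_diff V W)" using comp_unions_sym_diff [OF X Y(1)] by blast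
  next
    fix A assume "A \<in> sym_diff V ` comp_unions (sym_diff V W)"
    then obtain Y where Y: "Y \<in> comp_unions (sym_diff V W)" "A = sym_diff V Y" by blast
    have "A = sym_diff (sym_diff V X) (sym_diff X Y)" unfolding Y(2) by blast
    then show "A \<in> sym_diff (sym_diff V X) ` comp_unions (sym_diff V W)"
      using comp_unions_sym_diff [OF X Y(1)] by blast
  qed
  then show ?thesis unfolding square_verts_def eq .
qed

text \<open>Comparable elements in the symmetric difference of two filters lie on the same side.
  Toggling \<open>V - W\<close> thus brings the diagonal into the normal form
  \<open>V \<inter> W\<close>, \<open>V \<union> W\<close>.\<close>

lemma filters_comparable_part:
  assumes "V \<in> filters P" "W \<in> filters P"
  shows "V - W \<in> comp_unions (sym_diff V W)"
proof -
  have Vf: "\<And>p q. p \<in> V \<Longrightarrow> q \<in> P \<Longrightarrow> p \<le> q \<Longrightarrow> q \<in> V" and "V \<subseteq> P"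
    using assms(1) unfolding filters_def by auto
  moreover have Wf: "\<And>p q. p \<in> W \<Longrightarrow> q \<in> P \<Longrightarrow> p \<le> q \<Longrightarrow> q \<in> W" and "W \<subseteq> P"
    using assms(2) unfolding filters_def by auto
  ultimately show ?thesis unfolding comp_unions_def incomparable_def by blast
qed

definition square_regions :: "'a::order set \<Rightarrow> 'a set set" where
  "square_regions P = {E. order_convex P E \<and> card (comp_unions E) = 4}"

text \<open>For connected \<open>E\<close>, disjointness of minimal and maximal elements means that
  \<open>E\<close> has more than one element.\<close>

definition triangle_regions :: "'a::order set \<Rightarrow> 'a set set" where
  "triangle_regions P = {E. order_convex P E \<and> poset_connected E \<and> minimals E \<inter> maximals E = {}}"

lemma filters_Int: "V \<in> filters P \<Longrightarrow> W \<in> filters P \<Longrightarrow> V \<inter> W \<in> filters P"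
  and filters_Un: "V \<in> filters P \<Longrightarrow> W \<in> filters P \<Longrightarrow> V \<union> W \<in> filters P"
  unfolding filters_def by auto

lemma filters_trivial [simp]: "{} \<in> filters E" "E \<in> filters E"
  unfolding filters_def by auto

lemma card_filter_squares:
  fixes P :: "'a::order set"
  shows "card {square_verts V W | V W. V \<in> filters P \<and> W \<in> filters P \<and> card (comp_unions (sym_diff V W)) = 4}
    = card (SIGMA E:square_regions P. filters (incomp_part P E))"
    (is "card ?Q = card ?I")
proof -
  let ?f = "\<lambda>(E, R). square_verts (base_filter P E R) (base_filter P E R \<union> E)"
  have "bij_betw ?f ?I ?Q"
    unfolding bij_betw_def
  proof
    show "inj_on ?f ?I"
    proof (rule inj_onI, clarify)
      fix E R E' R' assume E: "E \<in> square_regions P" "R \<in> filters (incomp_part P E)"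
        and E': "E' \<in> square_regions P" "R' \<in> filters (incomp_part P E')"
        and eq: "square_verts (base_filter P E R) (base_filter P E R \<union> E) =
          square_verts (base_filter P E' R') (base_filter P E' R' \<union> E')"
      have I: "base_filter P E R = base_filter P E' R'"
        using arg_cong [OF eq, of Inter] unfolding Inter_square_verts by blast
      have K: "base_filter P E R \<union> E = base_filter P E' R' \<union> E'"
        using arg_cong [OF eq, of Union] unfolding Union_square_verts by blast
      have "E = (base_filter P E R \<union> E) - base_filter P E R"
        using base_filter_disjoint [OF E(2)] by blast
      also have "\<dots> = (base_filter P E' R' \<union> E') - base_filter P E' R'" by (subst K, subst I, rule refl)
      also have "\<dots> = E'" using base_filter_disjoint [OF E'(2)] by blast
      finally have EE: "E = E'" .
      have "R = base_filter P E R \<inter> incomp_part P E"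
        by (rule base_filter_Int_incomp_part [OF E(2), symmetric])
      also have "\<dots> = base_filter P E' R' \<inter> incomp_part P E'" by (subst I, subst EE, rule refl)
      also have "\<dots> = R'" by (rule base_filter_Int_incomp_part [OF E'(2)])
      finally have "R = R'" .
      then show "E = E' \<and> R = R'" using EE by simp
    qed
    show "?f ` ?I = ?Q"
    proof (intro equalityI subsetI)
      fix Q assume "Q \<in> ?f ` ?I"
      then obtain E R where E: "order_convex P E" "card (comp_unions E) = 4" and R: "R \<in> filters (incomp_part P E)"
        and Q: "Q = square_verts (base_filter P E R) (base_filter P E R \<union> E)"
        unfolding square_regions_def by auto
      have "base_filter P E R \<in> filters P" using base_filter_Un [OF E(1) R, of "{}"] by simp
      moreover have "base_filter P E R \<union> E \<in> filters P" by (rule base_filter_Un [OF E(1) R]) simp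
      moreover have sd: "sym_diff (base_filter P E R) (base_filter P E R \<union> E) = E"
        using base_filter_disjoint [OF R] by blast
      have "card (comp_unions (sym_diff (base_filter P E R) (base_filter P E R \<union> E))) = 4"
        unfolding sd by (rule E(2))
      ultimately show "Q \<in> ?Q" using Q by blast
    next
      fix Q assume "Q \<in> ?Q"
      then obtain V W where VW: "V \<in> filters P" "W \<in> filters P" and card: "card (comp_unions (sym_diff V W)) = 4"
        and Q: "Q = square_verts V W" by blast
      let ?E = "sym_diff V W"
      have IK: "V \<inter> W \<in> filters P" "V \<union> W \<in> filters P" "V \<inter> W \<subseteq> V \<union> W"
        using filters_Int [OF VW] filters_Un [OF VW] by auto
      have E: "V \<union> W - V \<inter> W = ?E" by blast
      note pair = filter_pair [OF IK, unfolded E]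
      have "sym_diff V (V - W) = V \<inter> W" "sym_diff W (V - W) = V \<union> W" by blast+
      then have "Q = square_verts (V \<inter> W) (V \<union> W)"
        using square_verts_sym_diff [OF filters_comparable_part [OF VW]] Q by simp
      also have "V \<union> W = V \<inter> W \<union> ?E" by blast
      finally have "Q = ?f (?E, V \<inter> W \<inter> incomp_part P ?E)" by (simp only: prod.case pair(3))
      moreover have "?E \<in> square_regions P" using pair(1) card unfolding square_regions_def by blast
      then have "(?E, V \<inter> W \<inter> incomp_part P ?E) \<in> ?I" using pair(2) by (rule SigmaI)
      ultimately show "Q \<in> ?f ` ?I" by (rule image_eqI)
    qed
  qed
  then show ?thesis by (simp add: bij_betw_same_card)
qed

section \<open>Symmetric differences of antichains and the regions they span\<close>

lemma antichains_subset: "A \<in> antichains P \<Longrightarrow> A \<subseteq> P"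
  unfolding antichains_def by simp

text \<open>Two comparable elements on one side would violate the antichain property there. This
  reverses the situation for filters, where comparable elements share a side.\<close>

lemma antichain_sym_diff_opposite:
  assumes "V \<in> antichains P" "W \<in> antichains P" "p \<in> sym_diff V W" "q \<in> sym_diff V W" "p < q"
  shows "p \<in> V \<longleftrightarrow> q \<notin> V"
proof -
  have "\<And>x y. x \<in> V \<Longrightarrow> y \<in> V \<Longrightarrow> x \<le> y \<Longrightarrow> x = y" "\<And>x y. x \<in> W \<Longrightarrow> y \<in> W \<Longrightarrow> x \<le> y \<Longrightarrow> x = y"
    using assms(1,2) unfolding antichains_def by auto
  then show ?thesis using assms(3-5) by (metis DiffD1 DiffD2 UnE less_imp_le less_irrefl)
qed

text \<open>Any two comparable elements are on opposite sides, and three elements of a chain cannot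
  be pairwise opposite. So the symmetric difference has height at most two.\<close>

lemma antichain_sym_diff_less:
  assumes VW: "V \<in> antichains P" "W \<in> antichains P"
    and pq: "p \<in> sym_diff V W" "q \<in> sym_diff V W" "p < q"
  shows "p \<in> minimals (sym_diff V W)" "q \<in> maximals (sym_diff V W)" "q \<notin> minimals (sym_diff V W)"
proof -
  note opp = antichain_sym_diff_opposite [OF VW]
  have "r = p" if r: "r \<in> sym_diff V W" "r \<le> p" for r
  proof (rule ccontr)
    assume "r \<noteq> p"
    then have "r < p" "r < q" using r(2) pq(3) by auto
    then show False using opp [OF r(1) pq(1)] opp [OF r(1) pq(2)] opp [OF pq] by blast
  qed
  then show "p \<in> minimals (sym_diff V W)" using pq(1) unfolding minimals_def by blast
  have "r = q" if r: "r \<in> sym_diff V W" "q \<le> r" for r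
  proof (rule ccontr)
    assume "r \<noteq> q"
    then have "q < r" "p < r" using r(2) pq(3) by auto
    then show False using opp [OF pq(2) r(1)] opp [OF pq(1) r(1)] opp [OF pq] by blast
  qed
  then show "q \<in> maximals (sym_diff V W)" using pq(2) unfolding maximals_def by blast
  show "q \<notin> minimals (sym_diff V W)" using pq unfolding minimals_def by (auto simp: less_le_not_le)
qed

lemma antichain_sym_diff_boundary:
  assumes VW: "V \<in> antichains P" "W \<in> antichains P"
  shows "boundary (sym_diff V W) = sym_diff V W"
proof -
  have "p \<in> minimals (sym_diff V W) \<or> p \<in> maximals (sym_diff V W)" if p: "p \<in> sym_diff V W" for p
  proof (cases "\<exists>r\<in>sym_diff V W. r < p")
    case True
    then show ?thesis using antichain_sym_diff_less(2) [OF VW _ p] by blast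
  next
    case False
    then show ?thesis using p unfolding minimals_def by (auto simp: less_le)
  qed
  then show ?thesis
    using minimals_subset [of "sym_diff V W"] maximals_subset [of "sym_diff V W"]
    unfolding boundary_def by blast
qed

text \<open>Toggling this set in \<open>V\<close> moves exactly the minimal elements of the
  difference to the side of \<open>V\<close>. In a component with more than one element the two
  sides are its minimal and its maximal elements, possibly the wrong way round; an isolated element
  is treated as minimal.\<close>

lemma antichain_minimals_part:
  assumes VW: "V \<in> antichains P" "W \<in> antichains P"
  defines "T \<equiv> sym_diff V W"
  shows "{p\<in>T. p \<in> V \<longleftrightarrow> p \<notin> minimals T} \<in> comp_unions T"
  unfolding comp_unions_def incomparable_def
proof (intro CollectI conjI ballI notI)
  let ?X = "{p\<in>T. p \<in> V \<longleftrightarrow> p \<notin> minimals T}"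
  have key: "p \<in> ?X \<longleftrightarrow> q \<in> ?X" if "p \<in> T" "q \<in> T" "p < q" for p q
    using antichain_sym_diff_opposite [OF VW, folded T_def, OF that]
      antichain_sym_diff_less [OF VW, folded T_def, OF that] that by simp
  fix p q assume p: "p \<in> ?X" and q: "q \<in> T - ?X"
  then have "p \<noteq> q" "p \<in> T" "q \<in> T" by auto
  show False if "p \<le> q"
    using key [OF \<open>p \<in> T\<close> \<open>q \<in> T\<close>] that \<open>p \<noteq> q\<close> p q by (simp add: order_less_le)
  show False if "q \<le> p"
    using key [OF \<open>q \<in> T\<close> \<open>p \<in> T\<close>] that \<open>p \<noteq> q\<close> p q by (simp add: order_less_le)
qed blast

lemma minimals_order_hull:
  assumes "finite T" "T \<subseteq> P"
  shows "minimals (order_hull P T) = minimals T"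
proof -
  have TH: "T \<subseteq> order_hull P T" using assms(2) unfolding order_hull_def by blast
  show ?thesis
  proof (intro equalityI subsetI)
    fix x assume x: "x \<in> minimals (order_hull P T)"
    then obtain a where a: "a \<in> T" "a \<le> x" unfolding minimals_def order_hull_def by blast
    then have "a = x" using minimalsD [OF x] TH by blast
    then show "x \<in> minimals T" using a x TH unfolding minimals_def by blast
  next
    fix x assume x: "x \<in> minimals T"
    have "y = x" if y: "y \<in> order_hull P T" "y \<le> x" for y
    proof -
      obtain a where a: "a \<in> T" "a \<le> y" using y(1) unfolding order_hull_def by blast
      then have "a = x" using minimalsD [OF x a(1)] y(2) by (meson order_trans)
      then show ?thesis using a(2) y(2) by simp
    qed
    then show "x \<in> minimals (order_hull P T)"
      using x TH minimals_subset [of T] unfolding minimals_def [of "order_hull P T"] by blast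
  qed
qed

lemma maximals_order_hull:
  assumes "finite T" "T \<subseteq> P"
  shows "maximals (order_hull P T) = maximals T"
proof -
  have TH: "T \<subseteq> order_hull P T" using assms(2) unfolding order_hull_def by blast
  show ?thesis
  proof (intro equalityI subsetI)
    fix x assume x: "x \<in> maximals (order_hull P T)"
    then obtain a where a: "a \<in> T" "x \<le> a" unfolding maximals_def order_hull_def by blast
    then have "a = x" using maximalsD [OF x] TH by blast
    then show "x \<in> maximals T" using a x TH unfolding maximals_def by blast
  next
    fix x assume x: "x \<in> maximals T"
    have "y = x" if y: "y \<in> order_hull P T" "x \<le> y" for y
    proof -
      obtain a where a: "a \<in> T" "y \<le> a" using y(1) unfolding order_hull_def by blast
      then have "a = x" using maximalsD [OF x a(1)] y(2) by (meson order_trans)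
      then show ?thesis using a(2) y(2) by simp
    qed
    then show "x \<in> maximals (order_hull P T)"
      using x TH maximals_subset [of T] unfolding maximals_def [of "order_hull P T"] by blast
  qed
qed

lemma order_convex_order_hull: "order_convex P (order_hull P T)"
  unfolding order_convex_def order_hull_def by (blast intro: order_trans)

text \<open>Convexity recovers \<open>E\<close> from any part containing its extremal elements. A
  triangle of antichains shows the boundary together with \<open>M\<close>, a square only the
  boundary.\<close>

lemma order_hull_between:
  assumes "finite E" "order_convex P E" "boundary E \<subseteq> T" "T \<subseteq> E"
  shows "order_hull P T = E"
proof (intro equalityI subsetI)
  fix x assume "x \<in> order_hull P T"
  then obtain a b where "x \<in> P" "a \<in> E" "a \<le> x" "b \<in> E" "x \<le> b"
    using assms(4) unfolding order_hull_def by blast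
  then show "x \<in> E" using assms(2) unfolding order_convex_def by blast
next
  fix x assume x: "x \<in> E"
  obtain l u where "l \<in> minimals E" "l \<le> x" "u \<in> maximals E" "x \<le> u"
    using ex_minimals_le [OF assms(1) x] ex_maximals_ge [OF assms(1) x] by blast
  moreover from this have "l \<in> T" "u \<in> T" using assms(3) unfolding boundary_def by auto
  moreover have "x \<in> P" using x assms(2) unfolding order_convex_def by blast
  ultimately show "x \<in> order_hull P T" unfolding order_hull_def by blast
qed

lemma order_hull_boundary:
  assumes "finite E" "order_convex P E"
  shows "order_hull P (boundary E) = E"
  by (rule order_hull_between [OF assms])
    (use minimals_subset [of E] maximals_subset [of E] in \<open>auto simp: boundary_def\<close>)

lemma antichains_incomp_Un:
  assumes "S \<in> antichains (incomp_part P E)" "M \<in> antichains E" "E \<subseteq> P"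
  shows "S \<union> M \<in> antichains P"
proof -
  have inc: "\<not> s \<le> e" "\<not> e \<le> s" if "s \<in> S" "e \<in> M" for s e
    using assms(1,2) that unfolding antichains_def incomp_part_def incomparable_def by blast+
  have S: "S \<subseteq> P" "\<And>x y. x \<in> S \<Longrightarrow> y \<in> S \<Longrightarrow> x \<le> y \<Longrightarrow> x = y"
    using assms(1) unfolding antichains_def incomp_part_def by auto
  have M: "M \<subseteq> E" "\<And>x y. x \<in> M \<Longrightarrow> y \<in> M \<Longrightarrow> x \<le> y \<Longrightarrow> x = y"
    using assms(2) unfolding antichains_def by auto
  have "x = y" if "x \<in> S \<union> M" "y \<in> S \<union> M" "x \<le> y" for x y
    using that inc [of x y] inc [of y x] S(2) [of x y] M(2) [of x y] by auto
  then show ?thesis using S(1) M(1) assms(3) unfolding antichains_def by auto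
qed

lemma antichains_incomp_disjoint:
  assumes "S \<in> antichains (incomp_part P E)" shows "S \<inter> E = {}"
  using assms unfolding antichains_def incomp_part_def incomparable_def by blast

lemma antichains_minimals: "minimals E \<in> antichains E"
  and antichains_maximals: "maximals E \<in> antichains E"
  unfolding antichains_def minimals_def maximals_def by auto

lemma antichains_maximals_Diff: "maximals E - A \<in> antichains E"
  using antichains_maximals [of E] unfolding antichains_def by blast

text \<open>An element of \<open>S\<close> shares an antichain with each \<open>t\<close> in
  \<open>T\<close>, so it is incomparable to \<open>t\<close>; by transitivity it is incomparable to
  everything between two elements of \<open>T\<close>.\<close>

lemma antichain_Int_incomp_part:
  assumes "S \<subseteq> V" "V \<in> antichains P"
    and "\<And>t. t \<in> T \<Longrightarrow> \<exists>W\<in>antichains P. insert t S \<subseteq> W" "S \<inter> T = {}" "T \<subseteq> P"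
  shows "S \<in> antichains (incomp_part P (order_hull P T))"
proof -
  have inc: "\<not> s \<le> t \<and> \<not> t \<le> s" if "s \<in> S" "t \<in> T" for s t
    using assms(3) [OF that(2)] that assms(4) unfolding antichains_def by blast
  have "incomparable s e" if s: "s \<in> S" and e: "e \<in> order_hull P T" for s e
  proof -
    obtain a b where "a \<in> T" "a \<le> e" "b \<in> T" "e \<le> b" using e unfolding order_hull_def by blast
    then show ?thesis using inc [OF s] unfolding incomparable_def by (meson order_trans)
  qed
  then have "S \<subseteq> incomp_part P (order_hull P T)"
    using assms(1,2) unfolding antichains_def incomp_part_def by auto
  moreover have "\<forall>x\<in>S. \<forall>y\<in>S. x \<le> y \<longrightarrow> x = y"
    using assms(1,2) unfolding antichains_def by blast
  ultimately show ?thesis unfolding antichains_def by blast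
qed

text \<open>Normal form of the diagonal: the common part \<open>S\<close> with all minimal elements,
  and \<open>S\<close> with the remaining maximal ones. An isolated element of \<open>E\<close> is
  minimal and maximal at once and would cancel from the difference if it stayed in both
  corners.\<close>

lemma card_antichain_squares:
  fixes P :: "'a::{finite,order} set"
  shows "card {square_verts V W | V W. V \<in> antichains P \<and> W \<in> antichains P \<and> card (comp_unions (sym_diff V W)) = 4}
    = card (SIGMA E:square_regions P. antichains (incomp_part P E))"
    (is "card ?Q = card ?I")
proof -
  let ?f = "\<lambda>(E, S). square_verts (S \<union> minimals E) (S \<union> (maximals E - minimals E))"
  have disj: "S \<inter> boundary E = {}" if "S \<in> antichains (incomp_part P E)" for S E
    using antichains_incomp_disjoint [OF that] minimals_subset [of E] maximals_subset [of E]
    unfolding boundary_def by blast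
  have bij: "bij_betw ?f ?I ?Q"
    unfolding bij_betw_def
  proof
    have S_eq: "\<Inter> (?f (E, S)) = S" and bd_eq: "\<Union> (?f (E, S)) - \<Inter> (?f (E, S)) = boundary E"
      if "S \<in> antichains (incomp_part P E)" for E S
      using disj [OF that] unfolding boundary_def by (auto simp: Inter_square_verts Union_square_verts)
    show "inj_on ?f ?I"
    proof (rule inj_onI)
      fix x y assume xy: "x \<in> ?I" "y \<in> ?I" and eq: "?f x = ?f y"
      obtain E S E' S' where x: "x = (E, S)" and y: "y = (E', S')" by (cases x; cases y) auto
      have E: "order_convex P E" "S \<in> antichains (incomp_part P E)"
        and E': "order_convex P E'" "S' \<in> antichains (incomp_part P E')"
        using xy unfolding x y square_regions_def by auto
      have "S = \<Inter> (?f x)" unfolding x by (rule S_eq [OF E(2), symmetric])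
      moreover have "\<Inter> (?f y) = S'" unfolding y by (rule S_eq [OF E'(2)])
      ultimately have "S = S'" unfolding eq by (rule trans)
      have "boundary E = \<Union> (?f x) - \<Inter> (?f x)" unfolding x by (rule bd_eq [OF E(2), symmetric])
      moreover have "\<Union> (?f y) - \<Inter> (?f y) = boundary E'" unfolding y by (rule bd_eq [OF E'(2)])
      ultimately have "boundary E = boundary E'" unfolding eq by (rule trans)
      then have "order_hull P (boundary E) = order_hull P (boundary E')" by (rule arg_cong)
      then have "E = E'"
        unfolding order_hull_boundary [OF finite E(1)] order_hull_boundary [OF finite E'(1)] .
      then show "x = y" using \<open>S = S'\<close> unfolding x y by simp
    qed
    show "?f ` ?I = ?Q"
    proof (intro equalityI subsetI)
      fix Q assume "Q \<in> ?f ` ?I"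
      then obtain E S where E: "order_convex P E" "card (comp_unions E) = 4" and S: "S \<in> antichains (incomp_part P E)"
        and Q: "Q = square_verts (S \<union> minimals E) (S \<union> (maximals E - minimals E))"
        unfolding square_regions_def by auto
      have EP: "E \<subseteq> P" using E(1) unfolding order_convex_def by simp
      have "S \<union> minimals E \<in> antichains P" "S \<union> (maximals E - minimals E) \<in> antichains P"
        using antichains_incomp_Un [OF S _ EP] antichains_minimals antichains_maximals_Diff by auto
      moreover have "sym_diff (S \<union> minimals E) (S \<union> (maximals E - minimals E)) = boundary E"
        using disj [OF S] unfolding boundary_def by blast
      then have "card (comp_unions (sym_diff (S \<union> minimals E) (S \<union> (maximals E - minimals E)))) = 4"
        using E(2) card_comp_unions_boundary [of E] by simp
      ultimately show "Q \<in> ?Q" using Q by blast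
    next
      fix Q assume "Q \<in> ?Q"
      then obtain V W where VW: "V \<in> antichains P" "W \<in> antichains P"
        and card: "card (comp_unions (sym_diff V W)) = 4" and Q: "Q = square_verts V W" by blast
      let ?T = "sym_diff V W"
      let ?E = "order_hull P ?T" and ?S = "V \<inter> W"
      have TP: "?T \<subseteq> P" using antichains_subset [OF VW(1)] antichains_subset [OF VW(2)] by blast
      have min: "minimals ?E = minimals ?T" and max: "maximals ?E = maximals ?T"
        by (rule minimals_order_hull [OF finite TP], rule maximals_order_hull [OF finite TP])
      have bdT: "minimals ?T \<union> maximals ?T = ?T"
        using antichain_sym_diff_boundary [OF VW] unfolding boundary_def .
      have "boundary ?E = ?T" unfolding boundary_def min max by (rule bdT)
      then have "card (comp_unions ?E) = 4" using card card_comp_unions_boundary [of ?E] by simp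
      then have E: "?E \<in> square_regions P"
        using order_convex_order_hull unfolding square_regions_def by blast
      have S: "?S \<in> antichains (incomp_part P ?E)"
        by (rule antichain_Int_incomp_part [of _ V]) (use VW TP in blast)+
      let ?X = "{p\<in>?T. p \<in> V \<longleftrightarrow> p \<notin> minimals ?T}"
      have X: "?X \<in> comp_unions ?T" using antichain_minimals_part [OF VW] by simp
      have "sym_diff V ?X = ?S \<union> minimals ?T" "sym_diff W ?X = ?S \<union> (maximals ?T - minimals ?T)"
        using bdT minimals_subset [of ?T] maximals_subset [of ?T] by blast+
      then have "Q = ?f (?E, ?S)"
        using square_verts_sym_diff [OF X] Q min max by simp
      then show "Q \<in> ?f ` ?I" using E S by blast
    qed
  qed
  then show ?thesis by (rule bij_betw_same_card [symmetric])
qed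

section \<open>Triangles of filters and of antichains\<close>

lemma three_sorted:
  assumes card: "card \<W> = 3"
    and total: "\<And>V W. V \<in> \<W> \<Longrightarrow> W \<in> \<W> \<Longrightarrow> V \<noteq> W \<Longrightarrow> R V W \<or> R W V"
    and trans: "\<And>U V W. R U V \<Longrightarrow> R V W \<Longrightarrow> R U W"
  obtains U V W where "\<W> = {U, V, W}" "U \<noteq> V" "U \<noteq> W" "V \<noteq> W" "R U V" "R V W" "R U W"
proof -
  obtain A B C where ABC: "\<W> = {A, B, C}" "A \<noteq> B" "A \<noteq> C" "B \<noteq> C"
    using card by (auto simp: card_3_iff)
  have AB: "R A B \<or> R B A" and AC: "R A C \<or> R C A" and BC: "R B C \<or> R C B"
    using total ABC by auto
  have perm: "{A, B, C} = {B, A, C}" "{A, B, C} = {A, C, B}" "{A, B, C} = {C, A, B}"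
    "{A, B, C} = {B, C, A}" "{A, B, C} = {C, B, A}" by blast+
  note goal = that
  have *: thesis if "{A, B, C} = {U, V, W}" "U \<noteq> V" "U \<noteq> W" "V \<noteq> W" "R U V" "R V W" for U V W
    by (rule goal [OF _ that(2-6) trans [OF that(5,6)]]) (simp only: ABC(1) that(1))
  consider "R A B" "R B C" | "R A B" "R C B" "R A C" | "R A B" "R C B" "R C A"
    | "R B A" "R A C" | "R B A" "R C A" "R B C" | "R B A" "R C A" "R C B"
    using AB AC BC by blast
  then show thesis
  proof cases
    case 1 then show ?thesis using * [OF refl] ABC by blast
  next
    case 2 then show ?thesis using * [OF perm(2)] ABC by blast
  next
    case 3 then show ?thesis using * [OF perm(3)] ABC by blast
  next
    case 4 then show ?thesis using * [OF perm(1)] ABC by blast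
  next
    case 5 then show ?thesis using * [OF perm(4)] ABC by blast
  next
    case 6 then show ?thesis using * [OF perm(5)] ABC by blast
  qed
qed

section \<open>Triangles of filters\<close>

lemma poset_connected_constant:
  fixes g :: "'a::order \<Rightarrow> 'b"
  assumes X: "poset_connected X" and eq: "\<And>p q. p \<in> X \<Longrightarrow> q \<in> X \<Longrightarrow> p \<le> q \<Longrightarrow> g p = g q"
  obtains c where "\<And>p. p \<in> X \<Longrightarrow> g p = c"
proof -
  obtain x where x: "x \<in> X" using X unfolding poset_connected_def by blast
  let ?Y = "{p\<in>X. g p = g x}"
  have "?Y = X"
  proof (rule ccontr)
    assume "?Y \<noteq> X"
    then obtain p q where "p \<in> ?Y" "q \<in> X - ?Y" "p \<le> q \<or> q \<le> p"
      using poset_connectedD [OF X, of ?Y] x by blast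
    then show False using eq [of p q] eq [of q p] by auto
  qed
  then show thesis using that by blast
qed

lemma poset_connected_comp_unions: "poset_connected E \<Longrightarrow> X \<in> comp_unions E \<Longrightarrow> X = {} \<or> X = E"
  unfolding poset_connected_def by simp

text \<open>\<open>V - W\<close> is a union of components of a connected set, hence empty or
  everything.\<close>

lemma connected_filters_comparable:
  assumes "V \<in> filters P" "W \<in> filters P" "poset_connected (sym_diff V W)"
  shows "V \<subseteq> W \<or> W \<subseteq> V"
proof -
  from poset_connected_comp_unions [OF assms(3) filters_comparable_part [OF assms(1,2)]]
  show ?thesis
  proof
    assume "V - W = sym_diff V W"
    then have "W - V \<subseteq> V - W" by blast
    then show ?thesis by blast
  qed blast
qed

text \<open>Filters grow downwards, so the upper piece \<open>E - D\<close> is added before the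
  lower piece \<open>D\<close>.\<close>

definition filter_triangle :: "'a::order set \<Rightarrow> 'a set \<times> 'a set \<times> 'a set \<Rightarrow> 'a set set" where
  "filter_triangle P = (\<lambda>(E, D, R).
    {base_filter P E R, base_filter P E R \<union> (E - D), base_filter P E R \<union> E})"

definition filter_triangle_data :: "'a::order set \<Rightarrow> ('a set \<times> 'a set \<times> 'a set) set" where
  "filter_triangle_data P = (SIGMA E:triangle_regions P. order_splits E \<times> filters (incomp_part P E))"

definition antichain_triangle :: "'a::order set \<times> 'a set \<times> 'a set \<Rightarrow> 'a set set" where
  "antichain_triangle = (\<lambda>(E, M, S). {S \<union> minimals E, S \<union> M, S \<union> maximals E})"

definition antichain_triangle_data :: "'a::order set \<Rightarrow> ('a set \<times> 'a set \<times> 'a set) set" where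
  "antichain_triangle_data P =
    (SIGMA E:triangle_regions P. chain_splits E \<times> antichains (incomp_part P E))"

lemma order_splitsD:
  assumes "D \<in> order_splits E"
  shows "D \<subseteq> E" "D \<noteq> {}" "E - D \<noteq> {}" "E - D \<in> filters E" "poset_connected D" "poset_connected (E - D)"
  using assms unfolding order_splits_def downsets_def filters_def poset_connected_def by auto

lemma filter_triangle_chain:
  assumes "(E, D, R) \<in> filter_triangle_data P"
  defines "I \<equiv> base_filter P E R" and "J \<equiv> base_filter P E R \<union> (E - D)" and "K \<equiv> base_filter P E R \<union> E"
  shows "I \<in> filters P" "J \<in> filters P" "K \<in> filters P" "I \<subset> J" "J \<subset> K" "K - I = E" "J - I = E - D" "K - J = D"
proof -
  have E: "order_convex P E" and D: "D \<in> order_splits E" and R: "R \<in> filters (incomp_part P E)"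
    using assms(1) unfolding filter_triangle_data_def triangle_regions_def by auto
  show "I \<in> filters P" using base_filter_Un [OF E R, of "{}"] unfolding I_def by simp
  show "J \<in> filters P" unfolding J_def by (rule base_filter_Un [OF E R order_splitsD(4) [OF D]])
  show "K \<in> filters P" unfolding K_def by (rule base_filter_Un [OF E R]) simp
  have dis: "base_filter P E R \<inter> E = {}" by (rule base_filter_disjoint [OF R])
  show "K - I = E" "J - I = E - D" "K - J = D"
    unfolding I_def J_def K_def using dis order_splitsD(1) [OF D] by blast+
  show "I \<subset> J" unfolding I_def J_def using dis order_splitsD(3) [OF D] by blast
  show "J \<subset> K" unfolding J_def K_def using dis order_splitsD(1,2) [OF D] by blast
qed

text \<open>The smallest and the largest filter are the intersection and the union of the triple,
  and the third member is the middle one.\<close>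

lemma inj_filter_triangle: "inj_on (filter_triangle P) (filter_triangle_data P)"
proof (rule inj_onI)
  fix x y assume xy: "x \<in> filter_triangle_data P" "y \<in> filter_triangle_data P"
    and eq: "filter_triangle P x = filter_triangle P y"
  obtain E D R E' D' R' where x: "x = (E, D, R)" and y: "y = (E', D', R')" by (cases x; cases y) auto
  let ?I = "base_filter P E R" and ?I' = "base_filter P E' R'"
  let ?J = "?I \<union> (E - D)" and ?J' = "?I' \<union> (E' - D')"
  let ?K = "?I \<union> E" and ?K' = "?I' \<union> E'"
  note c = filter_triangle_chain [OF xy(1) [unfolded x]]
  note c' = filter_triangle_chain [OF xy(2) [unfolded y]]
  have T: "{?I, ?J, ?K} = {?I', ?J', ?K'}" using eq unfolding x y filter_triangle_def by simp
  have "?I = \<Inter> {?I, ?J, ?K}" by auto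
  also have "\<dots> = ?I'" unfolding T by auto
  finally have I: "?I = ?I'" .
  have "?K = \<Union> {?I, ?J, ?K}" using c(5) by auto
  also have "\<dots> = ?K'" unfolding T using c'(5) by auto
  finally have K: "?K = ?K'" .
  have "?J \<in> {?I, ?J, ?K}" by simp
  then have "?J \<in> {?I', ?J', ?K'}" unfolding T .
  moreover have "?J \<noteq> ?I'" using c(4) I by blast
  moreover have "?J \<noteq> ?K'" using c(5) K by blast
  ultimately have J: "?J = ?J'" by blast
  have "?K - ?I = ?K' - ?I'" by (rule arg_cong2 [OF K I])
  then have "E = E'" unfolding c(6) c'(6) .
  moreover have "?K - ?J = ?K' - ?J'" by (rule arg_cong2 [OF K J])
  then have "D = D'" unfolding c(8) c'(8) .
  moreover have "R = R'"
  proof -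
    have R: "R \<in> filters (incomp_part P E)" "R' \<in> filters (incomp_part P E')"
      using xy unfolding x y filter_triangle_data_def by auto
    have "?I \<inter> incomp_part P E = R" by (rule base_filter_Int_incomp_part [OF R(1)])
    moreover have "?I' \<inter> incomp_part P E' = R'" by (rule base_filter_Int_incomp_part [OF R(2)])
    moreover have "?I \<inter> incomp_part P E = ?I' \<inter> incomp_part P E'"
      by (subst I, subst \<open>E = E'\<close>, rule refl)
    ultimately show ?thesis by (simp only:)
  qed
  ultimately show "x = y" unfolding x y by simp
qed

text \<open>Sorted by inclusion, \<open>I\<close>, \<open>J\<close>, \<open>K\<close> give the
  region \<open>K - I\<close> with lower piece \<open>K - J\<close> and upper piece
  \<open>J - I\<close>. Both pieces are nonempty, so the region is more than a point and, being
  connected, has no isolated element.\<close>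

lemma connected_filters_triangle:
  fixes P :: "'a::{finite,order} set"
  assumes W: "\<W> \<subseteq> filters P" "card \<W> = 3"
    and conn: "\<And>V W. V \<in> \<W> \<Longrightarrow> W \<in> \<W> \<Longrightarrow> V \<noteq> W \<Longrightarrow> poset_connected (sym_diff V W)"
  shows "\<W> \<in> filter_triangle P ` filter_triangle_data P"
proof -
  have total: "V \<subseteq> W \<or> W \<subseteq> V" if "V \<in> \<W>" "W \<in> \<W>" "V \<noteq> W" for V W
    using connected_filters_comparable [OF _ _ conn [OF that]] W(1) that by blast
  obtain I J K where IJK: "\<W> = {I, J, K}" "I \<noteq> J" "I \<noteq> K" "J \<noteq> K" "I \<subseteq> J" "J \<subseteq> K" "I \<subseteq> K"
  proof (rule three_sorted [OF W(2), where R = "(\<subseteq>)"])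
    show "V \<subseteq> W \<or> W \<subseteq> V" if "V \<in> \<W>" "W \<in> \<W>" "V \<noteq> W" for V W using that by (rule total)
    show "U \<subseteq> W" if "U \<subseteq> V" "V \<subseteq> W" for U V W :: "'a set" using that by (rule subset_trans)
  qed (rule that)
  have F: "I \<in> filters P" "J \<in> filters P" "K \<in> filters P" using W(1) IJK(1) by auto
  let ?E = "K - I" and ?D = "K - J"
  note pair = filter_pair [OF F(1,3) IJK(7)]
  have sd: "sym_diff I K = ?E" "sym_diff J K = ?D" "sym_diff I J = J - I" using IJK(5-7) by blast+
  have E: "poset_connected ?E" and D: "poset_connected ?D" and C: "poset_connected (J - I)"
    using conn [of I K] conn [of J K] conn [of I J] IJK(1-4) sd by auto
  have ED: "?E - ?D = J - I" using IJK(5,6) by blast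
  have "minimals ?E \<inter> maximals ?E = {}"
  proof (rule ccontr)
    assume "\<not> ?thesis"
    then obtain x where x: "x \<in> minimals ?E" "x \<in> maximals ?E" by blast
    then have "{x} \<subseteq> ?E" using minimals_subset [of ?E] by blast
    moreover have "{x} \<noteq> ?E"
    proof
      assume "{x} = ?E"
      then have single: "k = x" if "k \<in> K" "k \<notin> I" for k using that by blast
      obtain a b where ab: "a \<in> K - J" "b \<in> J - I" using C D unfolding poset_connected_def by blast
      then have "a = x" "b = x" using single [of a] single [of b] IJK(5,6) by auto
      then show False using ab by simp
    qed
    ultimately obtain q where "q \<in> ?E - {x}" "x \<le> q \<or> q \<le> x"
      using poset_connectedD [OF E, of "{x}"] by blast
    then show False using minimalsD [OF x(1), of q] maximalsD [OF x(2), of q] by blast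
  qed
  then have reg: "?E \<in> triangle_regions P" using pair(1) E unfolding triangle_regions_def by blast
  have "?D \<in> downsets ?E"
    unfolding downsets_def
  proof (intro CollectI conjI ballI impI)
    show "?D \<subseteq> ?E" using IJK(5) by blast
    fix p q assume p: "p \<in> ?D" and q: "q \<in> ?E" "q \<le> p"
    have "p \<in> P" using p F(3) unfolding filters_def by blast
    then have "q \<notin> J" using p q(2) F(2) unfolding filters_def by blast
    then show "q \<in> ?D" using q(1) by blast
  qed
  then have "?D \<in> order_splits ?E" using D C ED unfolding order_splits_def by simp
  then have "(?E, ?D, I \<inter> incomp_part P ?E) \<in> filter_triangle_data P"
    using reg pair(2) unfolding filter_triangle_data_def by blast
  moreover have "filter_triangle P (?E, ?D, I \<inter> incomp_part P ?E) = \<W>"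
  proof -
    have "I \<union> (J - I) = J" "I \<union> ?E = K" using IJK(5,7) by blast+
    then show ?thesis unfolding filter_triangle_def IJK(1) by (simp add: pair(3) ED)
  qed
  ultimately show ?thesis by (rule rev_image_eqI [OF _ sym])
qed

text \<open>Filters of the incomparable part are counted as antichains, so that a region has the
  same weight for both polytopes.\<close>

lemma card_filter_triangle_data:
  fixes P :: "'a::{finite,order} set"
  shows "card (filter_triangle_data P) =
    (\<Sum>E\<in>triangle_regions P. card (order_splits E) * card (antichains (incomp_part P E)))"
  unfolding filter_triangle_data_def
  by (simp add: card_SigmaI card_cartesian_product card_filters_eq_antichains)

lemma card_antichain_triangle_data:
  fixes P :: "'a::{finite,order} set"
  shows "card (antichain_triangle_data P) =
    (\<Sum>E\<in>triangle_regions P. card (chain_splits E) * card (antichains (incomp_part P E)))"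
  unfolding antichain_triangle_data_def
  by (simp add: card_SigmaI card_cartesian_product)

section \<open>Triangles of antichains\<close>

lemma antichain_triangle_facts:
  fixes P :: "'a::{finite,order} set"
  assumes "(E, M, S) \<in> antichain_triangle_data P"
  shows "order_convex P E" "poset_connected E" "minimals E \<inter> maximals E = {}" "minimals E \<noteq> {}"
    "M \<in> antichains E" "poset_connected (sym_diff (minimals E) M)" "poset_connected (sym_diff M (maximals E))"
    "S \<inter> E = {}" "S \<in> antichains (incomp_part P E)" "M \<subseteq> E" "M \<noteq> minimals E" "M \<noteq> maximals E"
proof -
  show E: "order_convex P E" "poset_connected E" "minimals E \<inter> maximals E = {}"
    and M: "M \<in> antichains E" "poset_connected (sym_diff (minimals E) M)" "poset_connected (sym_diff M (maximals E))"
    and S: "S \<in> antichains (incomp_part P E)"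
    using assms unfolding antichain_triangle_data_def triangle_regions_def chain_splits_def by auto
  show "S \<inter> E = {}" by (rule antichains_incomp_disjoint [OF S])
  show "M \<subseteq> E" using M(1) unfolding antichains_def by blast
  show "M \<noteq> minimals E" "M \<noteq> maximals E" using M(2,3) unfolding poset_connected_def by auto
  obtain x where "x \<in> E" using E(2) unfolding poset_connected_def by blast
  then show "minimals E \<noteq> {}" using ex_minimals_le [of E x] by auto
qed

text \<open>\<open>S\<close> is the intersection of the triple because no element of
  \<open>E\<close> is both minimal and maximal, and the union minus \<open>S\<close> lies between
  the boundary of \<open>E\<close> and \<open>E\<close>, so its convex hull is \<open>E\<close>.
  \<open>M\<close> is then the remaining member.\<close>

lemma inj_antichain_triangle:
  fixes P :: "'a::{finite,order} set"
  shows "inj_on antichain_triangle (antichain_triangle_data P)"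
proof (rule inj_onI)
  have rec: "\<Inter> (antichain_triangle (E, M, S)) = S"
    "order_hull P (\<Union> (antichain_triangle (E, M, S)) - S) = E"
    if d: "(E, M, S) \<in> antichain_triangle_data P" for E M S
  proof -
    note f = antichain_triangle_facts [OF d]
    have sub: "minimals E \<subseteq> E" "maximals E \<subseteq> E" by (rule minimals_subset, rule maximals_subset)
    show "\<Inter> (antichain_triangle (E, M, S)) = S"
      using f(3) unfolding antichain_triangle_def by auto
    have "\<Union> (antichain_triangle (E, M, S)) - S = minimals E \<union> M \<union> maximals E"
      using f(8,10) sub unfolding antichain_triangle_def by auto
    moreover have "order_hull P (minimals E \<union> M \<union> maximals E) = E"
      by (rule order_hull_between) (use f(1,10) sub in \<open>auto simp: boundary_def\<close>)
    ultimately show "order_hull P (\<Union> (antichain_triangle (E, M, S)) - S) = E" by simp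
  qed
  fix x y assume xy: "x \<in> antichain_triangle_data P" "y \<in> antichain_triangle_data P"
    and eq: "antichain_triangle x = antichain_triangle y"
  obtain E M S E' M' S' where x: "x = (E, M, S)" and y: "y = (E', M', S')" by (cases x; cases y) auto
  note d = xy(1) [unfolded x] and d' = xy(2) [unfolded y]
  note f = antichain_triangle_facts [OF d] and f' = antichain_triangle_facts [OF d']
  note T = eq [unfolded x y]
  have "S = \<Inter> (antichain_triangle (E, M, S))" by (rule rec(1) [OF d, symmetric])
  also have "\<dots> = \<Inter> (antichain_triangle (E', M', S'))" by (subst T, rule refl)
  also have "\<dots> = S'" by (rule rec(1) [OF d'])
  finally have S: "S = S'" .
  have "E = order_hull P (\<Union> (antichain_triangle (E, M, S)) - S)" by (rule rec(2) [OF d, symmetric])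
  also have "\<dots> = order_hull P (\<Union> (antichain_triangle (E', M', S')) - S')"
    by (subst T, subst S, rule refl)
  also have "\<dots> = E'" by (rule rec(2) [OF d'])
  finally have E: "E = E'" .
  have cancel: "X = Y" if "S \<union> X = S \<union> Y" "X \<subseteq> E" "Y \<subseteq> E" for X Y
    using that f(8) by blast
  have sub: "minimals E \<subseteq> E" "maximals E \<subseteq> E" "M' \<subseteq> E"
    using minimals_subset [of E] maximals_subset [of E] f'(10) unfolding E by auto
  have "S \<union> M \<in> antichain_triangle (E, M, S)" unfolding antichain_triangle_def by simp
  then have "S \<union> M \<in> antichain_triangle (E', M', S')" unfolding T .
  then have "S \<union> M \<in> {S \<union> minimals E, S \<union> M', S \<union> maximals E}"
    unfolding antichain_triangle_def prod.case S [symmetric] E [symmetric] .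
  then consider "S \<union> M = S \<union> minimals E" | "S \<union> M = S \<union> M'" | "S \<union> M = S \<union> maximals E" by blast
  then have "M = M'"
  proof cases
    case 1
    then have "M = minimals E" using cancel f(10) sub(1) by simp
    then show ?thesis using f(11) by simp
  next
    case 2
    then show ?thesis using cancel f(10) sub(3) by simp
  next
    case 3
    then have "M = maximals E" using cancel f(10) sub(2) by simp
    then show ?thesis using f(12) by simp
  qed
  then show "x = y" unfolding x y E S by simp
qed

text \<open>\<open>V\<close> generates a larger upset than \<open>W\<close>. Passing to a subset of
  an antichain therefore also counts as moving up.\<close>

definition refines :: "'a::order set \<Rightarrow> 'a set \<Rightarrow> bool" where
  "refines V W \<longleftrightarrow> (\<forall>w\<in>W. \<exists>v\<in>V. v \<le> w)"

lemma refines_trans: "refines U V \<Longrightarrow> refines V W \<Longrightarrow> refines U W"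
  unfolding refines_def by (meson order_trans)

text \<open>By connectedness the set that would be toggled for the normal form is empty or
  everything. So one of the two antichains holds all minimal elements of the difference, and these
  lie below the elements of the other.\<close>

lemma connected_antichains_refine:
  fixes V W :: "'a::{finite,order} set"
  assumes VW: "V \<in> antichains P" "W \<in> antichains P" and conn: "poset_connected (sym_diff V W)"
  shows "refines V W \<or> refines W V"
proof -
  let ?T = "sym_diff V W"
  let ?X = "{p\<in>?T. p \<in> V \<longleftrightarrow> p \<notin> minimals ?T}"
  have low: "\<exists>l\<in>minimals ?T. l \<le> w" if "w \<in> ?T" for w by (rule ex_minimals_le [OF _ that]) simp
  have sub: "minimals ?T \<subseteq> ?T" by (rule minimals_subset)
  from poset_connected_comp_unions [OF conn antichain_minimals_part [OF VW]]
  consider "?X = {}" | "?X = ?T" by blast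
  then show ?thesis
  proof cases
    case 1
    have "\<exists>v\<in>V. v \<le> w" if "w \<in> W" for w
    proof (cases "w \<in> V")
      case False
      then have "w \<in> ?T" using that by blast
      then obtain l where "l \<in> minimals ?T" "l \<le> w" using low by blast
      moreover from this have "l \<in> V" using 1 sub by blast
      ultimately show ?thesis by blast
    qed auto
    then show ?thesis unfolding refines_def by blast
  next
    case 2
    have "\<exists>v\<in>W. v \<le> w" if "w \<in> V" for w
    proof (cases "w \<in> W")
      case False
      then have "w \<in> ?T" using that by blast
      then obtain l where l: "l \<in> minimals ?T" "l \<le> w" using low by blast
      then have "l \<in> ?X" using 2 sub by blast
      then have "l \<in> W" using l(1) by blast
      then show ?thesis using l(2) by blast
    qed auto
    then show ?thesis unfolding refines_def by blast
  qed
qed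

lemma antichainsD: "A \<in> antichains P \<Longrightarrow> x \<in> A \<Longrightarrow> y \<in> A \<Longrightarrow> x \<le> y \<Longrightarrow> x = y"
  unfolding antichains_def by blast

lemma connected_antichain_singleton:
  assumes A: "A \<in> antichains P" and B: "B \<subseteq> A" "poset_connected B" "x \<in> B"
  shows "B = {x}"
proof (rule ccontr)
  assume "B \<noteq> {x}"
  then obtain q where "q \<in> B - {x}" "x \<le> q \<or> q \<le> x"
    using poset_connectedD [OF B(2), of "{x}"] B(3) by blast
  then show False using antichainsD [OF A, of x q] antichainsD [OF A, of q x] B by blast
qed

text \<open>By \<open>ne\<close> the difference is more than \<open>{t}\<close>, so something
  comparable to \<open>t\<close> exists in it, necessarily in \<open>W\<close>. It is not below
  \<open>t\<close>, since refinement would put an element of \<open>V\<close> below it and hence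
  below \<open>t\<close>.\<close>

lemma connected_antichains_below:
  assumes VW: "V \<in> antichains P" "W \<in> antichains P" and ref: "refines V W"
    and conn: "poset_connected (sym_diff V W)" and t: "t \<in> V - W" and ne: "W - V \<noteq> {}"
  shows "\<exists>q\<in>W - V. t \<le> q"
proof -
  obtain w where w: "w \<in> W - V" using ne by blast
  have "{t} \<noteq> sym_diff V W"
  proof
    assume "{t} = sym_diff V W"
    then have "w \<in> {t}" using w by simp
    then show False using w t by simp
  qed
  then obtain q where q: "q \<in> sym_diff V W - {t}" "t \<le> q \<or> q \<le> t"
    using poset_connectedD [OF conn, of "{t}"] t by blast
  have "q \<notin> V" using antichainsD [OF VW(1), of t q] antichainsD [OF VW(1), of q t] q t by blast
  then have qW: "q \<in> W - V" using q by blast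
  have "\<not> q \<le> t"
  proof
    assume "q \<le> t"
    obtain v where v: "v \<in> V" "v \<le> q" using ref qW unfolding refines_def by blast
    then have "v \<le> t" using \<open>q \<le> t\<close> by (rule_tac order_trans)
    then have "v = t" using antichainsD [OF VW(1) v(1)] t by blast
    then have "q = t" using v(2) \<open>q \<le> t\<close> by simp
    then show False using q by blast
  qed
  then show ?thesis using qW q(2) by blast
qed

lemma antichains_mono: "A \<in> antichains P \<Longrightarrow> B \<subseteq> A \<Longrightarrow> B \<subseteq> E \<Longrightarrow> B \<in> antichains E"
  unfolding antichains_def by blast

text \<open>The region is the convex hull of what the three antichains do not share. As
  \<open>V \<inter> W\<close> is contained in \<open>M\<close>, its boundary is exactly
  \<open>sym_diff V W\<close>, so connectedness passes to the region.\<close>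

lemma antichain_triangleI:
  fixes P :: "'a::{finite,order} set"
  assumes A: "V \<in> antichains P" "M \<in> antichains P" "W \<in> antichains P"
    and min: "minimals (V \<union> M \<union> W - V \<inter> M \<inter> W) = V - V \<inter> M \<inter> W"
    and max: "maximals (V \<union> M \<union> W - V \<inter> M \<inter> W) = W - V \<inter> M \<inter> W"
    and VW: "V \<inter> W \<subseteq> M"
    and conn: "poset_connected (sym_diff V W)" "poset_connected (sym_diff V M)" "poset_connected (sym_diff M W)"
  shows "{V, M, W} \<in> antichain_triangle ` antichain_triangle_data P"
proof -
  let ?S = "V \<inter> M \<inter> W"
  let ?T = "V \<union> M \<union> W - ?S"
  let ?E = "order_hull P ?T"
  have TP: "?T \<subseteq> P"
    using antichains_subset [OF A(1)] antichains_subset [OF A(2)] antichains_subset [OF A(3)] by blast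
  have minE: "minimals ?E = V - ?S" and maxE: "maximals ?E = W - ?S"
    by (simp_all only: minimals_order_hull [OF finite TP] maximals_order_hull [OF finite TP] min max)
  have disj: "minimals ?E \<inter> maximals ?E = {}" unfolding minE maxE using VW by blast
  have "boundary ?E = sym_diff V W" unfolding boundary_def minE maxE using VW by blast
  then have "poset_connected ?E" using conn(1) poset_connected_boundary [of ?E] by simp
  then have reg: "?E \<in> triangle_regions P"
    using order_convex_order_hull disj unfolding triangle_regions_def by blast
  have "?T \<subseteq> ?E" using TP unfolding order_hull_def by blast
  then have "M - ?S \<subseteq> ?E" by blast
  then have "M - ?S \<in> antichains ?E" by (rule antichains_mono [OF A(2) Diff_subset])
  moreover have "sym_diff (V - ?S) (M - ?S) = sym_diff V M" "sym_diff (M - ?S) (W - ?S) = sym_diff M W"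
    by blast+
  ultimately have M: "M - ?S \<in> chain_splits ?E"
    using conn(2,3) unfolding chain_splits_def minE maxE by simp
  have "\<exists>A\<in>antichains P. insert t ?S \<subseteq> A" if "t \<in> ?T" for t
    using that A by blast
  then have S: "?S \<in> antichains (incomp_part P ?E)"
    using A(1) TP by (intro antichain_Int_incomp_part [of _ V]) auto
  have "(?E, M - ?S, ?S) \<in> antichain_triangle_data P"
    using reg M S unfolding antichain_triangle_data_def by blast
  moreover have "antichain_triangle (?E, M - ?S, ?S) = {V, M, W}"
  proof -
    have "?S \<union> (V - ?S) = V" "?S \<union> (M - ?S) = M" "?S \<union> (W - ?S) = W" by blast+
    then show ?thesis unfolding antichain_triangle_def by (simp only: prod.case minE maxE)
  qed
  ultimately show ?thesis by (rule rev_image_eqI [OF _ sym])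
qed

text \<open>Sorting by refinement need not put the middle antichain in the middle. If
  \<open>C \<subseteq> B\<close>, the step from \<open>B\<close> to \<open>C\<close> only drops an
  element without leading upwards, so \<open>B\<close> is the top of the region and \<open>C\<close>
  plays the role of \<open>M\<close>. For a chain \<open>a < b\<close> this happens with
  \<open>{a}\<close>, \<open>{b}\<close>, \<open>{}\<close>. Otherwise the sorted order is the right
  one.\<close>

lemma connected_antichains_triangle:
  fixes P :: "'a::{finite,order} set"
  assumes W: "\<W> \<subseteq> antichains P" "card \<W> = 3"
    and conn: "\<And>V W. V \<in> \<W> \<Longrightarrow> W \<in> \<W> \<Longrightarrow> V \<noteq> W \<Longrightarrow> poset_connected (sym_diff V W)"
  shows "\<W> \<in> antichain_triangle ` antichain_triangle_data P"
proof -
  have total: "refines V W \<or> refines W V" if "V \<in> \<W>" "W \<in> \<W>" "V \<noteq> W" for V W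
    using connected_antichains_refine [OF _ _ conn [OF that]] W(1) that by blast
  obtain A B C where ABC: "\<W> = {A, B, C}" "A \<noteq> B" "A \<noteq> C" "B \<noteq> C"
      and ref: "refines A B" "refines B C" "refines A C"
  proof (rule three_sorted [OF W(2), where R = refines])
    show "refines V W \<or> refines W V" if "V \<in> \<W>" "W \<in> \<W>" "V \<noteq> W" for V W using that by (rule total)
    show "refines U W" if "refines U V" "refines V W" for U V W :: "'a set"
      using that by (rule refines_trans)
  qed (rule that)
  have anti: "A \<in> antichains P" "B \<in> antichains P" "C \<in> antichains P" using W(1) ABC(1) by auto
  have cAB: "poset_connected (sym_diff A B)" and cBC: "poset_connected (sym_diff B C)"
    and cAC: "poset_connected (sym_diff A C)"
    using conn [of A B] conn [of B C] conn [of A C] ABC by auto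
  \<comment> \<open>A common element of the outer antichains is squeezed: refinement puts an element
    of \<open>B\<close> below it, and an element of \<open>A\<close> below that.\<close>
  have AC: "A \<inter> C \<subseteq> B"
  proof
    fix x assume x: "x \<in> A \<inter> C"
    then obtain y z where yz: "y \<in> B" "y \<le> x" "z \<in> A" "z \<le> y" using ref unfolding refines_def by blast
    then have "z = x" using antichainsD [OF anti(1) yz(3), of x] x by (meson IntD1 order_trans)
    then have "y = x" using yz by simp
    then show "x \<in> B" using yz by simp
  qed
  let ?S = "A \<inter> B \<inter> C"
  let ?T = "A \<union> B \<union> C - ?S"
  have down: "\<exists>a\<in>A. a \<le> t" if "t \<in> A \<union> B \<union> C" for t
    using that ref unfolding refines_def by blast
  have min: "minimals ?T = A - ?S"
  proof (intro equalityI subsetI)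
    fix t assume t: "t \<in> minimals ?T"
    then have tT: "t \<in> ?T" using minimals_subset [of ?T] by blast
    then obtain a where a: "a \<in> A" "a \<le> t" using down by blast
    have "a \<notin> ?S"
    proof
      assume aS: "a \<in> ?S"
      then have "a = t" using tT a antichainsD [OF anti(1), of a t] antichainsD [OF anti(2), of a t]
          antichainsD [OF anti(3), of a t] by blast
      then show False using aS tT by blast
    qed
    then have "a = t" using minimalsD [OF t, of a] a by blast
    then show "t \<in> A - ?S" using a tT by blast
  next
    fix t assume t: "t \<in> A - ?S"
    have "s = t" if s: "s \<in> ?T" "s \<le> t" for s
    proof -
      obtain a where a: "a \<in> A" "a \<le> s" using down s(1) by blast
      then have "a \<le> t" using s(2) by (rule_tac order_trans)
      then have "a = t" using antichainsD [OF anti(1) a(1)] t by blast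
      then show ?thesis using a(2) s(2) by simp
    qed
    then show "t \<in> minimals ?T" using t unfolding minimals_def by blast
  qed
  show ?thesis
  proof (cases "C \<subseteq> B")
    case False
    then have CB: "C - B \<noteq> {}" by blast
    then have CA: "C - A \<noteq> {}" using AC by blast
    have max: "maximals ?T = C - ?S"
    proof (intro equalityI subsetI)
      fix t assume t: "t \<in> maximals ?T"
      then have tT: "t \<in> ?T" using maximals_subset [of ?T] by blast
      have "t \<in> C"
      proof (rule ccontr)
        assume "t \<notin> C"
        then have "(\<exists>q\<in>C - B. t \<le> q) \<or> (\<exists>q\<in>C - A. t \<le> q)"
          using tT connected_antichains_below [OF anti(2,3) ref(2) cBC _ CB, of t]
            connected_antichains_below [OF anti(1,3) ref(3) cAC _ CA, of t] by blast
        then obtain q where "q \<in> C" "q \<notin> B \<or> q \<notin> A" "t \<le> q" by blast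
        then have "q = t" using maximalsD [OF t, of q] by blast
        then show False using \<open>q \<in> C\<close> \<open>t \<notin> C\<close> by blast
      qed
      then show "t \<in> C - ?S" using tT by blast
    next
      fix t assume t: "t \<in> C - ?S"
      have "s = t" if s: "s \<in> ?T" "t \<le> s" for s
      proof -
        have aux: "s = t" if X: "X \<in> antichains P" "refines X C" "s \<in> X" for X
        proof -
          obtain v where v: "v \<in> X" "v \<le> t" using X(2) t unfolding refines_def by blast
          then have "v \<le> s" using s(2) by (rule_tac order_trans)
          then have "v = s" using antichainsD [OF X(1) v(1) X(3)] by blast
          then show ?thesis using v(2) s(2) by simp
        qed
        have "refines C C" unfolding refines_def by blast
        then show ?thesis using aux [OF anti(1) ref(3)] aux [OF anti(2) ref(2)] aux [OF anti(3)] s(1) by blast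
      qed
      then show "t \<in> maximals ?T" using t unfolding maximals_def by blast
    qed
    show ?thesis unfolding ABC(1)
      by (rule antichain_triangleI [OF anti min max AC cAC cAB cBC])
  next
    case True
    have B_C: "poset_connected (B - C)"
    proof -
      have "sym_diff B C = B - C" using True by blast
      then show ?thesis using cBC by simp
    qed
    then obtain m where m: "m \<in> B - C" unfolding poset_connected_def by blast
    \<comment> \<open>A connected part of an antichain is a single element.\<close>
    have Bm: "B - C = {m}" by (rule connected_antichain_singleton [OF anti(2) _ B_C m]) blast
    have AC': "A - C = {x}" if "C \<subseteq> A" "x \<in> A - C" for x
    proof -
      have "sym_diff A C = A - C" using that by blast
      then have "poset_connected (A - C)" using cAC by simp
      then show ?thesis by (rule connected_antichain_singleton [OF anti(1) _ _ that(2), rotated]) blast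
    qed
    have BA: "B - A \<noteq> {}"
    proof
      assume "B - A = {}"
      then have BA: "B \<subseteq> A" by blast
      then have "A - C = {m}" using AC' [of m] True m by blast
      then have "A \<subseteq> B" using True Bm by blast
      then show False using BA ABC(2) by blast
    qed
    \<comment> \<open>The same squeezing condition for the new arrangement, with \<open>C\<close>
      between \<open>A\<close> and \<open>B\<close>.\<close>
    have AB: "A \<inter> B \<subseteq> C"
    proof
      fix x assume x: "x \<in> A \<inter> B"
      show "x \<in> C"
      proof (rule ccontr)
        assume xC: "x \<notin> C"
        then have xm: "x = m" using x Bm by blast
        show False
        proof (cases "C \<subseteq> A")
          case True
          then have "A - C = {m}" using AC' [of m] x xC xm by blast
          then have "A = B" using Bm True \<open>C \<subseteq> B\<close> by blast
          then show False using ABC(2) by blast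
        next
          case False
          then have "C - A \<noteq> {}" by blast
          then obtain q where q: "q \<in> C - A" "x \<le> q"
            using connected_antichains_below [OF anti(1,3) ref(3) cAC, of x] x xC by blast
          then have "x = q" using antichainsD [OF anti(2), of x q] x \<open>C \<subseteq> B\<close> by blast
          then show False using q xC by blast
        qed
      qed
    qed
    have max: "maximals ?T = B - ?S"
    proof (intro equalityI subsetI)
      fix t assume t: "t \<in> maximals ?T"
      then have tT: "t \<in> ?T" using maximals_subset [of ?T] by blast
      have "t \<in> B"
      proof (rule ccontr)
        assume "t \<notin> B"
        then have "t \<in> A - B" using tT True by blast
        then obtain q where q: "q \<in> B - A" "t \<le> q"
          using connected_antichains_below [OF anti(1,2) ref(1) cAB _ BA] by blast
        then have "q = t" using maximalsD [OF t, of q] by blast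
        then show False using q \<open>t \<notin> B\<close> by blast
      qed
      then show "t \<in> B - ?S" using tT by blast
    next
      fix t assume t: "t \<in> B - ?S"
      have "s = t" if s: "s \<in> ?T" "t \<le> s" for s
      proof (cases "s \<in> B")
        case True
        then show ?thesis using antichainsD [OF anti(2), of t s] t s(2) by blast
      next
        case False
        then have sA: "s \<in> A" using s(1) \<open>C \<subseteq> B\<close> by blast
        obtain v where v: "v \<in> A" "v \<le> t" using ref(1) t unfolding refines_def by blast
        then have "v \<le> s" using s(2) by (rule_tac order_trans)
        then have "v = s" using antichainsD [OF anti(1) v(1) sA] by blast
        then show ?thesis using v(2) s(2) by simp
      qed
      then show "t \<in> maximals ?T" using t unfolding maximals_def by blast
    qed
    have perm: "A \<union> C \<union> B = A \<union> B \<union> C" "A \<inter> C \<inter> B = ?S" by blast+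
    have "sym_diff C B = sym_diff B C" by blast
    then have cCB: "poset_connected (sym_diff C B)" using cBC by simp
    have "{A, C, B} \<in> antichain_triangle ` antichain_triangle_data P"
      by (rule antichain_triangleI [OF anti(1,3,2) _ _ AB cAB cAC cCB])
        (simp_all only: perm min max)
    moreover have "\<W> = {A, C, B}" unfolding ABC(1) by blast
    ultimately show ?thesis by simp
  qed
qed

section \<open>The order polytope and the chain polytope\<close>

lemma card_three: "a \<noteq> b \<Longrightarrow> a \<noteq> c \<Longrightarrow> b \<noteq> c \<Longrightarrow> card {a, b, c} = 3"
  by simp

lemma unit_cubeD: "x \<in> unit_cube \<Longrightarrow> 0 \<le> x $ p" "x \<in> unit_cube \<Longrightarrow> x $ p \<le> 1"
  unfolding unit_cube_def by simp_all

lemma unit_cube_eq_cbox: "unit_cube = cbox (0 :: real ^ 'a::finite) 1"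
  unfolding unit_cube_def by (auto simp: mem_box_cart)

lemma compact_subset_unit_cube: "closed S \<Longrightarrow> S \<subseteq> unit_cube \<Longrightarrow> compact (S :: (real ^ 'a::finite) set)"
  using compact_Int_closed [OF compact_cbox, of S 0 1] unfolding unit_cube_eq_cbox
  by (simp add: inf.absorb2)

lemma extreme_point_convex_combination:
  assumes "x extreme_point_of S" "a \<in> S" "y \<in> S" "0 < t" "t < 1" "x = t *\<^sub>R a + (1 - t) *\<^sub>R y"
  shows "x = a"
proof (rule ccontr)
  assume "x \<noteq> a"
  then have "a \<noteq> y"
    using assms(6) by (auto simp: scaleR_left_distrib [symmetric])
  then have "x \<in> open_segment a y"
    using assms(4-6) by (auto simp: in_segment intro!: exI [of _ "1 - t"])
  then show False using assms(1-3) unfolding extreme_point_of_def by blast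
qed

text \<open>The peeling step behind both vertex descriptions: subtract the largest multiple of the
  indicator vector of \<open>V\<close> that keeps the coordinates in \<open>V\<close> nonnegative, and rescale.\<close>

lemma extreme_point_peel:
  fixes x :: "real ^ 'a::finite"
  assumes x: "x extreme_point_of S" and V: "ind V \<in> S" "V \<noteq> {}"
    and pos: "\<And>p. p \<in> V \<Longrightarrow> 0 < x $ p" "\<And>p. p \<in> V \<Longrightarrow> x $ p \<le> 1"
    and full: "(\<And>p. p \<in> V \<Longrightarrow> x $ p = 1) \<Longrightarrow> x = ind V"
    and peel: "\<And>d. 0 < d \<Longrightarrow> d < 1 \<Longrightarrow> (\<And>p. p \<in> V \<Longrightarrow> d \<le> x $ p) \<Longrightarrow>
      (\<chi> p. (x $ p - d * of_bool (p \<in> V)) / (1 - d)) \<in> S"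
  shows "x = ind V"
proof -
  define d where "d = Min ((\<lambda>p. x $ p) ` V)"
  have "d \<in> (\<lambda>p. x $ p) ` V" unfolding d_def using V(2) by (intro Min_in) auto
  then have d: "0 < d" "d \<le> 1" using pos by auto
  have le: "d \<le> x $ p" if "p \<in> V" for p unfolding d_def using that by (intro Min_le) auto
  show ?thesis
  proof (cases "d = 1")
    case True
    then have "x $ p = 1" if "p \<in> V" for p using le [OF that] pos(2) [OF that] by simp
    then show ?thesis by (rule full)
  next
    case False
    then have d1: "d < 1" using d by simp
    let ?y = "\<chi> p. (x $ p - d * of_bool (p \<in> V)) / (1 - d)"
    have "x = d *\<^sub>R ind V + (1 - d) *\<^sub>R ?y"
      using d1 by (simp add: vec_eq_iff)
    then show ?thesis
      using extreme_point_convex_combination [OF x V(1) peel [OF d(1) d1 le] d(1) d1] by blast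
  qed
qed

lemma order_polytopeI:
  assumes "\<And>p. p \<notin> P \<Longrightarrow> x $ p = 0" "\<And>p. 0 \<le> x $ p" "\<And>p. x $ p \<le> 1"
    and "\<And>p q. p \<in> P \<Longrightarrow> q \<in> P \<Longrightarrow> p \<le> q \<Longrightarrow> x $ p \<le> x $ q"
  shows "x \<in> order_polytope P"
  unfolding order_polytope_def using assms by simp

lemma chain_polytopeI:
  assumes "\<And>p. p \<notin> P \<Longrightarrow> x $ p = 0" "\<And>p. 0 \<le> x $ p"
    and "\<And>ps. set ps \<subseteq> P \<Longrightarrow> sorted_wrt (<) ps \<Longrightarrow> (\<Sum>p\<leftarrow>ps. x $ p) \<le> 1"
  shows "x \<in> chain_polytope P"
  unfolding chain_polytope_def using assms by simp

section \<open>The order polytope\<close>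

lemma order_polytope_unit_cube: "order_polytope P \<subseteq> unit_cube"
proof
  fix x :: "real ^ 'a::{finite,order}" assume "x \<in> order_polytope P"
  then have "0 \<le> x $ p \<and> x $ p \<le> 1" for p unfolding order_polytope_def by (cases "p \<in> P") auto
  then show "x \<in> unit_cube" unfolding unit_cube_def by blast
qed

lemma order_polytope_bounds:
  assumes "x \<in> order_polytope P" shows "0 \<le> x $ p" "x $ p \<le> 1"
  using unit_cubeD [OF subsetD [OF order_polytope_unit_cube assms]] by simp_all

lemma closed_order_polytope: "closed (order_polytope P)"
  unfolding order_polytope_def Ball_def
  by (intro closed_Collect_conj closed_Collect_all closed_Collect_imp open_Collect_const
      closed_Collect_le closed_Collect_eq continuous_intros)

lemma convex_order_polytope: "convex (order_polytope P)"
proof (rule convexI)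
  fix x y :: "real ^ 'a::{finite,order}" and u v :: real
  assume xy: "x \<in> order_polytope P" "y \<in> order_polytope P" and uv: "0 \<le> u" "0 \<le> v" "u + v = 1"
  have "0 \<le> u * x $ p + v * y $ p" "u * x $ p + v * y $ p \<le> 1" if "p \<in> P" for p
    using that xy uv unfolding order_polytope_def by (auto intro: convex_bound_le)
  moreover have "u * x $ p + v * y $ p \<le> u * x $ q + v * y $ q" if "p \<in> P" "q \<in> P" "p \<le> q" for p q
    using that xy uv unfolding order_polytope_def by (auto intro!: add_mono mult_left_mono)
  moreover have "u * x $ p + v * y $ p = 0" if "p \<notin> P" for p
    using that xy unfolding order_polytope_def by auto
  ultimately show "u *\<^sub>R x + v *\<^sub>R y \<in> order_polytope P" unfolding order_polytope_def by simp
qed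

lemma ind_filter_mem:
  assumes "V \<in> filters P" shows "ind V \<in> order_polytope P"
proof -
  have "V \<subseteq> P" "\<And>p q. p \<in> V \<Longrightarrow> q \<in> P \<Longrightarrow> p \<le> q \<Longrightarrow> q \<in> V"
    using assms unfolding filters_def by auto
  then show ?thesis unfolding order_polytope_def by (auto simp: of_bool_def)
qed

text \<open>The support of a point is a filter, and its indicator vector is the one to peel off. All
  coordinates in the support are lowered by the same amount and the others are zero, so monotonicity
  persists.\<close>

lemma extreme_point_order_polytope:
  fixes P :: "'a::{finite,order} set"
  assumes x: "x extreme_point_of (order_polytope P)"
  shows "x \<in> ind ` filters P"
proof -
  have xS: "x \<in> order_polytope P" using x unfolding extreme_point_of_def by blast
  then have out: "\<And>p. p \<notin> P \<Longrightarrow> x $ p = 0" and bd: "\<And>p. p \<in> P \<Longrightarrow> 0 \<le> x $ p" "\<And>p. p \<in> P \<Longrightarrow> x $ p \<le> 1"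
    and mono: "\<And>p q. p \<in> P \<Longrightarrow> q \<in> P \<Longrightarrow> p \<le> q \<Longrightarrow> x $ p \<le> x $ q"
    unfolding order_polytope_def by auto
  let ?I = "{p\<in>P. 0 < x $ p}"
  have zero: "x $ p = 0" if "p \<notin> ?I" for p using that out bd(1) by force
  have I: "?I \<in> filters P" unfolding filters_def using mono by force
  have "x = ind ?I"
  proof (cases "?I = {}")
    case True
    then have "x $ p = 0" for p using zero [of p] by blast
    then show ?thesis unfolding True by (simp add: vec_eq_iff)
  next
    case False
    show ?thesis
    proof (rule extreme_point_peel [OF x ind_filter_mem [OF I] False])
      show "0 < x $ p" "x $ p \<le> 1" if "p \<in> ?I" for p using that bd by auto
      show "x = ind ?I" if "\<And>p. p \<in> ?I \<Longrightarrow> x $ p = 1"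
      proof -
        have "x $ p = ind ?I $ p" for p using that [of p] zero [of p] by (cases "p \<in> ?I") simp_all
        then show ?thesis by (simp add: vec_eq_iff)
      qed
      fix d assume d: "0 < d" "d < 1" and le: "\<And>p. p \<in> ?I \<Longrightarrow> d \<le> x $ p"
      let ?y = "\<lambda>p. (x $ p - d * of_bool (p \<in> ?I)) / (1 - d)"
      have y_in: "?y p = (x $ p - d) / (1 - d)" if "p \<in> ?I" for p using that by simp
      have y_out: "?y p = 0" if "p \<notin> ?I" for p using zero [OF that] that by simp
      have y0: "0 \<le> ?y p" for p using y_in [of p] y_out [of p] le [of p] d by (cases "p \<in> ?I") simp_all
      have y1: "?y p \<le> 1" for p
        using y_in [of p] y_out [of p] bd(2) [of p] d by (cases "p \<in> ?I") (simp_all add: divide_le_eq)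
      have ym: "?y p \<le> ?y q" if "p \<in> P" "q \<in> P" "p \<le> q" for p q
      proof (cases "p \<in> ?I")
        case True
        then have "q \<in> ?I" using I that unfolding filters_def by blast
        then show ?thesis using y_in True mono [OF that] d by (simp add: divide_right_mono)
      next
        case False
        show ?thesis unfolding y_out [OF False] by (rule y0)
      qed
      show "(\<chi> p. ?y p) \<in> order_polytope P"
      proof (rule order_polytopeI, unfold vec_lambda_beta)
        show "?y p = 0" if "p \<notin> P" for p by (rule y_out) (use that in simp)
              show "0 \<le> ?y p" "?y p \<le> 1" for p by (rule y0, rule y1)
        show "?y p \<le> ?y q" if "p \<in> P" "q \<in> P" "p \<le> q" for p q using that by (rule ym)
      qed
    qed
  qed
  then show ?thesis using I by blast
qed

text \<open>Passing upwards could leave the toggled set only where \<open>X\<close> separates two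
  comparable elements of the symmetric difference, which it never does.\<close>

lemma exchange_filters:
  assumes V: "V \<in> filters P" and W: "W \<in> filters P" and X: "X \<in> comp_unions (sym_diff V W)"
  shows "sym_diff V X \<in> filters P"
  unfolding filters_def
proof (intro CollectI conjI ballI impI)
  have Vf: "\<And>p q. p \<in> V \<Longrightarrow> q \<in> P \<Longrightarrow> p \<le> q \<Longrightarrow> q \<in> V" and VP: "V \<subseteq> P"
    using V unfolding filters_def by auto
  have Wf: "\<And>p q. p \<in> W \<Longrightarrow> q \<in> P \<Longrightarrow> p \<le> q \<Longrightarrow> q \<in> W" and WP: "W \<subseteq> P"
    using W unfolding filters_def by auto
  have XE: "X \<subseteq> sym_diff V W" using X unfolding comp_unions_def by blast
  show "sym_diff V X \<subseteq> P" using XE VP WP by blast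
  fix p q assume p: "p \<in> sym_diff V X" and q: "q \<in> P" "p \<le> q"
  consider "p \<in> V" "p \<notin> X" | "p \<in> X" "p \<in> W" "p \<notin> V" using p XE by blast
  then show "q \<in> sym_diff V X"
  proof cases
    case 1
    have qV: "q \<in> V" by (rule Vf [OF 1(1) q])
    have "q \<notin> X"
    proof
      assume qX: "q \<in> X"
      then have "q \<notin> W" using XE qV by blast
      then have "p \<in> sym_diff V W" using 1 Wf [OF _ q] by blast
      then show False using comp_unionsD [OF X qX, of p] q(2) 1(2) by blast
    qed
    then show ?thesis using qV by blast
  next
    case 2
    have qW: "q \<in> W" by (rule Wf [OF 2(2) q])
    show ?thesis
    proof (cases "q \<in> V")
      case True
      then show ?thesis using XE qW by blast
    next
      case False
      then have "q \<in> X" using comp_unionsD [OF X 2(1), of q] qW q(2) by blast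
      then show ?thesis using False by blast
    qed
  qed
qed

lemma zero_one_order_polytope:
  fixes P :: "'a::{finite,order} set"
  shows "zero_one_polytope (order_polytope P) (filters P)"
proof
  show "compact (order_polytope P)"
    by (rule compact_subset_unit_cube [OF closed_order_polytope order_polytope_unit_cube])
  show "convex (order_polytope P)" by (rule convex_order_polytope)
  show "order_polytope P \<subseteq> unit_cube" by (rule order_polytope_unit_cube)
  show "ind V \<in> order_polytope P" if "V \<in> filters P" for V using that by (rule ind_filter_mem)
  show "x \<in> ind ` filters P" if "x extreme_point_of order_polytope P" for x
    using that by (rule extreme_point_order_polytope)
  show "sym_diff V X \<in> filters P"
    if "V \<in> filters P" "W \<in> filters P" "X \<in> comp_unions (sym_diff V W)" for V W X
    using that by (rule exchange_filters)
  fix V W p q assume V: "V \<in> filters P" and W: "W \<in> filters P"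
    and p: "p \<in> sym_diff V W" and q: "q \<in> sym_diff V W" and "p < q"
  then have pq: "p \<in> P" "q \<in> P" "p \<le> q" unfolding filters_def by auto
  have y: "y $ p \<le> y $ q" if "y \<in> order_polytope P" for y
    using that pq unfolding order_polytope_def by blast
  have "p \<in> V \<longleftrightarrow> q \<in> V" using p q pq V W unfolding filters_def by blast
  then show "(\<forall>y\<in>order_polytope P. coord V y p \<le> coord V y q) \<or>
      (\<forall>y\<in>order_polytope P. coord V y q \<le> coord V y p)"
    using y unfolding coord_def by (cases "p \<in> V") auto
qed

text \<open>A point of the tight hull is 1 on the smallest filter, 0 off the largest, and constant
  on each connected piece: \<open>s\<close> on \<open>E - D\<close> and \<open>t\<close> on
  \<open>D\<close>. As \<open>E\<close> is connected, some element of \<open>D\<close> lies below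
  one of \<open>E - D\<close>, so \<open>t \<le> s\<close>; the barycentric coordinates are
  \<open>1 - s\<close>, \<open>s - t\<close> and \<open>t\<close>.\<close>

lemma tight_filter_triangle:
  fixes P :: "'a::{finite,order} set"
  assumes "(E, D, R) \<in> filter_triangle_data P"
  shows "tight_hull (order_polytope P) (ind ` filter_triangle P (E, D, R)) \<subseteq> hull01 (filter_triangle P (E, D, R))"
proof
  let ?I = "base_filter P E R"
  let ?J = "?I \<union> (E - D)" and ?K = "?I \<union> E"
  have T: "filter_triangle P (E, D, R) = {?I, ?J, ?K}" unfolding filter_triangle_def by simp
  note c = filter_triangle_chain [OF assms]
  have E: "poset_connected E" and D: "D \<in> order_splits E"
    using assms unfolding filter_triangle_data_def triangle_regions_def by auto
  note d = order_splitsD [OF D]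
  have KP: "?K \<subseteq> P" using c(3) unfolding filters_def by blast
  have IE: "?I \<inter> E = {}" using c(6) by blast
  fix y assume y: "y \<in> tight_hull (order_polytope P) (ind ` filter_triangle P (E, D, R))"
  have yS: "y \<in> order_polytope P" using y tight_hull_subset by blast
  note cube = order_polytope_bounds [OF yS]
  have mono: "y $ p \<le> y $ q" if "p \<in> P" "q \<in> P" "p \<le> q" for p q
    using yS that unfolding order_polytope_def by blast
  have tightI: "g y = 0"
    if "affine_form g" "\<And>x. x \<in> order_polytope P \<Longrightarrow> 0 \<le> g x"
      and g: "g (ind ?I) = 0" "g (ind ?J) = 0" "g (ind ?K) = 0" for g
  proof (rule tight_hullD [OF y that(1,2)])
    show "g w = 0" if "w \<in> ind ` filter_triangle P (E, D, R)" for w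
      using that g unfolding T image_insert image_empty insert_iff empty_iff by metis
  qed
  have yI: "y $ p = 1" if p: "p \<in> ?I" for p
  proof -
    have "1 - y $ p = 0"
    proof (rule tightI [OF affine_form_diff [OF affine_form_const affine_form_nth]])
      show "0 \<le> 1 - x $ p" if "x \<in> order_polytope P" for x
        using order_polytope_bounds [OF that, of p] by simp
    qed (use p in simp_all)
    then show ?thesis by simp
  qed
  have yK: "y $ p = 0" if p: "p \<notin> ?K" for p
    by (rule tightI [OF affine_form_nth order_polytope_bounds(1)]) (use p in simp_all)
  have block: "y $ p = y $ q"
    if pq: "p \<in> P" "q \<in> P" "p \<le> q"
      "p \<in> ?I \<longleftrightarrow> q \<in> ?I" "p \<in> ?J \<longleftrightarrow> q \<in> ?J" "p \<in> ?K \<longleftrightarrow> q \<in> ?K" for p q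
  proof -
    have "y $ q - y $ p = 0"
    proof (rule tightI [OF affine_form_diff [OF affine_form_nth affine_form_nth]])
      show "0 \<le> x $ q - x $ p" if "x \<in> order_polytope P" for x
        using that pq(1-3) unfolding order_polytope_def by simp
    qed (simp_all only: ind_nth pq(4-6) diff_self)
    then show ?thesis by simp
  qed
  have yD: "y $ p = y $ q" if "p \<in> D" "q \<in> D" "p \<le> q" for p q
    using that d(1) IE KP by (intro block) auto
  have yC: "y $ p = y $ q" if "p \<in> E - D" "q \<in> E - D" "p \<le> q" for p q
    using that IE KP by (intro block) auto
  obtain t where t: "\<And>p. p \<in> D \<Longrightarrow> y $ p = t"
    using poset_connected_constant [OF d(5), of "\<lambda>p. y $ p"] yD by blast
  obtain s where s: "\<And>p. p \<in> E - D \<Longrightarrow> y $ p = s"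
    using poset_connected_constant [OF d(6), of "\<lambda>p. y $ p"] yC by blast
  obtain p0 q0 where pq0: "p0 \<in> D" "q0 \<in> E - D" "p0 \<le> q0 \<or> q0 \<le> p0"
    using poset_connectedD [OF E d(1,2)] d(3) by blast
  have "\<not> q0 \<le> p0" using D pq0 unfolding order_splits_def downsets_def by blast
  then have "y $ p0 \<le> y $ q0" using pq0 d(1) KP by (intro mono) auto
  then have "t \<le> s" using s [OF pq0(2)] t [OF pq0(1)] by simp
  have bounds: "0 \<le> t" "s \<le> 1" using cube [of p0] cube [of q0] s [OF pq0(2)] t [OF pq0(1)] by auto
  have "y $ p = ((1 - s) *\<^sub>R ind ?I + (s - t) *\<^sub>R ind ?J + t *\<^sub>R ind ?K) $ p" for p
  proof -
    consider "p \<in> ?I" | "p \<in> D" "p \<in> E" "p \<notin> ?I" | "p \<in> E - D" "p \<notin> ?I" | "p \<notin> ?K"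
      using d(1) IE by blast
    then show ?thesis
    proof cases
      case 1
      then show ?thesis using yI [OF 1] by simp
    next
      case 2
      then show ?thesis using t [OF 2(1)] by simp
    next
      case 3
      then show ?thesis using s [OF 3(1)] by simp
    next
      case 4
      then show ?thesis using yK [OF 4] by simp
    qed
  qed
  then have "y = (1 - s) *\<^sub>R ind ?I + (s - t) *\<^sub>R ind ?J + t *\<^sub>R ind ?K" by (simp only: vec_eq_iff) blast
  moreover have "0 \<le> 1 - s" "0 \<le> s - t" "0 \<le> t" "(1 - s) + (s - t) + t = 1" using bounds \<open>t \<le> s\<close> by auto
  ultimately have "y \<in> convex hull {ind ?I, ind ?J, ind ?K}" unfolding convex_hull_3 by blast
  then show "y \<in> hull01 (filter_triangle P (E, D, R))" unfolding hull01_def T by simp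
qed

lemma f2_triangle_order_polytope:
  fixes P :: "'a::{finite,order} set"
  shows "f2_triangle (order_polytope P) =
    (\<Sum>E\<in>triangle_regions P. card (order_splits E) * card (antichains (incomp_part P E)))"
proof -
  interpret zero_one_polytope "order_polytope P" "filters P" by (rule zero_one_order_polytope)
  have "f2_triangle (order_polytope P) = card (filter_triangle P ` filter_triangle_data P)"
  proof (rule f2_triangle_eq)
    fix \<W> assume "\<W> \<in> filter_triangle P ` filter_triangle_data P"
    then obtain E D R where d: "(E, D, R) \<in> filter_triangle_data P" and W: "\<W> = filter_triangle P (E, D, R)"
      by auto
    note c = filter_triangle_chain [OF d]
    have "\<W> \<subseteq> filters P" using c(1-3) unfolding W filter_triangle_def by simp
    moreover have "card \<W> = 3"
      unfolding W filter_triangle_def prod.case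
      by (rule card_three) (use c(4,5) in blast)+
    ultimately show "\<W> \<subseteq> filters P \<and> card \<W> = 3 \<and> tight_hull (order_polytope P) (ind ` \<W>) \<subseteq> hull01 \<W>"
      using tight_filter_triangle [OF d] unfolding W by blast
  qed (rule connected_filters_triangle)
  also have "\<dots> = card (filter_triangle_data P)" by (rule card_image [OF inj_filter_triangle])
  finally show ?thesis unfolding card_filter_triangle_data .
qed

lemma f2_square_order_polytope:
  fixes P :: "'a::{finite,order} set"
  shows "f2_square (order_polytope P) = (\<Sum>E\<in>square_regions P. card (antichains (incomp_part P E)))"
  unfolding zero_one_polytope.f2_square_eq [OF zero_one_order_polytope] card_filter_squares
  by (simp add: card_SigmaI card_filters_eq_antichains)

section \<open>The chain polytope\<close>

lemma chain_polytope_sum_le: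
  "x \<in> chain_polytope P \<Longrightarrow> set ps \<subseteq> P \<Longrightarrow> sorted_wrt (<) ps \<Longrightarrow> (\<Sum>p\<leftarrow>ps. x $ p) \<le> 1"
  unfolding chain_polytope_def by blast

lemma chain_polytope_nonneg: "x \<in> chain_polytope P \<Longrightarrow> 0 \<le> x $ p"
  unfolding chain_polytope_def by (cases "p \<in> P") auto

lemma chain_polytope_out: "x \<in> chain_polytope P \<Longrightarrow> p \<notin> P \<Longrightarrow> x $ p = 0"
  unfolding chain_polytope_def by blast

lemma chain_polytope_unit_cube: "chain_polytope P \<subseteq> unit_cube"
proof
  fix x :: "real ^ 'a::{finite,order}" assume x: "x \<in> chain_polytope P"
  have "x $ p \<le> 1" for p
    using chain_polytope_sum_le [OF x, of "[p]"] chain_polytope_out [OF x, of p] by (cases "p \<in> P") auto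
  then show "x \<in> unit_cube" using chain_polytope_nonneg [OF x] unfolding unit_cube_def by blast
qed

lemma closed_chain_polytope:
  fixes P :: "'a::{finite,order} set"
  shows "closed (chain_polytope P)"
proof -
  have "continuous_on UNIV (\<lambda>x :: real ^ 'a::{finite,order}. \<Sum>p\<leftarrow>ps. x $ p)" for ps
    by (induction ps) (auto intro!: continuous_intros)
  then show ?thesis
    unfolding chain_polytope_def Ball_def
    by (intro closed_Collect_conj closed_Collect_all closed_Collect_imp open_Collect_const
        closed_Collect_le closed_Collect_eq continuous_intros)
qed

lemma convex_chain_polytope: "convex (chain_polytope P)"
proof (rule convexI)
  fix x y :: "real ^ 'a::{finite,order}" and u v :: real
  assume xy: "x \<in> chain_polytope P" "y \<in> chain_polytope P" and uv: "0 \<le> u" "0 \<le> v" "u + v = 1"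
  have sum: "(\<Sum>p\<leftarrow>ps. (u *\<^sub>R x + v *\<^sub>R y) $ p) = u * (\<Sum>p\<leftarrow>ps. x $ p) + v * (\<Sum>p\<leftarrow>ps. y $ p)" for ps
    by (induction ps) (auto simp: algebra_simps)
  have "(\<Sum>p\<leftarrow>ps. (u *\<^sub>R x + v *\<^sub>R y) $ p) \<le> 1" if "set ps \<subseteq> P" "sorted_wrt (<) ps" for ps
    unfolding sum using xy uv that by (intro convex_bound_le chain_polytope_sum_le)
  moreover have "0 \<le> (u *\<^sub>R x + v *\<^sub>R y) $ p" for p
    using uv chain_polytope_nonneg [OF xy(1), of p] chain_polytope_nonneg [OF xy(2), of p] by simp
  moreover have "(u *\<^sub>R x + v *\<^sub>R y) $ p = 0" if "p \<notin> P" for p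
    using that xy by (simp add: chain_polytope_out)
  ultimately show "u *\<^sub>R x + v *\<^sub>R y \<in> chain_polytope P" unfolding chain_polytope_def by blast
qed

lemma sum_ind_antichain_le_1:
  assumes A: "A \<in> antichains P" and ps: "sorted_wrt (<) ps"
  shows "(\<Sum>p\<leftarrow>ps. ind A $ p) \<le> (1::real)"
  using ps
proof (induction ps)
  case (Cons p ps)
  show ?case
  proof (cases "p \<in> A")
    case True
    have "ind A $ q = 0" if "q \<in> set ps" for q
      using that Cons.prems antichainsD [OF A True, of q] by (auto simp: less_imp_le)
    then have "(\<Sum>p\<leftarrow>ps. ind A $ p) = (\<Sum>p\<leftarrow>ps. (0::real))"
      by (intro arg_cong [where f = sum_list] map_cong) auto
    then show ?thesis using True by simp
  next
    case False
    then show ?thesis using Cons by simp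
  qed
qed simp

lemma ind_antichain_mem:
  assumes A: "A \<in> antichains P" shows "ind A \<in> chain_polytope P"
proof -
  have "A \<subseteq> P" by (rule antichains_subset [OF A])
  then have "ind A $ p = 0" if "p \<notin> P" for p using that by auto
  moreover have "0 \<le> ind A $ p" for p by simp
  moreover note sum_ind_antichain_le_1 [OF A]
  ultimately show ?thesis unfolding chain_polytope_def by blast
qed

text \<open>The vector to peel off belongs to the minimal elements of the support. A chain meeting
  them loses at least \<open>d\<close>. For a chain avoiding them, its part in the support, unless
  empty, can be extended downwards by some minimal \<open>a\<close> with \<open>x $ a\<close> at
  least \<open>d\<close>, so its sum was at most \<open>1 - d\<close> already.\<close>

lemma extreme_point_chain_polytope:
  fixes P :: "'a::{finite,order} set"
  assumes x: "x extreme_point_of (chain_polytope P)"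
  shows "x \<in> ind ` antichains P"
proof -
  have xS: "x \<in> chain_polytope P" using x unfolding extreme_point_of_def by blast
  note nonneg = chain_polytope_nonneg [OF xS] and out = chain_polytope_out [OF xS]
  note sum_le = chain_polytope_sum_le [OF xS]
  let ?I = "{p\<in>P. 0 < x $ p}"
  let ?A = "minimals ?I"
  have zero: "x $ p = 0" if "p \<notin> ?I" for p using that out [of p] nonneg [of p] by (cases "p \<in> P") auto
  have AI: "?A \<subseteq> ?I" by (rule minimals_subset)
  have A: "?A \<in> antichains P" using antichains_minimals [of ?I] unfolding antichains_def by auto
  have x1: "x $ p \<le> 1" if "p \<in> P" for p using sum_le [of "[p]"] that by simp
  have "x = ind ?A"
  proof (cases "?A = {}")
    case True
    then have "?I = {}" using ex_minimals_le [of ?I] by auto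
    then have "x $ p = 0" for p using zero [of p] by blast
    then show ?thesis unfolding True by (simp add: vec_eq_iff)
  next
    case False
    show ?thesis
    proof (rule extreme_point_peel [OF x ind_antichain_mem [OF A] False])
      show "0 < x $ p" "x $ p \<le> 1" if "p \<in> ?A" for p using that AI x1 by auto
      show "x = ind ?A" if one: "\<And>p. p \<in> ?A \<Longrightarrow> x $ p = 1"
      proof -
        \<comment> \<open>With value 1 on the minimal elements of the support, a further element of
          the support would produce a chain of sum greater than 1.\<close>
        have rest: "x $ p = 0" if "p \<notin> ?A" for p
        proof (rule ccontr)
          assume "x $ p \<noteq> 0"
          then have p: "p \<in> ?I" using zero by blast
          then obtain a where a: "a \<in> ?A" "a \<le> p" using ex_minimals_le [of ?I p] by auto
          then have "a < p" using that by (auto simp: less_le)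
          then have "x $ a + x $ p \<le> 1" using sum_le [of "[a, p]"] a(1) AI p by auto
          then show False using one [OF a(1)] p by simp
        qed
        have eq: "x $ p = ind ?A $ p" for p using one [of p] rest [of p] by (cases "p \<in> ?A") simp_all
        show ?thesis unfolding vec_eq_iff by (intro allI eq)
      qed
      fix d assume d: "0 < d" "d < 1" and le: "\<And>p. p \<in> ?A \<Longrightarrow> d \<le> x $ p"
      let ?y = "\<lambda>p. (x $ p - d * of_bool (p \<in> ?A)) / (1 - d)"
      have y0: "0 \<le> ?y p" for p using le [of p] nonneg [of p] d by (cases "p \<in> ?A") simp_all
      have yout: "?y p = 0" if "p \<notin> P" for p
      proof -
        have "p \<notin> ?A" using that AI by blast
        then show ?thesis using out [OF that] by simp
      qed
      have ysum: "(\<Sum>p\<leftarrow>ps. ?y p) \<le> 1" if ps: "set ps \<subseteq> P" "sorted_wrt (<) ps" for ps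
      proof -
        have split: "(\<Sum>p\<leftarrow>ps. ?y p) = ((\<Sum>p\<leftarrow>ps. x $ p) - d * (\<Sum>p\<leftarrow>ps. of_bool (p \<in> ?A))) / (1 - d)" for ps
          by (induction ps) (simp_all add: add_divide_distrib diff_divide_distrib distrib_left)
        have "(\<Sum>p\<leftarrow>ps. x $ p) - d * (\<Sum>p\<leftarrow>ps. of_bool (p \<in> ?A)) \<le> 1 - d"
        proof (cases "set ps \<inter> ?A = {}")
          case False
          then obtain a where a: "a \<in> set ps" "a \<in> ?A" by blast
          then have "(1::real) = of_bool (a \<in> ?A)" by simp
          also have "\<dots> \<le> (\<Sum>p\<leftarrow>ps. of_bool (p \<in> ?A))"
            using a(1) by (intro member_le_sum_list) auto
          finally have "d * 1 \<le> d * (\<Sum>p\<leftarrow>ps. of_bool (p \<in> ?A))"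
            using d(1) by (intro mult_left_mono) auto
          then show ?thesis using sum_le [OF ps] by simp
        next
          case True
          have none: "(\<Sum>p\<leftarrow>ps. of_bool (p \<in> ?A)) = (0::real)"
            using True by (induction ps) auto
          \<comment> \<open>Only after dropping the zero coordinates is the first element of the
            chain known to lie over a minimal element of the support.\<close>
          have filter: "(\<Sum>p\<leftarrow>ps. x $ p) = (\<Sum>p\<leftarrow>filter (\<lambda>p. p \<in> ?I) ps. x $ p)"
          proof (induction ps)
            case (Cons p ps)
            then show ?case using zero [of p] by (cases "p \<in> ?I") simp_all
          qed simp
          show ?thesis
          proof (cases "filter (\<lambda>p. p \<in> ?I) ps")
            case Nil
            then show ?thesis using none filter d by simp
          next
            case (Cons h qs)
            have "h \<in> set (filter (\<lambda>p. p \<in> ?I) ps)" unfolding Cons by simp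
            then have h: "h \<in> ?I" "h \<in> set ps" by simp_all
            then obtain a where a: "a \<in> ?A" "a \<le> h" using ex_minimals_le [of ?I h] by auto
            then have ah: "a < h" using True h(2) by (auto simp: less_le)
            have so: "sorted_wrt (<) (h # qs)" using sorted_wrt_filter [OF ps(2)] Cons by metis
            then have "sorted_wrt (<) (a # h # qs)" using ah by (auto intro: less_trans)
            moreover have "set (a # h # qs) \<subseteq> P"
            proof -
              have "set (h # qs) \<subseteq> set ps" unfolding Cons [symmetric] by auto
              then show ?thesis using ps(1) a(1) AI by auto
            qed
            ultimately have "(\<Sum>p\<leftarrow>a # h # qs. x $ p) \<le> 1" by (intro sum_le)
            then have "x $ a + (\<Sum>p\<leftarrow>ps. x $ p) \<le> 1" unfolding filter Cons by simp
            then show ?thesis using le [OF a(1)] none by simp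
          qed
        qed
        then show ?thesis unfolding split using d by (simp add: divide_le_eq)
      qed
      show "(\<chi> p. ?y p) \<in> chain_polytope P"
      proof (rule chain_polytopeI, unfold vec_lambda_beta)
        show "?y p = 0" if "p \<notin> P" for p using that by (rule yout)
        show "0 \<le> ?y p" for p by (rule y0)
        show "(\<Sum>p\<leftarrow>ps. ?y p) \<le> 1" if "set ps \<subseteq> P" "sorted_wrt (<) ps" for ps
          using that by (rule ysum)
      qed
    qed
  qed
  then show ?thesis using A by blast
qed

text \<open>An untouched element of \<open>V\<close> that is comparable to a newly added one must
  also belong to \<open>W\<close>, since otherwise it would have been toggled too. So comparable
  elements of the new set lie together in \<open>V\<close> or together in \<open>W\<close>.\<close>

lemma exchange_antichains:
  assumes V: "V \<in> antichains P" and W: "W \<in> antichains P" and X: "X \<in> comp_unions (sym_diff V W)"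
  shows "sym_diff V X \<in> antichains P"
proof -
  have XE: "X \<subseteq> sym_diff V W" using X unfolding comp_unions_def by blast
  have "p = q" if pq: "p \<in> sym_diff V X" "q \<in> sym_diff V X" "p \<le> q" for p q
  proof -
    have mixed: "a \<in> W" if "a \<in> V - X" "b \<in> X - V" "a \<le> b \<or> b \<le> a" for a b
    proof (rule ccontr)
      assume "a \<notin> W"
      then have "a \<in> sym_diff V W" using that by blast
      then show False using comp_unionsD [OF X, of b a] that by blast
    qed
    have XW: "X - V \<subseteq> W" using XE by blast
    have "(p \<in> V \<and> q \<in> V) \<or> (p \<in> W \<and> q \<in> W)"
      using pq mixed [of p q] mixed [of q p] XW by blast
    then show ?thesis using antichainsD [OF V, of p q] antichainsD [OF W, of p q] pq(3) by blast
  qed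
  moreover have "sym_diff V X \<subseteq> P" using XE antichains_subset [OF V] antichains_subset [OF W] by blast
  ultimately show ?thesis unfolding antichains_def by blast
qed

lemma zero_one_chain_polytope:
  fixes P :: "'a::{finite,order} set"
  shows "zero_one_polytope (chain_polytope P) (antichains P)"
proof
  show "compact (chain_polytope P)"
    by (rule compact_subset_unit_cube [OF closed_chain_polytope chain_polytope_unit_cube])
  show "convex (chain_polytope P)" by (rule convex_chain_polytope)
  show "chain_polytope P \<subseteq> unit_cube" by (rule chain_polytope_unit_cube)
  show "ind V \<in> chain_polytope P" if "V \<in> antichains P" for V using that by (rule ind_antichain_mem)
  show "x \<in> ind ` antichains P" if "x extreme_point_of chain_polytope P" for x
    using that by (rule extreme_point_chain_polytope)
  show "sym_diff V X \<in> antichains P"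
    if "V \<in> antichains P" "W \<in> antichains P" "X \<in> comp_unions (sym_diff V W)" for V W X
    using that by (rule exchange_antichains)
  fix V W p q assume V: "V \<in> antichains P" and W: "W \<in> antichains P"
    and p: "p \<in> sym_diff V W" and q: "q \<in> sym_diff V W" and "p < q"
  have pq: "p \<in> P" "q \<in> P" using V W p q unfolding antichains_def by auto
  have y: "y $ p + y $ q \<le> 1" if "y \<in> chain_polytope P" for y
    using chain_polytope_sum_le [OF that, of "[p, q]"] pq \<open>p < q\<close> by simp
  have "p \<in> V \<longleftrightarrow> q \<notin> V" by (rule antichain_sym_diff_opposite [OF V W p q \<open>p < q\<close>])
  then show "(\<forall>y\<in>chain_polytope P. coord V y p \<le> coord V y q) \<or>
      (\<forall>y\<in>chain_polytope P. coord V y q \<le> coord V y p)"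
    using y unfolding coord_def by (cases "p \<in> V") (auto simp: algebra_simps)
qed

text \<open>The decisive tight inequalities come from chains of two or three elements that meet each
  of the three antichains exactly once. Together with the links they make \<open>y\<close> constant
  on the minimal elements outside \<open>M\<close> and on the maximal elements outside
  \<open>M\<close>. These two constants are the weights of the bottom and the top vertex.\<close>

lemma tight_antichain_triangle:
  fixes P :: "'a::{finite,order} set"
  assumes data: "(E, M, S) \<in> antichain_triangle_data P"
  shows "tight_hull (chain_polytope P) (ind ` antichain_triangle (E, M, S)) \<subseteq> hull01 (antichain_triangle (E, M, S))"
proof
  let ?L = "minimals E" and ?U = "maximals E"
  note f = antichain_triangle_facts [OF data]
  have T: "antichain_triangle (E, M, S) = {S \<union> ?L, S \<union> M, S \<union> ?U}" unfolding antichain_triangle_def by simp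
  have sub: "?L \<subseteq> E" "?U \<subseteq> E" by (rule minimals_subset, rule maximals_subset)
  have EP: "E \<subseteq> P" using f(1) unfolding order_convex_def by simp
  have SP: "S \<subseteq> P" using f(9) unfolding antichains_def incomp_part_def by blast
  fix y assume y: "y \<in> tight_hull (chain_polytope P) (ind ` antichain_triangle (E, M, S))"
  have yS: "y \<in> chain_polytope P" using y tight_hull_subset by blast
  note nonneg = chain_polytope_nonneg [OF yS]
  have tightI: "g y = 0"
    if "affine_form g" "\<And>x. x \<in> chain_polytope P \<Longrightarrow> 0 \<le> g x"
      and g: "g (ind (S \<union> ?L)) = 0" "g (ind (S \<union> M)) = 0" "g (ind (S \<union> ?U)) = 0" for g
  proof (rule tight_hullD [OF y that(1,2)])
    show "g w = 0" if "w \<in> ind ` antichain_triangle (E, M, S)" for w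
      using that g unfolding T image_insert image_empty insert_iff empty_iff by metis
  qed
  have notS: "p \<notin> S" if "p \<in> E" for p using f(8) that by blast
  have y_S: "y $ p = 1" if p: "p \<in> S" for p
  proof -
    have "1 - y $ p = 0"
    proof (rule tightI [OF affine_form_diff [OF affine_form_const affine_form_nth]])
      show "0 \<le> 1 - x $ p" if "x \<in> chain_polytope P" for x
        using unit_cubeD(2) [OF subsetD [OF chain_polytope_unit_cube that], of p] by simp
    qed (use p in simp_all)
    then show ?thesis by simp
  qed
  have y_out: "y $ p = 0" if p: "p \<notin> S \<union> ?L \<union> M \<union> ?U" for p
    by (rule tightI [OF affine_form_nth chain_polytope_nonneg]) (use p in auto)
  have pair: "y $ p + y $ q = 1"
    if pq: "p \<in> E" "q \<in> E" "p < q" "p \<in> ?L \<longleftrightarrow> q \<notin> ?L" "p \<in> M \<longleftrightarrow> q \<notin> M" "p \<in> ?U \<longleftrightarrow> q \<notin> ?U" for p q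
  proof -
    have "1 - y $ p - y $ q = 0"
    proof (rule tightI [OF affine_form_diff [OF affine_form_diff [OF affine_form_const affine_form_nth] affine_form_nth]])
      show "0 \<le> 1 - x $ p - x $ q" if "x \<in> chain_polytope P" for x
        using chain_polytope_sum_le [OF that, of "[p, q]"] pq(3) subsetD [OF EP pq(1)] subsetD [OF EP pq(2)]
        by simp
    qed (use pq(4-) notS [OF pq(1)] notS [OF pq(2)] in \<open>auto simp: of_bool_def\<close>)
    then show ?thesis by simp
  qed
  have triple: "y $ p + y $ z + y $ q = 1"
    if pq: "p \<in> ?L - M" "z \<in> M" "z \<notin> ?L" "z \<notin> ?U" "q \<in> ?U - M" "p < z" "z < q" for p z q
  proof -
    have e: "p \<in> E" "z \<in> E" "q \<in> E" "p \<notin> ?U" "q \<notin> ?L" using pq sub f(3,10) by auto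
    have "1 - y $ p - y $ z - y $ q = 0"
    proof (rule tightI [OF affine_form_diff [OF affine_form_diff [OF affine_form_diff [OF affine_form_const
              affine_form_nth] affine_form_nth] affine_form_nth]])
      have "p < q" using pq by (auto intro: less_trans)
      then show "0 \<le> 1 - x $ p - x $ z - x $ q" if "x \<in> chain_polytope P" for x
        using chain_polytope_sum_le [OF that, of "[p, z, q]"] pq(6,7) subsetD [OF EP e(1)]
          subsetD [OF EP e(2)] subsetD [OF EP e(3)]
        by simp
    qed (use pq notS [OF e(1)] notS [OF e(2)] notS [OF e(3)] e(4,5) in \<open>simp_all\<close>)
    then show ?thesis by simp
  qed
  have M_low: "\<exists>l\<in>?L - M. l < x" if x: "x \<in> M - ?L" for x
  proof -
    have "x \<in> E" using x f(10) by blast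
    then obtain l where l: "l \<in> ?L" "l \<le> x" using ex_minimals_le [of E x] by auto
    then have "l \<noteq> x" using x by blast
    moreover have "l \<notin> M" using antichainsD [OF f(5), of l x] l x \<open>l \<noteq> x\<close> by blast
    ultimately show ?thesis using l by (auto simp: less_le)
  qed
  have M_high: "\<exists>u\<in>?U - M. x < u" if x: "x \<in> M - ?U" for x
  proof -
    have "x \<in> E" using x f(10) by blast
    then obtain u where u: "u \<in> ?U" "x \<le> u" using ex_maximals_ge [of E x] by auto
    then have "u \<noteq> x" using x by blast
    moreover have "u \<notin> M" using antichainsD [OF f(5), of x u] u x \<open>u \<noteq> x\<close> by blast
    ultimately show ?thesis using u by (auto simp: less_le)
  qed
  have "\<exists>a\<in>?L - M. a \<le> x" if "x \<in> sym_diff ?L M" for x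
    using that M_low [of x] by (auto intro: less_imp_le)
  then have low: "?L - M \<noteq> {}" "linked (\<le>) (?L - M) (sym_diff ?L M)"
    using poset_connected_iff_linked [of "(\<le>)" "?L - M" "sym_diff ?L M"] f(6) by auto
  have "\<exists>a\<in>?U - M. x \<le> a" if "x \<in> sym_diff M ?U" for x
    using that M_high [of x] by (auto intro: less_imp_le)
  then have high: "?U - M \<noteq> {}" "linked (\<ge>) (?U - M) (sym_diff M ?U)"
    using poset_connected_iff_linked [of "(\<ge>)" "?U - M" "sym_diff M ?U"] f(7) by auto
  \<comment> \<open>The chosen maximal element depends on \<open>x\<close> only, so the right-hand
    side is the same for all \<open>a\<close> below \<open>x\<close>; a link through
    \<open>x\<close> therefore equates the values of \<open>y\<close> that it joins.\<close>
  have below: "y $ x + y $ a = (if x \<in> ?U then 1 else 1 - y $ (SOME u. u \<in> ?U - M \<and> x < u))"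
    if "x \<in> M - ?L" "a \<in> ?L - M" "a \<le> x" for x a
  proof -
    have ax: "a < x" "x \<in> E" "a \<in> E" using that sub f(10) by (auto simp: less_le)
    show ?thesis
    proof (cases "x \<in> ?U")
      case True
      have "y $ a + y $ x = 1" using that True f(3) ax by (intro pair) auto
      then show ?thesis using True by simp
    next
      case False
      define u where "u = (SOME u. u \<in> ?U - M \<and> x < u)"
      have "\<exists>u. u \<in> ?U - M \<and> x < u" using M_high [of x] that False by blast
      then have "u \<in> ?U - M \<and> x < u" unfolding u_def by (rule someI_ex)
      then have "y $ a + y $ x + y $ u = 1" using that False ax by (intro triple) auto
      then show ?thesis using False unfolding u_def by simp
    qed
  qed
  have above: "y $ x + y $ u = (if x \<in> ?L then 1 else 1 - y $ (SOME l. l \<in> ?L - M \<and> l < x))"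
    if "x \<in> M - ?U" "u \<in> ?U - M" "x \<le> u" for x u
  proof -
    have xu: "x < u" "x \<in> E" "u \<in> E" using that sub f(10) by (auto simp: less_le)
    show ?thesis
    proof (cases "x \<in> ?L")
      case True
      have "y $ x + y $ u = 1" using that True f(3) xu by (intro pair) auto
      then show ?thesis using True by simp
    next
      case False
      define l where "l = (SOME l. l \<in> ?L - M \<and> l < x)"
      have "\<exists>l. l \<in> ?L - M \<and> l < x" using M_low [of x] that False by blast
      then have "l \<in> ?L - M \<and> l < x" unfolding l_def by (rule someI_ex)
      then have "y $ l + y $ x + y $ u = 1" using that False xu by (intro triple) auto
      then show ?thesis using False unfolding l_def by simp
    qed
  qed
  obtain a0 where a0: "a0 \<in> ?L - M" using low(1) by blast
  obtain u0 where u0: "u0 \<in> ?U - M" using high(1) by blast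
  have s: "y $ a = y $ a0" if "a \<in> ?L - M" for a
  proof (rule ccontr)
    assume "y $ a \<noteq> y $ a0"
    let ?Y = "{a\<in>?L - M. y $ a = y $ a0}"
    have "?Y \<subseteq> ?L - M" "?Y \<noteq> {}" "?Y \<noteq> ?L - M" using a0 that \<open>y $ a \<noteq> y $ a0\<close> by blast+
    then obtain x b c where x: "x \<in> sym_diff ?L M" "b \<in> ?Y" "c \<in> (?L - M) - ?Y" "b \<le> x" "c \<le> x"
      using low(2) unfolding linked_def by meson
    have "x \<notin> ?L" using x minimalsD [of x E b] minimalsD [of x E c] sub by blast
    then have "x \<in> M - ?L" using x(1) by blast
    then show False using below [of x b] below [of x c] x by auto
  qed
  have t: "y $ u = y $ u0" if "u \<in> ?U - M" for u
  proof (rule ccontr)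
    assume "y $ u \<noteq> y $ u0"
    let ?Y = "{u\<in>?U - M. y $ u = y $ u0}"
    have "?Y \<subseteq> ?U - M" "?Y \<noteq> {}" "?Y \<noteq> ?U - M" using u0 that \<open>y $ u \<noteq> y $ u0\<close> by blast+
    then obtain x b c where x: "x \<in> sym_diff M ?U" "b \<in> ?Y" "c \<in> (?U - M) - ?Y" "x \<le> b" "x \<le> c"
      using high(2) unfolding linked_def by meson
    have "x \<notin> ?U" using x maximalsD [of x E b] maximalsD [of x E c] sub by blast
    then have "x \<in> M - ?U" using x(1) by blast
    then show False using above [of x b] above [of x c] x by auto
  qed
  have yMU: "y $ x = 1 - y $ a0" if x: "x \<in> M" "x \<in> ?U" for x
  proof -
    obtain a where a: "a \<in> ?L - M" "a < x" using M_low [of x] x f(3) by blast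
    then have "y $ x + y $ a = 1" using below [of x a] x f(3) by (auto simp: less_imp_le)
    then show ?thesis using s [OF a(1)] by simp
  qed
  have yML: "y $ x = 1 - y $ u0" if x: "x \<in> M" "x \<in> ?L" for x
  proof -
    obtain u where u: "u \<in> ?U - M" "x < u" using M_high [of x] x f(3) by blast
    then have "y $ x + y $ u = 1" using above [of x u] x f(3) by (auto simp: less_imp_le)
    then show ?thesis using t [OF u(1)] by simp
  qed
  have yM: "y $ x = 1 - y $ a0 - y $ u0" if x: "x \<in> M" "x \<notin> ?L" "x \<notin> ?U" for x
  proof -
    obtain a where a: "a \<in> ?L - M" "a < x" using M_low [of x] x by blast
    obtain u where u: "u \<in> ?U - M" "x < u" using M_high [of x] x by blast
    have "y $ a + y $ x + y $ u = 1" using a u x by (intro triple) auto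
    then show ?thesis using s [OF a(1)] t [OF u(1)] by simp
  qed
  have "y $ a0 + y $ u0 \<le> 1"
  proof -
    have conn: "poset_connected (?L \<union> ?U)"
      using f(2) poset_connected_boundary [of E] unfolding boundary_def by simp
    \<comment> \<open>A comparable pair crossing this cut cannot lie within \<open>?L\<close>,
      within \<open>?U\<close> or within \<open>M\<close>. It consists of a minimal and a maximal
      element outside \<open>M\<close>, whose chain inequality bounds the sum of the two
      constants.\<close>
    let ?X = "(?L - M) \<union> (?U \<inter> M)"
    have "?X \<subseteq> ?L \<union> ?U" "?X \<noteq> {}" "?X \<noteq> ?L \<union> ?U" using a0 u0 f(3) by blast+
    then obtain p q where pq: "p \<in> ?X" "q \<in> (?L \<union> ?U) - ?X" "p \<le> q \<or> q \<le> p"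
      using poset_connectedD [OF conn, of ?X] by blast
    have ne: "p \<noteq> q" using pq by blast
    have q: "q \<in> ?L \<inter> M \<or> q \<in> ?U - M" using pq(2) by blast
    have LL: False if "p \<in> ?L" "q \<in> ?L"
      using that pq(3) ne minimalsD [of p E q] minimalsD [of q E p] sub by blast
    have UU: False if "p \<in> ?U" "q \<in> ?U"
      using that pq(3) ne maximalsD [of p E q] maximalsD [of q E p] sub by blast
    have MM: False if "p \<in> M" "q \<in> M"
      using that pq(3) ne antichainsD [OF f(5), of p q] antichainsD [OF f(5), of q p] by blast
    have p: "p \<in> ?L - M" and q': "q \<in> ?U - M" using pq(1) q LL UU MM by blast+
    have "\<not> q \<le> p" using minimalsD [of p E q] p q' sub ne by blast
    then have "p < q" using pq(3) ne by (auto simp: less_le)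
    moreover have "p \<in> P" "q \<in> P" using p q' sub EP by auto
    ultimately have "y $ p + y $ q \<le> 1" using chain_polytope_sum_le [OF yS, of "[p, q]"] by simp
    then show ?thesis using s [OF p] t [OF q'] by simp
  qed
  then have coeff: "0 \<le> 1 - y $ a0 - y $ u0" "0 \<le> y $ a0" "0 \<le> y $ u0"
    "y $ a0 + (1 - y $ a0 - y $ u0) + y $ u0 = 1" using nonneg by auto
  \<comment> \<open>The middle weight is the value that \<open>yM\<close> forces on elements of
    \<open>M\<close> that are neither minimal nor maximal.\<close>
  let ?v = "y $ a0 *\<^sub>R ind (S \<union> ?L) + (1 - y $ a0 - y $ u0) *\<^sub>R ind (S \<union> M) + y $ u0 *\<^sub>R ind (S \<union> ?U)"
  have eq: "y $ p = ?v $ p" for p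
  proof (cases "p \<in> S")
    case True
    then show ?thesis using y_S by simp
  next
    case False
    consider "p \<in> ?L" "p \<in> M" "p \<notin> ?U" | "p \<in> ?L" "p \<notin> M" "p \<notin> ?U" | "p \<in> ?U" "p \<in> M" "p \<notin> ?L"
      | "p \<in> ?U" "p \<notin> M" "p \<notin> ?L" | "p \<in> M" "p \<notin> ?L" "p \<notin> ?U" | "p \<notin> ?L" "p \<notin> M" "p \<notin> ?U"
      using f(3) by blast
    then show ?thesis
    proof cases
      case 1
      then show ?thesis using False yML [of p] by simp
    next
      case 2
      then show ?thesis using False s [of p] by simp
    next
      case 3
      then show ?thesis using False yMU [of p] by simp
    next
      case 4
      then show ?thesis using False t [of p] by simp
    next
      case 5
      then show ?thesis using False yM [of p] by simp
    next
      case 6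
      then show ?thesis using False y_out [of p] by simp
    qed
  qed
  have "y = ?v" unfolding vec_eq_iff by (intro allI eq)
  then have "y \<in> convex hull {ind (S \<union> ?L), ind (S \<union> M), ind (S \<union> ?U)}"
    using coeff unfolding convex_hull_3 by blast
  then show "y \<in> hull01 (antichain_triangle (E, M, S))" unfolding hull01_def T by simp
qed

lemma f2_triangle_chain_polytope:
  fixes P :: "'a::{finite,order} set"
  shows "f2_triangle (chain_polytope P) =
    (\<Sum>E\<in>triangle_regions P. card (chain_splits E) * card (antichains (incomp_part P E)))"
proof -
  interpret zero_one_polytope "chain_polytope P" "antichains P" by (rule zero_one_chain_polytope)
  have "f2_triangle (chain_polytope P) = card (antichain_triangle ` antichain_triangle_data P)"
  proof (rule f2_triangle_eq)
    fix \<W> assume "\<W> \<in> antichain_triangle ` antichain_triangle_data P"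
    then obtain E M S where d: "(E, M, S) \<in> antichain_triangle_data P" and W: "\<W> = antichain_triangle (E, M, S)"
      by auto
    note f = antichain_triangle_facts [OF d]
    have EP: "E \<subseteq> P" using f(1) unfolding order_convex_def by simp
    have anti: "S \<union> minimals E \<in> antichains P" "S \<union> M \<in> antichains P" "S \<union> maximals E \<in> antichains P"
      using antichains_incomp_Un [OF f(9) _ EP] f(5) antichains_minimals antichains_maximals by auto
    have "minimals E \<noteq> maximals E" using f(3,4) by blast
    then have "S \<union> minimals E \<noteq> S \<union> M" "S \<union> minimals E \<noteq> S \<union> maximals E" "S \<union> M \<noteq> S \<union> maximals E"
      using f(8,10-12) minimals_subset [of E] maximals_subset [of E] by blast+
    then have "card \<W> = 3" unfolding W antichain_triangle_def prod.case by (intro card_three)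
    moreover have "\<W> \<subseteq> antichains P" using anti unfolding W antichain_triangle_def by simp
    ultimately show "\<W> \<subseteq> antichains P \<and> card \<W> = 3 \<and> tight_hull (chain_polytope P) (ind ` \<W>) \<subseteq> hull01 \<W>"
      using tight_antichain_triangle [OF d] unfolding W by blast
  qed (rule connected_antichains_triangle)
  also have "\<dots> = card (antichain_triangle_data P)" by (rule card_image [OF inj_antichain_triangle])
  finally show ?thesis unfolding card_antichain_triangle_data .
qed

lemma f2_square_chain_polytope:
  fixes P :: "'a::{finite,order} set"
  shows "f2_square (chain_polytope P) = (\<Sum>E\<in>square_regions P. card (antichains (incomp_part P E)))"
  unfolding zero_one_polytope.f2_square_eq [OF zero_one_chain_polytope] card_antichain_squares
  by (simp add: card_SigmaI)

section \<open>A copy of X forces strictness\<close>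

text \<open>In the convex hull of the four outer elements these are exactly the minimal and maximal
  ones, and the relations through \<open>e\<close> connect them.\<close>

lemma X_region:
  fixes P :: "'a::{finite,order} set"
  assumes P: "d1 \<in> P" "d2 \<in> P" "e \<in> P" "u1 \<in> P" "u2 \<in> P"
    and X: "d1 < e" "d2 < e" "e < u1" "e < u2" "incomparable d1 d2" "incomparable u1 u2"
  obtains E where "E \<in> triangle_regions P" "minimals E = {d1, d2}" "maximals E = {u1, u2}" "e \<in> E"
proof -
  let ?T = "{d1, d2, u1, u2}"
  let ?E = "order_hull P ?T"
  have lt: "d1 < u1" "d1 < u2" "d2 < u1" "d2 < u2" using X by (auto intro: less_trans)
  have ninc: "\<not> d1 \<le> d2" "\<not> d2 \<le> d1" "\<not> u1 \<le> u2" "\<not> u2 \<le> u1"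
    using X unfolding incomparable_def by auto
  have nle: "\<not> u1 \<le> d1" "\<not> u1 \<le> d2" "\<not> u2 \<le> d1" "\<not> u2 \<le> d2"
    using lt by (auto simp: less_le_not_le)
  have TP: "?T \<subseteq> P" using P by simp
  have "minimals ?T = {d1, d2}" unfolding minimals_def using lt ninc nle by (auto dest: less_imp_le)
  then have min: "minimals ?E = {d1, d2}" using minimals_order_hull [OF finite TP] by simp
  have "maximals ?T = {u1, u2}" unfolding maximals_def using lt ninc nle by (auto dest: less_imp_le)
  then have max: "maximals ?E = {u1, u2}" using maximals_order_hull [OF finite TP] by simp
  have "poset_connected ?T"
  proof (rule poset_connectedI)
    fix Y assume Y: "Y \<subseteq> ?T" "Y \<noteq> {}" "Y \<noteq> ?T"
    have le: "d1 \<le> u1" "d1 \<le> u2" "d2 \<le> u1" "d2 \<le> u2" using lt by auto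
    show "\<exists>p\<in>Y. \<exists>q\<in>?T - Y. p \<le> q \<or> q \<le> p"
    proof (rule ccontr)
      assume no: "\<not> ?thesis"
      have "d1 \<in> Y \<longleftrightarrow> u1 \<in> Y" "d1 \<in> Y \<longleftrightarrow> u2 \<in> Y" "d2 \<in> Y \<longleftrightarrow> u1 \<in> Y"
        using no le by blast+
      then show False using Y by blast
    qed
  qed simp
  moreover have "boundary ?E = ?T" unfolding boundary_def min max by auto
  ultimately have "poset_connected ?E" using poset_connected_boundary [of ?E] by simp
  moreover have "minimals ?E \<inter> maximals ?E = {}" unfolding min max using lt by auto
  ultimately have "?E \<in> triangle_regions P"
    using order_convex_order_hull unfolding triangle_regions_def by blast
  moreover have "e \<in> ?E" unfolding order_hull_def using P X by (auto intro: less_imp_le)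
  ultimately show thesis using that min max by blast
qed

theorem theorem6p1:
  fixes P :: "'a::{finite,order} set"
  shows "f2 (order_polytope P) = f2_triangle (order_polytope P) + f2_square (order_polytope P) \<and>
    f2_triangle (order_polytope P) + f2_square (order_polytope P)
      \<le> f2_triangle (chain_polytope P) + f2_square (chain_polytope P) \<and>
    f2_triangle (chain_polytope P) + f2_square (chain_polytope P) = f2 (chain_polytope P) \<and>
    (f2_triangle (order_polytope P) + f2_square (order_polytope P)
      = f2_triangle (chain_polytope P) + f2_square (chain_polytope P) \<longleftrightarrow> X_free P)"
proof -
  have sq: "f2_square (order_polytope P) = f2_square (chain_polytope P)"
    by (simp add: f2_square_order_polytope f2_square_chain_polytope)
  let ?a = "\<lambda>E. card (antichains (incomp_part P E))"
  have disj: "minimals E \<inter> maximals E = {}" "E \<subseteq> P" if "E \<in> triangle_regions P" for E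
    using that unfolding triangle_regions_def order_convex_def by auto
  have le: "card (order_splits E) * ?a E \<le> card (chain_splits E) * ?a E"
    if "E \<in> triangle_regions P" for E
    using card_order_splits_le [of E] disj [OF that] by simp
  have tri: "f2_triangle (order_polytope P) \<le> f2_triangle (chain_polytope P)"
    unfolding f2_triangle_order_polytope f2_triangle_chain_polytope by (intro sum_mono le)
  have "f2_triangle (order_polytope P) = f2_triangle (chain_polytope P) \<longleftrightarrow> X_free P"
  proof
    assume free: "X_free P"
    show "f2_triangle (order_polytope P) = f2_triangle (chain_polytope P)"
      unfolding f2_triangle_order_polytope f2_triangle_chain_polytope
    proof (intro sum.cong refl)
      fix E assume "E \<in> triangle_regions P"
      then show "card (order_splits E) * ?a E = card (chain_splits E) * ?a E"
        using card_order_splits_eq [of E P] disj free by simp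
    qed
  next
    assume eq: "f2_triangle (order_polytope P) = f2_triangle (chain_polytope P)"
    show "X_free P"
    proof (rule ccontr)
      assume "\<not> X_free P"
      then obtain d1 d2 e u1 u2 where P: "d1 \<in> P" "d2 \<in> P" "e \<in> P" "u1 \<in> P" "u2 \<in> P"
        and X: "d1 < e" "d2 < e" "e < u1" "e < u2" "incomparable d1 d2" "incomparable u1 u2"
        unfolding X_free_def by blast
      obtain E where E: "E \<in> triangle_regions P" "minimals E = {d1, d2}" "maximals E = {u1, u2}" "e \<in> E"
        using X_region [OF P X] by blast
      have "card (order_splits E) < card (chain_splits E)"
        using card_order_splits_less [OF _ E(2-4) X] by simp
      \<comment> \<open>The weight of the region is positive, so strictness for the splits is not
        lost in the product.\<close>
      moreover have "{} \<in> antichains (incomp_part P E)" unfolding antichains_def by simp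
      then have "0 < ?a E" by (auto simp: card_gt_0_iff)
      ultimately have "card (order_splits E) * ?a E < card (chain_splits E) * ?a E" by simp
      then have "f2_triangle (order_polytope P) < f2_triangle (chain_polytope P)"
        unfolding f2_triangle_order_polytope f2_triangle_chain_polytope
        using E(1) by (intro sum_strict_mono_ex1 ballI le) auto
      then show False using eq by simp
    qed
  qed
  then show ?thesis
    using sq tri zero_one_polytope.f2_eq [OF zero_one_order_polytope [of P]]
      zero_one_polytope.f2_eq [OF zero_one_chain_polytope [of P]] by simp
qed

end
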